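(* For every $c\in\mathbb{N}$, the one-step graded ideal zeta function of $\mathfrak{f}_{c,2}(\mathbb{F}_p)$ is uniformly given by a polynomial in $p$; that is, there exists a polynomial $W_c(X,Y)\in\mathbb{Q}[X,Y]$ such that for all but finitely many primes $p$, $$\zeta_{\mathfrak{f}_{c,2}(\mathbb{F}_p)}^{\triangleleft_1}(s)=W_c(p,p^{-s}).$$
   Context: $\mathbb{N}=\{1,2,\dots\}$ and $[n]=\{1,\dots,n\}$. $\mathfrak{f}_{c,2}(\mathbb{F}_p)$ is the free nilpotent Lie algebra of class $c$ on $2$ generators $X_1,X_2$ over $\mathbb{F}_p$. Write $L=\mathfrak{f}_{c,2}(\mathbb{F}_p)=L_1\oplus\cdots\oplus L_c$, where $L_k$ is the homogeneous component of degree $k$ (spanned by Lie monomials of degree $k$ in $X_1,X_2$), equivalently $L_k\cong\gamma_k(L)/\gamma_{k+1}(L)$ with $\gamma_k$ the lower central series. For $n\leq c$ and $k\in[c-n]$, an ideal $I$ of $L$ is an $n$-step graded ideal (at level $k$), written $I\triangleleft_{k,n}L$, if it is of the form $$I=\underbrace{0\oplus\cdots\oplus0}_{k-1}\oplus I_{k}\oplus I_{k+1}\oplus\cdots\oplus I_{k+n}\oplus L_{k+n+1}\oplus\cdots\oplus L_{c},$$ with subspaces $I_{k}\leq L_{k},\ldots,I_{k+n}\leq L_{k+n}$. The $n$-step graded ideal zeta function is $$\zeta_{L}^{\triangleleft_n}(s)=\sum_{k=1}^{c-n}\ \sum_{I\triangleleft_{k,n}L}|L_{k}:I_{k}|^{-s}\cdots|L_{k+n}:I_{k+n}|^{-s};$$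 the one-step graded ideal zeta function is the case $n=1$. *)

theory Defs
  imports
    "HOL-Algebra.QuotRing"
    "HOL-Algebra.Module"
    "HOL-Number_Theory.Residues"
    "HOL-Computational_Algebra.Polynomial"
    "HOL-Analysis.Complex_Transcendental"
begin

section \<open>Non-associative algebras\<close>

text \<open>
  An algebra over a field \<open>K\<close> is represented by a record of type \<open>module\<close>, whose field
  \<open>mult\<close> holds the (bilinear, in general non-associative) product; for a Lie algebra, \<open>mult\<close> is
  the bracket.  There is no unit: the record field \<open>one\<close> carries no meaning here.
\<close>

definition lin_span :: "('k, 'm) ring_scheme \<Rightarrow> ('k, 'a, 'n) module_scheme \<Rightarrow> 'a set \<Rightarrow> 'a set"
  where "lin_span K A S = \<Inter>{H. submodule H K A \<and> S \<subseteq> H}"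

definition alg_ideal :: "('k, 'm) ring_scheme \<Rightarrow> ('k, 'a, 'n) module_scheme \<Rightarrow> 'a set \<Rightarrow> bool"
  where "alg_ideal K A I \<longleftrightarrow>
    submodule I K A \<and>
    (\<forall>a\<in>carrier A. \<forall>x\<in>I. a \<otimes>\<^bsub>A\<^esub> x \<in> I \<and> x \<otimes>\<^bsub>A\<^esub> a \<in> I)"

definition gen_alg_ideal :: "('k, 'm) ring_scheme \<Rightarrow> ('k, 'a, 'n) module_scheme \<Rightarrow> 'a set \<Rightarrow> 'a set"
  where "gen_alg_ideal K A S = \<Inter>{I. alg_ideal K A I \<and> S \<subseteq> I}"

text \<open>The quotient algebra of cosets: as \<^const>\<open>FactRing\<close>, with the induced scalar multiplication.\<close>

definition quot_alg :: "('k, 'a, 'n) module_scheme \<Rightarrow> 'a set \<Rightarrow> ('k, 'a set) module"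
  where "quot_alg A I =
    \<lparr>carrier = a_rcosets\<^bsub>A\<^esub> I, monoid.mult = rcoset_mult A I,
     one = I +>\<^bsub>A\<^esub> \<one>\<^bsub>A\<^esub>, zero = I, add = set_add A,
     module.smult = (\<lambda>a X. \<Union>x\<in>X. I +>\<^bsub>A\<^esub> (a \<odot>\<^bsub>A\<^esub> x))\<rparr>"

text \<open>
  \<open>lower_central K L i\<close> is the term $\gamma_{i+1}(L)$ of the lower central series:
  $\gamma_1(L) = L$ and $\gamma_{i+1}(L) = [\gamma_i(L), L]$.
\<close>

primrec lower_central ::
    "('k, 'm) ring_scheme \<Rightarrow> ('k, 'a, 'n) module_scheme \<Rightarrow> nat \<Rightarrow> 'a set" where
  "lower_central K L 0 = carrier L"
| "lower_central K L (Suc i) =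
     lin_span K L {x \<otimes>\<^bsub>L\<^esub> y | x y. x \<in> lower_central K L i \<and> y \<in> carrier L}"


section \<open>Free and free nilpotent Lie algebras\<close>

text \<open>The free magma on a set of generators (all elements of the type \<open>'x\<close>).\<close>

datatype 'x magma = Gen 'x | Br "'x magma" "'x magma"

primrec degree_magma :: "'x magma \<Rightarrow> nat" where
  "degree_magma (Gen x) = 1"
| "degree_magma (Br u v) = degree_magma u + degree_magma v"

text \<open>
  The free non-associative algebra: the vector space with basis the free magma, with the
  bilinear product that extends \<^const>\<open>Br\<close>.
\<close>

definition free_alg :: "('k, 'm) ring_scheme \<Rightarrow> ('k, 'x magma \<Rightarrow> 'k) module"
  where "free_alg K =
    \<lparr>carrier = {f. (\<forall>w. f w \<in> carrier K) \<and> finite {w. f w \<noteq> \<zero>\<^bsub>K\<^esub>}},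
     monoid.mult = (\<lambda>f g w. case w of Gen x \<Rightarrow> \<zero>\<^bsub>K\<^esub> | Br u v \<Rightarrow> f u \<otimes>\<^bsub>K\<^esub> g v),
     one = (\<lambda>w. \<zero>\<^bsub>K\<^esub>),
     zero = (\<lambda>w. \<zero>\<^bsub>K\<^esub>),
     add = (\<lambda>f g w. f w \<oplus>\<^bsub>K\<^esub> g w),
     module.smult = (\<lambda>a f w. a \<otimes>\<^bsub>K\<^esub> f w)\<rparr>"

definition free_alg_gen :: "('k, 'm) ring_scheme \<Rightarrow> 'x \<Rightarrow> 'x magma \<Rightarrow> 'k"
  where "free_alg_gen K x = (\<lambda>w. if w = Gen x then \<one>\<^bsub>K\<^esub> else \<zero>\<^bsub>K\<^esub>)"

definition lie_relators :: "('k, 'a, 'n) module_scheme \<Rightarrow> 'a set"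
  where "lie_relators A =
    {x \<otimes>\<^bsub>A\<^esub> x | x. x \<in> carrier A} \<union>
    {(x \<otimes>\<^bsub>A\<^esub> y) \<otimes>\<^bsub>A\<^esub> z \<oplus>\<^bsub>A\<^esub> (y \<otimes>\<^bsub>A\<^esub> z) \<otimes>\<^bsub>A\<^esub> x \<oplus>\<^bsub>A\<^esub> (z \<otimes>\<^bsub>A\<^esub> x) \<otimes>\<^bsub>A\<^esub> y
      | x y z. x \<in> carrier A \<and> y \<in> carrier A \<and> z \<in> carrier A}"

definition lie_relation_ideal :: "('k, 'm) ring_scheme \<Rightarrow> ('x magma \<Rightarrow> 'k) set"
  where "lie_relation_ideal K = gen_alg_ideal K (free_alg K) (lie_relators (free_alg K))"

definition free_lie :: "('k, 'm) ring_scheme \<Rightarrow> ('k, ('x magma \<Rightarrow> 'k) set) module"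
  where "free_lie K = quot_alg (free_alg K) (lie_relation_ideal K)"

definition free_lie_gen :: "('k, 'm) ring_scheme \<Rightarrow> 'x \<Rightarrow> ('x magma \<Rightarrow> 'k) set"
  where "free_lie_gen K x = lie_relation_ideal K +>\<^bsub>free_alg K\<^esub> free_alg_gen K x"

text \<open>$F / \gamma_{c+1}(F)$ for the free Lie algebra $F$ on the generators \<open>'x\<close>.\<close>

definition free_nilpotent_lie ::
    "('k, 'm) ring_scheme \<Rightarrow> nat \<Rightarrow> ('k, ('x magma \<Rightarrow> 'k) set set) module"
  where "free_nilpotent_lie K c = quot_alg (free_lie K) (lower_central K (free_lie K) c)"

definition free_nilpotent_lie_gen ::
    "('k, 'm) ring_scheme \<Rightarrow> nat \<Rightarrow> 'x \<Rightarrow> ('x magma \<Rightarrow> 'k) set set"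
  where "free_nilpotent_lie_gen K c x =
    lower_central K (free_lie K) c +>\<^bsub>free_lie K\<^esub> free_lie_gen K x"

primrec lie_monomial :: "('k, 'a, 'n) module_scheme \<Rightarrow> ('x \<Rightarrow> 'a) \<Rightarrow> 'x magma \<Rightarrow> 'a" where
  "lie_monomial L X (Gen x) = X x"
| "lie_monomial L X (Br u v) = lie_monomial L X u \<otimes>\<^bsub>L\<^esub> lie_monomial L X v"

definition homogeneous_component ::
    "('k, 'm) ring_scheme \<Rightarrow> ('k, 'a, 'n) module_scheme \<Rightarrow> ('x \<Rightarrow> 'a) \<Rightarrow> nat \<Rightarrow> 'a set"
  where "homogeneous_component K L X k =
    lin_span K L (lie_monomial L X ` {w. degree_magma w = k})"


section \<open>Graded ideal zeta functions\<close>

text \<open>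
  In this section \<open>D 1, \<dots>, D c\<close> are the homogeneous components of the graded Lie algebra \<open>L\<close>.
\<close>

definition component_sum ::
    "('k, 'a, 'n) module_scheme \<Rightarrow> nat \<Rightarrow> (nat \<Rightarrow> 'a set) \<Rightarrow> 'a set"
  where "component_sum L c E = {(\<Oplus>\<^bsub>L\<^esub>j\<in>{1..c}. y j) | y. \<forall>j\<in>{1..c}. y j \<in> E j}"

definition step_graded_ideal ::
    "('k, 'm) ring_scheme \<Rightarrow> ('k, 'a, 'n) module_scheme \<Rightarrow> (nat \<Rightarrow> 'a set) \<Rightarrow> nat \<Rightarrow>
     nat \<Rightarrow> nat \<Rightarrow> 'a set \<Rightarrow> bool"
  where "step_graded_ideal K L D c k n I \<longleftrightarrow>
    alg_ideal K L I \<and>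
    (\<exists>J. (\<forall>j\<in>{k..k+n}. submodule (J j) K L \<and> J j \<subseteq> D j) \<and>
         I = component_sum L c (\<lambda>j. if j < k then {\<zero>\<^bsub>L\<^esub>} else if j \<le> k + n then J j else D j))"

text \<open>The index $|M : N|$ of additive subgroups $N \le M$ of \<open>L\<close>.\<close>

definition add_index :: "('k, 'a, 'n) module_scheme \<Rightarrow> 'a set \<Rightarrow> 'a set \<Rightarrow> nat"
  where "add_index L M N = card (a_rcosets\<^bsub>L\<lparr>carrier := M\<rparr>\<^esub> N)"

text \<open>
  As the sum of the \<open>D j\<close> is direct, the component $I_j$ of a graded ideal $I$ is
  \<open>I \<inter> D j\<close>.
\<close>

definition step_ideal_zeta ::
    "('k, 'm) ring_scheme \<Rightarrow> ('k, 'a, 'n) module_scheme \<Rightarrow> (nat \<Rightarrow> 'a set) \<Rightarrow> nat \<Rightarrow>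
     nat \<Rightarrow> complex \<Rightarrow> complex"
  where "step_ideal_zeta K L D c n s =
    (\<Sum>k=1..c - n. \<Sum>I | step_graded_ideal K L D c k n I.
       \<Prod>j=k..k+n. of_nat (add_index L (D j) (I \<inter> D j)) powr (- s))"

datatype two_generators = X1 | X2

text \<open>The $n$-step graded ideal zeta function of $\mathfrak{f}_{c,2}(\mathbb{F}_p)$.\<close>

definition zeta_f2 :: "nat \<Rightarrow> nat \<Rightarrow> nat \<Rightarrow> complex \<Rightarrow> complex"
  where "zeta_f2 c p n s =
    (let K = residue_ring (int p);
         L = free_nilpotent_lie K c;
         X = (free_nilpotent_lie_gen K c :: two_generators \<Rightarrow> _)
     in step_ideal_zeta K L (homogeneous_component K L X) c n s)"

text \<open>
  A polynomial in $\mathbb{Q}[X,Y]$ is an element of $\mathbb{Q}[X][Y]$, evaluated here at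
  complex \<open>(x, y)\<close>.
\<close>

definition eval_XY :: "rat poly poly \<Rightarrow> complex \<Rightarrow> complex \<Rightarrow> complex"
  where "eval_XY W x y = poly (map_poly (\<lambda>q. poly (map_poly of_rat q) x) W) y"

end

theory Submission
  imports Defs "HOL-Library.Function_Algebras"
begin

text \<open>A one-step graded ideal at level \<open>k\<close> is a pair of subspaces \<open>U \<le> L\<^sub>k\<close> and \<open>U' \<le> L\<^sub>k\<^sub>+\<^sub>1\<close> such
  that \<open>[U, x] \<subseteq> U'\<close> and \<open>[U, y] \<subseteq> U'\<close>, where \<open>x\<close> and \<open>y\<close> are the two generators: everything below
  level \<open>k\<close> is zero, everything above level \<open>k + 1\<close> is full, and a bracket with an element of degree
  at least two leaves the window.  So for every pair of dimensions one has to count the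
  subrepresentations of the pair of linear maps \<open>[-, x], [-, y] : L\<^sub>k \<rightrightarrows> L\<^sub>k\<^sub>+\<^sub>1\<close>, and the claim is that
  this number is a polynomial in \<open>p\<close>.

  The tool is a reflection.  Given \<open>\<alpha>, \<beta> : V1 \<rightrightarrows> V0\<close>, let \<open>V2\<close> consist of the relations
  \<open>\<beta> u = \<alpha> u'\<close> with \<open>u, u' \<in> V1\<close>; its two projections form a pair of maps \<open>V2 \<rightrightarrows> V1\<close>.  For
  \<open>U \<le> V1\<close> the dimension of the space \<open>\<alpha> U + \<beta> U\<close> is \<open>2 dim U - d\<close>, where \<open>d\<close> is the dimension of the
  space of relations inside \<open>U\<close>.  Hence the counts for \<open>V1 \<rightrightarrows> V0\<close> are combinations, with Gaussian
  binomials as coefficients, of the numbers of \<open>U\<close> with given \<open>dim U\<close> and \<open>d\<close>; and these numbers are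
  obtained from the counts for \<open>V2 \<rightrightarrows> V1\<close> by inverting a unitriangular matrix of Gaussian binomials
  (\<open>poly_on_subreps_reflection\<close>).  Iterating, the spaces become spaces of chains
  \<open>a\<^sub>0, \<dots>, a\<^sub>i\<close> with \<open>\<beta> a\<^sub>j = \<alpha> a\<^sub>j\<^sub>+\<^sub>1\<close>, and polynomiality follows as soon as long chains are zero and all
  the dimensions involved do not depend on \<open>p\<close> (\<open>poly_on_subreps_chains\<close>).

  Long chains are zero for \<open>k \<ge> 2\<close> because the bracket with a generator is injective on \<open>L\<^sub>k\<close>: comparing
  the degrees in \<open>x\<close> on both sides of \<open>[a\<^sub>j, y] = [a\<^sub>j\<^sub>+\<^sub>1, x]\<close> shows that the
  degree in \<open>x\<close> of every nonzero part of \<open>a\<^sub>0\<close> is at least the number of links of the chain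
  (\<open>no_long_chains\<close>).  On \<open>L\<^sub>1\<close> injectivity fails, but there the
  pairs can be listed, since \<open>L\<^sub>2\<close> is a line.  The dimensions are independent of \<open>p\<close> for almost all \<open>p\<close>
  because the chains are described by linear systems with integer coefficients
  (\<open>card_chains_lie_polys\<close>).

  For these arguments \<open>L\<^sub>k\<close> has to be a concrete space, and one common to all primes.  A Lie polynomial is
  a function on words, with values in the subgroup of order \<open>p\<close> of \<open>\<rat>/\<int>\<close>.  That the free nilpotent Lie
  algebra of class \<open>c\<close>, which is a quotient of a quotient of the free nonassociative algebra, is
  described by such functions is the Dynkin--Specht--Wever identity: it writes \<open>k\<close> times a Lie monomial
  of degree \<open>k\<close> as a combination of left-normed monomials with the coefficients of the words as
  coefficients, and \<open>k\<close> is invertible modulo \<open>p\<close> when \<open>p > c\<close> (\<open>to_L_eq_0_iff\<close>).  The zeta function is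
  then a sum over the pairs \<open>(U, U')\<close> (\<open>step_ideal_zeta_eq\<close>).\<close>

section \<open>Integer multiples in abelian groups\<close>

text \<open>Iterated addition gives the action of \<open>\<int>\<close> also on groups such as \<open>\<rat>/\<int>\<close> that carry no
  multiplication.\<close>

definition zsmul :: "int \<Rightarrow> 'a::ab_group_add \<Rightarrow> 'a"
  where "zsmul n x =
    (if 0 \<le> n then ((+) x ^^ nat n) 0 else - (((+) x ^^ nat (- n)) 0))"

lemma zsmul_0_left [simp]: "zsmul 0 x = 0"
  by (simp add: zsmul_def)

lemma zsmul_1_left [simp]: "zsmul 1 x = x"
  by (simp add: zsmul_def)

lemma zsmul_add_1: "zsmul (n + 1) x = zsmul n x + x"
proof (cases "n \<ge> 0")
  case True
  hence "nat (n + 1) = Suc (nat n)" by simp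
  thus ?thesis using True by (simp add: zsmul_def add.commute)
next
  case False
  hence n: "nat (- n) = Suc (nat (- (n + 1)))" by simp
  show ?thesis
  proof (cases "n = -1")
    case True
    thus ?thesis by (simp add: zsmul_def)
  next
    case f: False
    with False have "n + 1 < 0" by simp
    thus ?thesis using False unfolding zsmul_def by (simp only: n if_False not_le) (simp add: algebra_simps)
  qed
qed

lemma zsmul_diff_1: "zsmul (n - 1) x = zsmul n x - x"
  using zsmul_add_1[of "n - 1" x] by simp

lemma zsmul_add_left: "zsmul (m + n) x = zsmul m x + zsmul n x"
proof (induction n rule: int_induct[where k = 0])
  case (step1 i)
  have "zsmul (m + (i + 1)) x = zsmul (m + i) x + x" using zsmul_add_1[of "m + i" x] by (simp add: add.assoc)
  thus ?case using step1 by (simp add: zsmul_add_1 add.assoc)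
next
  case (step2 i)
  have "zsmul (m + (i - 1)) x = zsmul (m + i) x - x" using zsmul_diff_1[of "m + i" x] by (simp add: algebra_simps)
  thus ?case using step2 by (simp add: zsmul_diff_1 add_diff_eq)
qed simp

lemma zsmul_minus_left: "zsmul (- n) x = - zsmul n x"
  using zsmul_add_left[of n "- n" x] by (simp add: eq_neg_iff_add_eq_0 add.commute)

lemma zsmul_diff_left: "zsmul (m - n) x = zsmul m x - zsmul n x"
  using zsmul_add_left[of m "- n" x] by (simp add: zsmul_minus_left)

lemma additive_zsmul:
  assumes "Modules.additive f"
  shows "f (zsmul n x) = zsmul n (f x)"
proof (induction n rule: int_induct[where k = 0])
  case base
  thus ?case by (simp add: additive.zero[OF assms])
next
  case (step1 i)
  thus ?case by (simp add: zsmul_add_1 additive.add[OF assms])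
next
  case (step2 i)
  thus ?case by (simp add: zsmul_diff_1 additive.diff[OF assms])
qed

lemma zsmul_add_right: "zsmul n (x + y) = zsmul n x + zsmul n y"
  by (induction n rule: int_induct[where k = 0]) (simp_all add: zsmul_add_1 zsmul_diff_1)

lemma additive_zsmul_right: "Modules.additive (zsmul n)"
  by unfold_locales (rule zsmul_add_right)

lemma zsmul_0_right [simp]: "zsmul n 0 = 0"
  by (rule additive.zero[OF additive_zsmul_right])

lemmas zsmul_minus_right = additive.minus[OF additive_zsmul_right]
lemmas zsmul_diff_right = additive.diff[OF additive_zsmul_right]
lemmas zsmul_sum_right = additive.sum[OF additive_zsmul_right]

lemma zsmul_zsmul: "zsmul m (zsmul n x) = zsmul (m * n) x"
proof (induction m rule: int_induct[where k = 0])
  case (step1 i)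
  thus ?case by (simp add: zsmul_add_1 zsmul_add_left distrib_right)
next
  case (step2 i)
  thus ?case by (simp add: zsmul_diff_1 zsmul_diff_left left_diff_distrib)
qed simp

lemma zsmul_apply: "zsmul n f i = zsmul n (f i)" for f :: "'a \<Rightarrow> 'b::ab_group_add"
proof -
  have "Modules.additive (\<lambda>f :: 'a \<Rightarrow> 'b. f i)" by unfold_locales simp
  from additive_zsmul[OF this] show ?thesis by simp
qed

lemma zsmul_int: "zsmul n k = n * k" for k :: int
  by (induction n rule: int_induct[where k = 0]) (simp_all add: zsmul_add_1 zsmul_diff_1 algebra_simps)

section \<open>Finite elementary abelian subgroups\<close>

definition subgrp :: "'a::ab_group_add set \<Rightarrow> bool"
  where "subgrp H \<longleftrightarrow> 0 \<in> H \<and> (\<forall>x\<in>H. \<forall>y\<in>H. x - y \<in> H)"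

lemma subgrpI: "0 \<in> H \<Longrightarrow> (\<And>x y. x \<in> H \<Longrightarrow> y \<in> H \<Longrightarrow> x - y \<in> H) \<Longrightarrow> subgrp H"
  by (simp add: subgrp_def)

lemma subgrp_0: "subgrp H \<Longrightarrow> 0 \<in> H"
  by (simp add: subgrp_def)

lemma subgrp_diff: "subgrp H \<Longrightarrow> x \<in> H \<Longrightarrow> y \<in> H \<Longrightarrow> x - y \<in> H"
  by (simp add: subgrp_def)

lemma subgrp_minus: "subgrp H \<Longrightarrow> x \<in> H \<Longrightarrow> - x \<in> H"
  using subgrp_diff[of H 0 x] by (simp add: subgrp_0)

lemma subgrp_add: "subgrp H \<Longrightarrow> x \<in> H \<Longrightarrow> y \<in> H \<Longrightarrow> x + y \<in> H"
  using subgrp_diff[of H x "- y"] by (simp add: subgrp_minus)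

lemma subgrp_zsmul: "subgrp H \<Longrightarrow> x \<in> H \<Longrightarrow> zsmul n x \<in> H"
  by (induction n rule: int_induct[where k = 0])
     (simp_all add: zsmul_add_1 zsmul_diff_1 subgrp_0 subgrp_add subgrp_diff)

lemma subgrp_sum: "subgrp H \<Longrightarrow> (\<And>i. i \<in> S \<Longrightarrow> f i \<in> H) \<Longrightarrow> sum f S \<in> H"
  by (induction S rule: infinite_finite_induct) (auto simp: subgrp_0 subgrp_add)

lemma subgrp_Int: "subgrp G \<Longrightarrow> subgrp H \<Longrightarrow> subgrp (G \<inter> H)"
  by (auto simp: subgrp_def)

lemma subgrp_Times: "subgrp G \<Longrightarrow> subgrp H \<Longrightarrow> subgrp (G \<times> H)"
  by (auto simp: subgrp_def zero_prod_def)

lemma subgrp_singleton_0: "subgrp {0}"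
  by (simp add: subgrp_def)

lemma subgrp_image: "Modules.additive f \<Longrightarrow> subgrp H \<Longrightarrow> subgrp (f ` H)"
  by (auto simp: subgrp_def additive.diff[symmetric] intro: rev_image_eqI simp: additive.zero)

lemma subgrp_vimage: "Modules.additive f \<Longrightarrow> subgrp H \<Longrightarrow> subgrp {v. f v \<in> H}"
  by (auto simp: subgrp_def additive.diff additive.zero)

lemma card_additive_image:
  assumes f: "Modules.additive f" and G: "subgrp G" "finite G"
  shows "card G = card (f ` G) * card {v \<in> G. f v = 0}"
proof -
  have "card {v \<in> G. f v = y} = card {v \<in> G. f v = 0}" if "y \<in> f ` G" for y
  proof -
    from that obtain w where w: "w \<in> G" "y = f w" by blast
    have "bij_betw (\<lambda>v. v - w) {v \<in> G. f v = y} {v \<in> G. f v = 0}"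
      by (rule bij_betw_byWitness[where f' = "\<lambda>v. v + w"])
         (use w in \<open>auto simp: additive.diff[OF f] additive.add[OF f] G subgrp_diff subgrp_add\<close>)
    thus ?thesis by (rule bij_betw_same_card)
  qed
  hence "(\<Sum>y\<in>f ` G. card {v \<in> G. f v = y}) = card (f ` G) * card {v \<in> G. f v = 0}"
    by simp
  moreover have "card G = (\<Sum>y\<in>f ` G. card {v \<in> G. f v = y})"
  proof -
    have "G = (\<Union>y\<in>f ` G. {v \<in> G. f v = y})" by blast
    hence "card G = card (\<Union>y\<in>f ` G. {v \<in> G. f v = y})" by simp
    also have "\<dots> = (\<Sum>y\<in>f ` G. card {v \<in> G. f v = y})"
      by (rule card_UN_disjoint) (use G in auto)
    finally show ?thesis .
  qed
  ultimately show ?thesis by simp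
qed

text \<open>An elementary abelian \<open>p\<close>-group is the same thing as a vector space over $\mathbb{F}_p$;
  since $\mathbb{F}_p$ is a prime field, its subgroups are exactly the subspaces.  This is what
  allows all the primes to be treated in one ambient type.\<close>

definition elementary :: "nat \<Rightarrow> 'a::ab_group_add set \<Rightarrow> bool"
  where "elementary p V \<longleftrightarrow> subgrp V \<and> finite V \<and> (\<forall>v\<in>V. zsmul (int p) v = 0)"

lemma elementary_subgrp: "elementary p V \<Longrightarrow> subgrp V"
  and elementary_finite: "elementary p V \<Longrightarrow> finite V"
  and elementary_zsmul: "elementary p V \<Longrightarrow> v \<in> V \<Longrightarrow> zsmul (int p) v = 0"
  by (auto simp: elementary_def)

lemma elementary_subset: "elementary p V \<Longrightarrow> subgrp H \<Longrightarrow> H \<subseteq> V \<Longrightarrow> elementary p H"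
  by (auto simp: elementary_def intro: finite_subset)

lemma zsmul_mod: "zsmul (int p) v = 0 \<Longrightarrow> zsmul (n mod int p) v = zsmul n v"
proof -
  assume *: "zsmul (int p) v = 0"
  have "zsmul n v = zsmul (n div int p * int p + n mod int p) v" by simp
  also have "\<dots> = zsmul (n mod int p) v"
    unfolding zsmul_add_left zsmul_zsmul[symmetric] * by simp
  finally show ?thesis ..
qed

text \<open>Modulo \<open>H\<close> the multiples of \<open>v\<close> form a group of order dividing \<open>p\<close>, on which \<open>n\<close> is
  invertible.\<close>

lemma zsmul_mem_imp_mem:
  assumes p: "prime p" and H: "subgrp H" and v: "zsmul (int p) v \<in> H" and n: "\<not> int p dvd n"
    and nv: "zsmul n v \<in> H"
  shows "v \<in> H"
proof -
  have "coprime (int p) n" using p n by (simp add: prime_imp_coprime)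
  then obtain x y where "x * int p + y * n = 1"
    using bezout_int[of "int p" n] by (auto simp: coprime_iff_gcd_eq_1)
  hence "v = zsmul x (zsmul (int p) v) + zsmul y (zsmul n v)"
    by (simp add: zsmul_zsmul zsmul_add_left[symmetric])
  thus ?thesis using H v nv by (metis subgrp_add subgrp_zsmul)
qed

definition adjoin :: "'a::ab_group_add set \<Rightarrow> 'a \<Rightarrow> 'a set"
  where "adjoin H v = {h + zsmul i v | h i. h \<in> H}"

lemma subgrp_adjoin: "subgrp H \<Longrightarrow> subgrp (adjoin H v)"
proof (rule subgrpI)
  assume H: "subgrp H"
  show "0 \<in> adjoin H v" unfolding adjoin_def
    using subgrp_0[OF H] by (force intro: exI[of _ 0])
  fix x y assume "x \<in> adjoin H v" "y \<in> adjoin H v"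
  then obtain h i h' j where "h \<in> H" "h' \<in> H" "x = h + zsmul i v" "y = h' + zsmul j v"
    by (auto simp: adjoin_def)
  hence "x - y = (h - h') + zsmul (i - j) v" "h - h' \<in> H"
    by (auto simp: zsmul_diff_left algebra_simps intro: subgrp_diff[OF H])
  thus "x - y \<in> adjoin H v" by (auto simp: adjoin_def)
qed

lemma subset_adjoin: "H \<subseteq> adjoin H v"
  unfolding adjoin_def by (force intro: exI[of _ 0])

lemma mem_adjoin: "subgrp H \<Longrightarrow> v \<in> adjoin H v"
  unfolding adjoin_def by (force intro: exI[of _ 1] dest: subgrp_0)

lemma adjoin_subset: "subgrp G \<Longrightarrow> H \<subseteq> G \<Longrightarrow> v \<in> G \<Longrightarrow> adjoin H v \<subseteq> G"
  unfolding adjoin_def by (auto intro!: subgrp_add subgrp_zsmul)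

lemma card_adjoin:
  assumes p: "prime p" and H: "subgrp H" "finite H" and v: "zsmul (int p) v = 0" "v \<notin> H"
  shows "card (adjoin H v) = p * card H" "finite (adjoin H v)"
proof -
  let ?f = "\<lambda>(i, h). h + zsmul (int i) v"
  have inj: "inj_on ?f ({..<p} \<times> H)"
  proof (rule inj_onI, clarify)
    fix i h j k assume *: "i < p" "h \<in> H" "j < p" "k \<in> H"
      "h + zsmul (int i) v = k + zsmul (int j) v"
    hence "zsmul (int i - int j) v = k - h" by (simp add: zsmul_diff_left algebra_simps)
    hence mem: "zsmul (int i - int j) v \<in> H" using * H subgrp_diff by metis
    have "i = j"
    proof (rule ccontr)
      assume "i \<noteq> j"
      moreover have "\<bar>int i - int j\<bar> < int p" using * by linarith
      ultimately have "\<not> int p dvd int i - int j"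
        by (metis dvd_imp_le_int eq_iff_diff_eq_0 int_int_eq abs_of_nat not_le)
      from zsmul_mem_imp_mem[OF p H(1) _ this mem] v show False
        by (simp add: subgrp_0[OF H(1)])
    qed
    thus "i = j \<and> h = k" using * by simp
  qed
  have im: "?f ` ({..<p} \<times> H) = adjoin H v"
  proof
    show "?f ` ({..<p} \<times> H) \<subseteq> adjoin H v" by (auto simp: adjoin_def)
    show "adjoin H v \<subseteq> ?f ` ({..<p} \<times> H)"
    proof
      fix x assume "x \<in> adjoin H v"
      then obtain h i where h: "h \<in> H" "x = h + zsmul i v" by (auto simp: adjoin_def)
      have p0: "p > 0" using p by (simp add: prime_gt_0_nat)
      have "x = ?f (nat (i mod int p), h)" using h p0 v by (simp add: zsmul_mod)
      moreover have "nat (i mod int p) < p"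
        using p0 by (simp add: nat_less_iff)
      ultimately show "x \<in> ?f ` ({..<p} \<times> H)" using h by blast
    qed
  qed
  show "card (adjoin H v) = p * card H"
    using card_image[OF inj] by (simp add: im card_cartesian_product)
  show "finite (adjoin H v)" using H by (subst im[symmetric]) simp
qed

text \<open>A maximal proper subgroup over \<open>A\<close> is a hyperplane: adjoining any further vector gives
  everything.\<close>

lemma exists_hyperplane:
  assumes p: "prime p" and V: "elementary p V" and A: "subgrp A" "A \<subset> V"
  obtains V0 where "subgrp V0" "A \<subseteq> V0" "V0 \<subset> V" "card V = p * card V0"
proof -
  let ?S = "{H. subgrp H \<and> A \<subseteq> H \<and> H \<subset> V}"
  have "finite ?S" by (rule finite_subset[of _ "Pow V"]) (use elementary_finite[OF V] in auto)
  moreover have "A \<in> ?S" using A by auto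
  ultimately obtain V0 where V0: "V0 \<in> ?S" "\<And>H. H \<in> ?S \<Longrightarrow> V0 \<subseteq> H \<Longrightarrow> V0 = H"
    using finite_has_maximal[of ?S] by (metis (no_types, lifting) empty_iff)
  then obtain v where v: "v \<in> V" "v \<notin> V0" by auto
  have sub: "adjoin V0 v \<subseteq> V" using adjoin_subset[OF elementary_subgrp[OF V]] V0 v by blast
  have "adjoin V0 v = V"
  proof (rule ccontr)
    assume "adjoin V0 v \<noteq> V"
    hence "adjoin V0 v \<in> ?S" using V0(1) sub subset_adjoin[of V0 v] by (auto intro: subgrp_adjoin)
    from V0(2)[OF this subset_adjoin] mem_adjoin[of V0 v] V0(1) v show False by auto
  qed
  moreover have "finite V0" using V0(1) elementary_finite[OF V] by (auto intro: finite_subset)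
  ultimately have "card V = p * card V0"
    using card_adjoin(1)[OF p, of V0 v] V0(1) v elementary_zsmul[OF V] by auto
  with V0(1) that show ?thesis by auto
qed

lemma card_elementary_over:
  assumes p: "prime p" and V: "elementary p V" and A: "subgrp A" "A \<subseteq> V"
  shows "\<exists>n. card V = card A * p ^ n"
  using V A(2)
proof (induction "card V" arbitrary: V rule: less_induct)
  case less
  show ?case
  proof (cases "A = V")
    case True
    thus ?thesis by (auto intro: exI[of _ 0])
  next
    case False
    then obtain V0 where V0: "subgrp V0" "A \<subseteq> V0" "V0 \<subset> V" "card V = p * card V0"
      using exists_hyperplane[OF p less.prems(1) A(1)] less.prems(2) by auto
    have "card V0 < card V"
      by (rule psubset_card_mono[OF elementary_finite[OF less.prems(1)] V0(3)])
    from less.hyps[OF this elementary_subset[OF less.prems(1)]] V0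
    obtain n where "card V0 = card A * p ^ n" by auto
    hence "card V = card A * p ^ Suc n" using V0 by simp
    thus ?thesis by blast
  qed
qed

definition prank :: "nat \<Rightarrow> 'a set \<Rightarrow> nat"
  where "prank p V = (THE n. card V = p ^ n)"

lemma prank_eqI: "prime p \<Longrightarrow> card V = p ^ n \<Longrightarrow> prank p V = n"
  unfolding prank_def by (rule the_equality) (auto dest: prime_gt_1_nat)

lemma card_elementary:
  assumes "prime p" "elementary p V"
  shows "card V = p ^ prank p V"
  using card_elementary_over[OF assms subgrp_singleton_0] assms prank_eqI[OF assms(1), of V]
  by (auto simp: subgrp_0[OF elementary_subgrp])

section \<open>Gaussian binomial coefficients\<close>

text \<open>The recursion is the one that splits the subspaces of dimension \<open>e + 1\<close> of a space of dimension
  \<open>n + 1\<close> into those inside a fixed hyperplane and the others.  The truncation of \<open>n - e\<close> for \<open>n < e\<close> is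
  harmless since the factor \<open>gauss_binomial n e\<close> is then zero.\<close>

fun gauss_binomial :: "nat \<Rightarrow> nat \<Rightarrow> int poly" where
  "gauss_binomial 0 e = (if e = 0 then 1 else 0)"
| "gauss_binomial (Suc n) 0 = 1"
| "gauss_binomial (Suc n) (Suc e) =
     gauss_binomial n (Suc e) + monom 1 (n - e) * gauss_binomial n e"

lemma gauss_binomial_0_right [simp]: "gauss_binomial n 0 = 1"
  by (cases n) auto

lemma gauss_binomial_eq_0: "n < e \<Longrightarrow> gauss_binomial n e = 0"
  by (induction n e rule: gauss_binomial.induct) auto

lemma gauss_binomial_self [simp]: "gauss_binomial n n = 1"
  by (induction n) (auto simp: gauss_binomial_eq_0)

definition subgrps_between :: "'a::ab_group_add set \<Rightarrow> 'a set \<Rightarrow> nat \<Rightarrow> 'a set set"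
  where "subgrps_between A V m = {H. subgrp H \<and> A \<subseteq> H \<and> H \<subseteq> V \<and> card H = m}"

lemma finite_subgrps_between: "finite V \<Longrightarrow> finite (subgrps_between A V m)"
  by (rule finite_subset[of _ "Pow V"]) (auto simp: subgrps_between_def)

text \<open>Let \<open>V0\<close> be a hyperplane and \<open>v\<close> a vector outside it.  A subgroup \<open>H\<close> not contained in \<open>V0\<close> is
  determined by \<open>H \<inter> V0\<close> and by any element of \<open>H \<inter> (v + V0)\<close>, a coset of \<open>H \<inter> V0\<close>; counting pairs
  \<open>(H, w)\<close> in two ways gives the recursion of the Gaussian binomials.\<close>

lemma card_subgrps_not_in_hyperplane:
  assumes p: "prime p" and V: "elementary p V" and V0: "subgrp V0" "V0 \<subset> V" "card V = p * card V0"
    and A: "A \<subseteq> V0"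
  shows "card {H \<in> subgrps_between A V (p * m). \<not> H \<subseteq> V0} * m
       = card (subgrps_between A V0 m) * card V0"
proof -
  have finV: "finite V" and finV0: "finite V0" and sV: "subgrp V"
    using V V0 by (auto simp: elementary_def intro: finite_subset)
  have p0: "p > 0" using p by (simp add: prime_gt_0_nat)
  obtain v where v: "v \<in> V" "v \<notin> V0" using V0 by blast
  have adj: "adjoin V0 v = V"
  proof (rule card_subset_eq[OF finV])
    show "adjoin V0 v \<subseteq> V" using adjoin_subset[OF sV] V0 v by blast
    show "card (adjoin V0 v) = card V"
      using card_adjoin(1)[OF p V0(1) finV0] V0 v elementary_zsmul[OF V] by auto
  qed
  let ?W = "{w \<in> V. w - v \<in> V0}"
  let ?B = "{H \<in> subgrps_between A V (p * m). \<not> H \<subseteq> V0}"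
  have W: "card ?W = card V0"
  proof -
    have "bij_betw (\<lambda>w. w - v) ?W V0"
      by (rule bij_betw_byWitness[where f' = "\<lambda>u. u + v"]) (use v V0 sV in \<open>auto intro: subgrp_add\<close>)
    thus ?thesis by (rule bij_betw_same_card)
  qed
  have coset: "card (H \<inter> ?W) = m" "H \<inter> V0 \<in> subgrps_between A V0 m"
      "\<And>w. w \<in> H \<inter> ?W \<Longrightarrow> adjoin (H \<inter> V0) w = H" if "H \<in> ?B" for H
  proof -
    from that have H: "subgrp H" "A \<subseteq> H" "H \<subseteq> V" "card H = p * m" "\<not> H \<subseteq> V0"
      by (auto simp: subgrps_between_def)
    have finH: "finite H" using H finV by (auto intro: finite_subset)
    have sI: "subgrp (H \<inter> V0)" using H V0 by (auto intro: subgrp_Int)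
    obtain x where x: "x \<in> H" "x \<notin> V0" using H by blast
    then obtain u i where u: "u \<in> V0" "x = u + zsmul i v" using adj H(3) by (auto simp: adjoin_def)
    have i: "\<not> int p dvd i"
    proof
      assume "int p dvd i"
      then obtain j where "i = j * int p" by (metis dvdE mult.commute)
      hence "zsmul i v = 0" using elementary_zsmul[OF V v(1)] by (simp flip: zsmul_zsmul)
      thus False using u x by simp
    qed
    hence "coprime (int p) i" using p by (simp add: prime_imp_coprime)
    then obtain a b where ab: "a * int p + b * i = 1"
      using bezout_int[of "int p" i] by (auto simp: coprime_iff_gcd_eq_1)
    \<comment> \<open>The element \<open>x\<close> of \<open>H\<close> is \<open>i v\<close> modulo \<open>V0\<close>; dividing by \<open>i\<close> modulo \<open>p\<close> moves it to the coset of \<open>v\<close>.\<close>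
    define w0 where "w0 = zsmul b x"
    have "v = zsmul (a * int p + b * i) v" using ab by simp
    also have "\<dots> = zsmul b (zsmul i v)"
      unfolding zsmul_add_left zsmul_zsmul[symmetric] elementary_zsmul[OF V v(1)] by simp
    finally have "w0 - v = zsmul b u"
      unfolding w0_def u(2) zsmul_add_right by (simp add: algebra_simps)
    hence w0: "w0 \<in> H" "w0 - v \<in> V0" "w0 \<in> V"
      using H x u V0 by (auto simp: w0_def intro: subgrp_zsmul)
    have adjH: "adjoin (H \<inter> V0) w = H" if w: "w \<in> H \<inter> ?W" for w
    proof
      show "adjoin (H \<inter> V0) w \<subseteq> H" using adjoin_subset[OF H(1)] w by blast
      show "H \<subseteq> adjoin (H \<inter> V0) w"
      proof
        fix y assume y: "y \<in> H"
        then obtain u j where u: "u \<in> V0" "y = u + zsmul j v" using adj H(3) by (auto simp: adjoin_def)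
        have eq: "y - zsmul j w = u - zsmul j (w - v)" using u by (simp add: zsmul_diff_right)
        have "y - zsmul j w \<in> V0" unfolding eq
          using u w V0 by (auto intro: subgrp_diff subgrp_zsmul)
        moreover have "y - zsmul j w \<in> H" using y w H by (auto intro: subgrp_diff subgrp_zsmul)
        ultimately have "y - zsmul j w + zsmul j w \<in> adjoin (H \<inter> V0) w" unfolding adjoin_def by blast
        thus "y \<in> adjoin (H \<inter> V0) w" by simp
      qed
    qed
    thus "\<And>w. w \<in> H \<inter> ?W \<Longrightarrow> adjoin (H \<inter> V0) w = H" .
    have w0': "w0 \<notin> H \<inter> V0"
    proof
      assume "w0 \<in> H \<inter> V0"
      thus False using subgrp_diff[OF V0(1), of w0 "w0 - v"] w0 v by simp
    qed
    have "card H = p * card (H \<inter> V0)"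
      using card_adjoin(1)[OF p sI _ _ w0'] adjH[of w0] w0 finH elementary_zsmul[OF V w0(3)] by auto
    hence m: "card (H \<inter> V0) = m" using H p0 by simp
    thus "H \<inter> V0 \<in> subgrps_between A V0 m" using H A sI by (auto simp: subgrps_between_def)
    have "bij_betw (\<lambda>w. w - w0) (H \<inter> ?W) (H \<inter> V0)"
    proof (rule bij_betw_byWitness[where f' = "\<lambda>u. u + w0"]; safe?)
      fix w assume "w \<in> H" "w - v \<in> V0"
      thus "w - w0 \<in> H" "w - w0 \<in> V0"
        using H w0 V0 subgrp_diff[of V0 "w - v" "w0 - v"] by (auto intro: subgrp_diff)
    next
      fix u assume "u \<in> H" "u \<in> V0"
      thus "u + w0 \<in> H" "u + w0 \<in> V" "u + w0 - v \<in> V0"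
        using H w0 V0 subgrp_add[of V0 u "w0 - v"] by (auto intro: subgrp_add simp: algebra_simps)
    qed auto
    thus "card (H \<inter> ?W) = m" using m by (auto dest: bij_betw_same_card)
  qed
  have bij: "bij_betw (\<lambda>(H, w). (H \<inter> V0, w)) (SIGMA H:?B. H \<inter> ?W) (subgrps_between A V0 m \<times> ?W)"
  proof (rule bij_betw_byWitness[where f' = "\<lambda>(H0, w). (adjoin H0 w, w)"])
    show "\<forall>a\<in>(SIGMA H:?B. H \<inter> ?W).
        (case case a of (H, w) \<Rightarrow> (H \<inter> V0, w) of (H0, w) \<Rightarrow> (adjoin H0 w, w)) = a"
      using coset(3) by auto
  next
    have "adjoin H0 w \<inter> V0 = H0" if *: "H0 \<in> subgrps_between A V0 m" "w \<in> V" "w - v \<in> V0" for H0 w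
    proof -
      from * have H0: "subgrp H0" "A \<subseteq> H0" "H0 \<subseteq> V0" "card H0 = m" by (auto simp: subgrps_between_def)
      have wV0: "w \<notin> V0" using * v V0 subgrp_diff[of V0 w "w - v"] by auto
      have "adjoin H0 w \<inter> V0 \<subseteq> H0"
      proof
        fix y assume "y \<in> adjoin H0 w \<inter> V0"
        then obtain h i where y: "y = h + zsmul i w" "h \<in> H0" "y \<in> V0" by (auto simp: adjoin_def)
        hence "zsmul i w \<in> V0" using H0 V0 subgrp_diff[of V0 y h] by auto
        hence "int p dvd i"
          using zsmul_mem_imp_mem[OF p V0(1), of w i] wV0 elementary_zsmul[OF V *(2)] V0
          by (auto simp: subgrp_0)
        then obtain j where "i = j * int p" by (metis dvdE mult.commute)
        hence "zsmul i w = 0" using elementary_zsmul[OF V *(2)] by (simp flip: zsmul_zsmul)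
        thus "y \<in> H0" using y by simp
      qed
      thus ?thesis using H0 subset_adjoin by blast
    qed
    thus "\<forall>a\<in>subgrps_between A V0 m \<times> ?W.
        (case case a of (H0, w) \<Rightarrow> (adjoin H0 w, w) of (H, w) \<Rightarrow> (H \<inter> V0, w)) = a"
      by auto
  next
    show "(\<lambda>(H, w). (H \<inter> V0, w)) ` (SIGMA H:?B. H \<inter> ?W) \<subseteq> subgrps_between A V0 m \<times> ?W"
      using coset(2) by auto
    show "(\<lambda>(H0, w). (adjoin H0 w, w)) ` (subgrps_between A V0 m \<times> ?W) \<subseteq> (SIGMA H:?B. H \<inter> ?W)"
    proof (rule image_subsetI)
      fix a assume "a \<in> subgrps_between A V0 m \<times> ?W"
      then obtain H0 w where a: "a = (H0, w)" and *: "H0 \<in> subgrps_between A V0 m" "w \<in> V" "w - v \<in> V0"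
        by auto
      hence H0: "subgrp H0" "A \<subseteq> H0" "H0 \<subseteq> V0" "card H0 = m" by (auto simp: subgrps_between_def)
      have wV0: "w \<notin> V0" using * v V0 subgrp_diff[of V0 w "w - v"] by auto
      have fin: "finite H0" using H0 finV0 by (auto intro: finite_subset)
      have "card (adjoin H0 w) = p * m"
        using card_adjoin(1)[OF p H0(1) fin elementary_zsmul[OF V *(2)]] wV0 H0 by auto
      moreover have "adjoin H0 w \<subseteq> V" using adjoin_subset[OF sV] H0 V0 * by auto
      ultimately show "(case a of (H0, w) \<Rightarrow> (adjoin H0 w, w)) \<in> (SIGMA H:?B. H \<inter> ?W)"
        using H0 * wV0 mem_adjoin[OF H0(1), of w] subset_adjoin[of H0 w]
        by (auto simp: a subgrps_between_def intro: subgrp_adjoin)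
    qed
  qed
  have finB: "finite ?B" using finite_subgrps_between[OF finV] by simp
  have "card ?B * m = (\<Sum>H\<in>?B. card (H \<inter> ?W))" using coset(1) by simp
  also have "\<dots> = card (SIGMA H:?B. H \<inter> ?W)"
    by (rule card_SigmaI[symmetric]) (use finB finV in auto)
  also have "\<dots> = card (subgrps_between A V0 m \<times> ?W)" by (rule bij_betw_same_card[OF bij])
  also have "\<dots> = card (subgrps_between A V0 m) * card V0"
    by (simp only: card_cartesian_product W)
  finally show ?thesis .
qed

text \<open>Only the index of \<open>A\<close> in \<open>V\<close> and in the subgroups matters, as in a quotient \<open>V / A\<close>.  The induction
  passes to a hyperplane of \<open>V\<close> that contains \<open>A\<close>.\<close>

theorem card_subgrps_between:
  assumes p: "prime p" and V: "elementary p V" and A: "subgrp A" "A \<subseteq> V"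
    and card: "card V = card A * p ^ n"
  shows "int (card (subgrps_between A V (card A * p ^ e))) = poly (gauss_binomial n e) (int p)"
  using V A(2) card
proof (induction n e arbitrary: V rule: gauss_binomial.induct)
  case (1 e)
  have finV: "finite V" using 1 by (auto simp: elementary_def)
  have AV: "A = V" by (rule card_subset_eq[OF finV]) (use 1 in auto)
  have "card V > 0" using finV subgrp_0[OF elementary_subgrp[OF 1(1)]] by (auto simp: card_gt_0_iff)
  hence "subgrps_between A V (card A * p ^ e) = (if e = 0 then {V} else {})"
    using AV A one_less_power[OF prime_gt_1_nat[OF p], of e] by (auto simp: subgrps_between_def)
  thus ?case by simp
next
  case (2 n)
  have "H = A" if "H \<in> subgrps_between A V (card A * p ^ 0)" for H
    by (rule sym, rule card_subset_eq)
       (use that 2 in \<open>auto simp: subgrps_between_def elementary_def intro: finite_subset\<close>)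
  hence "subgrps_between A V (card A * p ^ 0) = {A}"
    using 2 A by (auto simp: subgrps_between_def)
  thus ?case by simp
next
  case (3 n e)
  have finV: "finite V" using 3 by (auto simp: elementary_def)
  have "finite A" using 3(4) finV by (rule finite_subset)
  hence cA: "card A > 0" using subgrp_0[OF A(1)] by (auto simp: card_gt_0_iff)
  have p1: "p > 1" using p by (rule prime_gt_1_nat)
  have "A \<noteq> V"
  proof
    assume "A = V"
    hence "p ^ Suc n = 1" using 3(5) cA by simp
    thus False using p1 by (metis nat_neq_iff nat_zero_less_power_iff one_less_power zero_less_Suc)
  qed
  then obtain V0 where V0: "subgrp V0" "A \<subseteq> V0" "V0 \<subset> V" "card V = p * card V0"
    using exists_hyperplane[OF p 3(3) A(1)] 3(4) by auto
  have eV0: "elementary p V0" using elementary_subset[OF 3(3)] V0 by auto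
  have cV0: "card V0 = card A * p ^ n" using V0(4) 3(5) p1 by simp
  let ?m = "card A * p ^ e"
  have IH1: "int (card (subgrps_between A V0 (card A * p ^ Suc e))) = poly (gauss_binomial n (Suc e)) (int p)"
    by (rule 3(1)[OF eV0 V0(2) cV0])
  have IH2: "int (card (subgrps_between A V0 ?m)) = poly (gauss_binomial n e) (int p)"
    by (rule 3(2)[OF eV0 V0(2) cV0])
  have pm: "p * ?m = card A * p ^ Suc e" by simp
  let ?B = "{H \<in> subgrps_between A V (card A * p ^ Suc e). \<not> H \<subseteq> V0}"
  have B: "card ?B * ?m = card (subgrps_between A V0 ?m) * (card A * p ^ n)"
    using card_subgrps_not_in_hyperplane[OF p 3(3) V0(1,3,4,2), of ?m] unfolding pm cV0 .
  have B': "card ?B = p ^ (n - e) * card (subgrps_between A V0 ?m)"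
  proof (cases "e \<le> n")
    case True
    hence "p ^ n = p ^ (n - e) * p ^ e" by (simp flip: power_add)
    hence "card ?B * ?m = p ^ (n - e) * card (subgrps_between A V0 ?m) * ?m"
      using B by (simp only: ac_simps)
    thus ?thesis using cA p1 by (simp add: mult.commute)
  next
    case False
    hence "card (subgrps_between A V0 ?m) = 0" using IH2 gauss_binomial_eq_0[of n e] by simp
    moreover from this have "card ?B = 0" using B cA p1 by simp
    ultimately show ?thesis by simp
  qed
  have "subgrps_between A V (card A * p ^ Suc e) = subgrps_between A V0 (card A * p ^ Suc e) \<union> ?B"
    using V0 by (auto simp: subgrps_between_def)
  hence "card (subgrps_between A V (card A * p ^ Suc e)) =
      card (subgrps_between A V0 (card A * p ^ Suc e) \<union> ?B)"
    by (rule arg_cong)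
  also have "\<dots> = card (subgrps_between A V0 (card A * p ^ Suc e)) + card ?B"
  proof (rule card_Un_disjoint)
    show "finite (subgrps_between A V0 (card A * p ^ Suc e))" "finite ?B"
      using finV eV0 by (auto intro!: finite_subgrps_between simp: elementary_def)
    show "subgrps_between A V0 (card A * p ^ Suc e) \<inter> ?B = {}"
      by (auto simp: subgrps_between_def)
  qed
  finally show ?case using IH1 IH2 B' by (simp add: poly_monom)
qed

section \<open>Counting subrepresentations of a pair of maps\<close>

text \<open>The pair of maps is regarded as a representation of the Kronecker quiver with two arrows; \<open>a\<close> and
  \<open>b\<close> are the orders, not the dimensions, of the two subspaces.\<close>

definition subreps ::
    "('a \<Rightarrow> 'b) \<Rightarrow> ('a \<Rightarrow> 'b) \<Rightarrow> 'a::ab_group_add set \<Rightarrow> 'b::ab_group_add set \<Rightarrow> nat \<Rightarrow> nat \<Rightarrow> ('a set \<times> 'b set) set"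
  where "subreps \<alpha> \<beta> V W a b =
    (SIGMA U : subgrps_between {0} V a. {U' \<in> subgrps_between {0} W b. \<alpha> ` U \<subseteq> U' \<and> \<beta> ` U \<subseteq> U'})"

definition poly_on :: "nat set \<Rightarrow> (nat \<Rightarrow> int) \<Rightarrow> bool"
  where "poly_on X F \<longleftrightarrow> (\<exists>P :: int poly. \<forall>p\<in>X. F p = poly P (int p))"

lemma poly_on_poly: "poly_on X (\<lambda>p. poly P (int p))"
  by (auto simp: poly_on_def)

lemma poly_on_cong: "(\<And>p. p \<in> X \<Longrightarrow> F p = G p) \<Longrightarrow> poly_on X F \<longleftrightarrow> poly_on X G"
  by (simp add: poly_on_def)

lemma poly_on_const: "poly_on X (\<lambda>p. k)"
  using poly_on_poly[of X "[:k:]"] by simp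

lemma poly_on_add: "poly_on X F \<Longrightarrow> poly_on X G \<Longrightarrow> poly_on X (\<lambda>p. F p + G p)"
  unfolding poly_on_def by (metis poly_add)

lemma poly_on_diff: "poly_on X F \<Longrightarrow> poly_on X G \<Longrightarrow> poly_on X (\<lambda>p. F p - G p)"
  unfolding poly_on_def by (metis poly_diff)

lemma poly_on_mult: "poly_on X F \<Longrightarrow> poly_on X G \<Longrightarrow> poly_on X (\<lambda>p. F p * G p)"
  unfolding poly_on_def by (metis poly_mult)

lemma poly_on_sum: "(\<And>i. i \<in> S \<Longrightarrow> poly_on X (F i)) \<Longrightarrow> poly_on X (\<lambda>p. \<Sum>i\<in>S. F i p)"
  by (induction S rule: infinite_finite_induct) (auto simp: poly_on_const poly_on_add)

lemma sum_by_rank: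
  assumes p: "prime p" and fin: "finite S"
    and card: "\<And>U. U \<in> S \<Longrightarrow> card (K U) = p ^ r U" "\<And>U. U \<in> S \<Longrightarrow> r U \<le> n"
  shows "(\<Sum>U\<in>S. g (r U)) = (\<Sum>d\<le>n. of_nat (card {U \<in> S. card (K U) = p ^ d}) * (g d :: int))"
proof -
  have "r U = d \<longleftrightarrow> card (K U) = p ^ d" if "U \<in> S" for U d
    using card(1)[OF that] prime_gt_1_nat[OF p] by simp
  hence eq: "{U \<in> S. r U = d} = {U \<in> S. card (K U) = p ^ d}" for d by blast
  have "(\<Sum>U\<in>S. g (r U)) = (\<Sum>d\<le>n. \<Sum>U\<in>{U \<in> S. r U = d}. g (r U))"
    by (rule sum.group[symmetric]) (use fin card(2) in auto)
  also have "\<dots> = (\<Sum>d\<le>n. of_nat (card {U \<in> S. card (K U) = p ^ d}) * g d)"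
    by (simp add: eq[symmetric])
  finally show ?thesis .
qed

text \<open>\<open>V2 \<rightrightarrows> V1\<close> is the reflection of \<open>V1 \<rightrightarrows> V0\<close>: its points are the relations
  \<open>\<beta>1 u = \<alpha>1 u'\<close> between elements of \<open>V1\<close>.  For a subgroup \<open>U\<close> of \<open>V1\<close>, the relations inside \<open>U\<close>
  form \<open>rels U\<close>.\<close>

locale reflection =
  fixes p :: nat
    and V2 :: "'c::ab_group_add set" and V1 :: "'b::ab_group_add set" and V0 :: "'a::ab_group_add set"
    and \<alpha>2 \<beta>2 :: "'c \<Rightarrow> 'b" and \<alpha>1 \<beta>1 :: "'b \<Rightarrow> 'a"
    and d2 d1 d0 :: nat
  assumes p: "prime p"
    and V2: "elementary p V2" "card V2 = p ^ d2"
    and V1: "elementary p V1" "card V1 = p ^ d1"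
    and V0: "elementary p V0" "card V0 = p ^ d0"
    and add2: "Modules.additive \<alpha>2" "Modules.additive \<beta>2"
    and add1: "Modules.additive \<alpha>1" "Modules.additive \<beta>1"
    and maps1: "\<alpha>1 ` V1 \<subseteq> V0" "\<beta>1 ` V1 \<subseteq> V0"
    and bij: "bij_betw (\<lambda>v. (\<alpha>2 v, \<beta>2 v)) V2 {(u, u'). u \<in> V1 \<and> u' \<in> V1 \<and> \<beta>1 u = \<alpha>1 u'}"
begin

definition rels :: "'b set \<Rightarrow> 'c set"
  where "rels U = {v \<in> V2. \<alpha>2 v \<in> U \<and> \<beta>2 v \<in> U}"

definition num_rels :: "nat \<Rightarrow> nat \<Rightarrow> nat"
  where "num_rels e d = card {U \<in> subgrps_between {0} V1 (p ^ e). card (rels U) = p ^ d}"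

lemma p1: "p > 1"
  using p by (rule prime_gt_1_nat)

lemma elementary_rels: "subgrp U \<Longrightarrow> elementary p (rels U)"
  by (rule elementary_subset[OF V2(1)])
     (auto simp: rels_def subgrp_def additive.diff[OF add2(1)] additive.diff[OF add2(2)]
        additive.zero[OF add2(1)] additive.zero[OF add2(2)]
        subgrp_0[OF elementary_subgrp[OF V2(1)]] intro: subgrp_diff[OF elementary_subgrp[OF V2(1)]])

lemma card_rels: "subgrp U \<Longrightarrow> card (rels U) = p ^ prank p (rels U)"
  using card_elementary[OF p elementary_rels] .

lemma prank_rels_le: "subgrp U \<Longrightarrow> prank p (rels U) \<le> d2"
proof -
  assume U: "subgrp U"
  have "card (rels U) \<le> card V2"
    by (rule card_mono) (auto simp: rels_def elementary_finite[OF V2(1)])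
  hence "p ^ prank p (rels U) \<le> p ^ d2" using card_rels[OF U] V2(2) by simp
  thus ?thesis using p1 by simp
qed

lemma finite_subgrps: "finite (subgrps_between {0} V1 m)"
  by (rule finite_subgrps_between[OF elementary_finite[OF V1(1)]])

text \<open>For fixed \<open>U\<close>, the subspaces \<open>N\<close> of \<open>V2\<close> for which \<open>(N, U)\<close> is a subrepresentation are the
  subspaces of \<open>rels U\<close>.\<close>

lemma card_subreps_reflected:
  "int (card (subreps \<alpha>2 \<beta>2 V2 V1 (p ^ d) (p ^ e))) =
     (\<Sum>d'\<le>d2. int (num_rels e d') * poly (gauss_binomial d' d) (int p))"
proof -
  let ?S = "subgrps_between {0} V1 (p ^ e)"
  have fin2: "finite (subgrps_between {0} V2 m)" for m
    by (rule finite_subgrps_between[OF elementary_finite[OF V2(1)]])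
  have "bij_betw (\<lambda>(N, U). (U, N)) (subreps \<alpha>2 \<beta>2 V2 V1 (p ^ d) (p ^ e))
      (SIGMA U:?S. subgrps_between {0} (rels U) (p ^ d))"
    by (rule bij_betw_byWitness[where f' = "\<lambda>(U, N). (N, U)"])
       (auto simp: subreps_def subgrps_between_def rels_def image_subset_iff)
  hence "card (subreps \<alpha>2 \<beta>2 V2 V1 (p ^ d) (p ^ e)) =
      card (SIGMA U:?S. subgrps_between {0} (rels U) (p ^ d))"
    by (rule bij_betw_same_card)
  also have "\<dots> = (\<Sum>U\<in>?S. card (subgrps_between {0} (rels U) (p ^ d)))"
    by (rule card_SigmaI[OF finite_subgrps])
       (auto simp: rels_def intro!: finite_subgrps_between elementary_finite[OF V2(1)])
  finally have "int (card (subreps \<alpha>2 \<beta>2 V2 V1 (p ^ d) (p ^ e))) =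
      (\<Sum>U\<in>?S. int (card (subgrps_between {0} (rels U) (p ^ d))))" by simp
  also have "\<dots> = (\<Sum>U\<in>?S. poly (gauss_binomial (prank p (rels U)) d) (int p))"
  proof (rule sum.cong[OF refl])
    fix U assume "U \<in> ?S"
    hence U: "subgrp U" by (simp add: subgrps_between_def)
    show "int (card (subgrps_between {0} (rels U) (p ^ d))) =
        poly (gauss_binomial (prank p (rels U)) d) (int p)"
      using card_subgrps_between[OF p elementary_rels[OF U] subgrp_singleton_0, of "prank p (rels U)" d]
        card_rels[OF U] subgrp_0[OF elementary_subgrp[OF elementary_rels[OF U]]] by simp
  qed
  also have "\<dots> = (\<Sum>d'\<le>d2. int (num_rels e d') * poly (gauss_binomial d' d) (int p))"
    unfolding num_rels_def
    by (rule sum_by_rank[OF p finite_subgrps])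
       (auto simp: subgrps_between_def card_rels prank_rels_le)
  finally show ?thesis .
qed

text \<open>The subgroup spanned by \<open>\<alpha>1 ` U\<close> and \<open>\<beta>1 ` U\<close> is a quotient of \<open>U \<times> U\<close> by the relations
  inside \<open>U\<close>.\<close>

lemma card_generated:
  assumes U: "subgrp U" "U \<subseteq> V1"
  shows "card U * card U = card ((\<lambda>(u, u'). \<alpha>1 u' - \<beta>1 u) ` (U \<times> U)) * card (rels U)"
proof -
  let ?\<theta> = "\<lambda>(u, u'). \<alpha>1 u' - \<beta>1 u"
  have \<theta>: "Modules.additive ?\<theta>"
    by unfold_locales (auto simp: additive.add[OF add1(1)] additive.add[OF add1(2)])
  have finU: "finite U" using U elementary_finite[OF V1(1)] by (auto intro: finite_subset)
  have "bij_betw (\<lambda>v. (\<alpha>2 v, \<beta>2 v)) (rels U) {x \<in> U \<times> U. ?\<theta> x = 0}"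
    unfolding bij_betw_def
  proof
    show "inj_on (\<lambda>v. (\<alpha>2 v, \<beta>2 v)) (rels U)"
      using bij by (auto simp: bij_betw_def rels_def inj_on_def)
    show "(\<lambda>v. (\<alpha>2 v, \<beta>2 v)) ` rels U = {x \<in> U \<times> U. ?\<theta> x = 0}"
    proof (intro equalityI subsetI)
      fix x assume "x \<in> (\<lambda>v. (\<alpha>2 v, \<beta>2 v)) ` rels U"
      then obtain v where v: "v \<in> V2" "\<alpha>2 v \<in> U" "\<beta>2 v \<in> U" "x = (\<alpha>2 v, \<beta>2 v)"
        by (auto simp: rels_def)
      have "(\<alpha>2 v, \<beta>2 v) \<in> {(u, u'). u \<in> V1 \<and> u' \<in> V1 \<and> \<beta>1 u = \<alpha>1 u'}"
        using bij_betw_apply[OF bij v(1)] .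
      thus "x \<in> {x \<in> U \<times> U. ?\<theta> x = 0}" using v by simp
    next
      fix x assume "x \<in> {x \<in> U \<times> U. ?\<theta> x = 0}"
      then obtain u u' where x: "x = (u, u')" "u \<in> U" "u' \<in> U" "\<alpha>1 u' - \<beta>1 u = 0" by auto
      hence "(u, u') \<in> {(u, u'). u \<in> V1 \<and> u' \<in> V1 \<and> \<beta>1 u = \<alpha>1 u'}" using U by auto
      hence "(u, u') \<in> (\<lambda>v. (\<alpha>2 v, \<beta>2 v)) ` V2" by (simp only: bij_betw_imp_surj_on[OF bij])
      then obtain v where "v \<in> V2" "(u, u') = (\<alpha>2 v, \<beta>2 v)" by blast
      thus "x \<in> (\<lambda>v. (\<alpha>2 v, \<beta>2 v)) ` rels U" using x by (auto simp: rels_def)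
    qed
  qed
  hence "card (rels U) = card {x \<in> U \<times> U. ?\<theta> x = 0}" by (rule bij_betw_same_card)
  moreover have "card (U \<times> U) = card (?\<theta> ` (U \<times> U)) * card {x \<in> U \<times> U. ?\<theta> x = 0}"
    by (rule card_additive_image[OF \<theta>]) (use U finU in \<open>auto intro: subgrp_Times\<close>)
  ultimately show ?thesis by (simp add: card_cartesian_product)
qed

text \<open>For \<open>dim U = e\<close> and \<open>dim (rels U) = d\<close> the subspace that \<open>U\<close> generates in \<open>V0\<close> has dimension
  \<open>2 e - d\<close>, and the subspaces of \<open>V0\<close> of dimension \<open>f\<close> that contain it are counted here.\<close>

definition extension_poly :: "nat \<Rightarrow> nat \<Rightarrow> nat \<Rightarrow> int poly"
  where "extension_poly e f d =
    (if d \<le> 2 * e \<and> 2 * e - d \<le> f then gauss_binomial (d0 - (2 * e - d)) (f - (2 * e - d)) else 0)"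

lemma card_extensions:
  assumes U: "U \<in> subgrps_between {0} V1 (p ^ e)"
  shows "int (card {U' \<in> subgrps_between {0} V0 (p ^ f). \<alpha>1 ` U \<subseteq> U' \<and> \<beta>1 ` U \<subseteq> U'}) =
    poly (extension_poly e f (prank p (rels U))) (int p)"
proof -
  from U have U: "subgrp U" "U \<subseteq> V1" "card U = p ^ e" by (auto simp: subgrps_between_def)
  let ?\<theta> = "\<lambda>(u, u'). \<alpha>1 u' - \<beta>1 u"
  define W where "W = ?\<theta> ` (U \<times> U)"
  have \<theta>: "Modules.additive ?\<theta>"
    by unfold_locales (auto simp: additive.add[OF add1(1)] additive.add[OF add1(2)])
  have W: "subgrp W" unfolding W_def by (intro subgrp_image \<theta> subgrp_Times U)
  have W0: "W \<subseteq> V0"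
    using U maps1 elementary_subgrp[OF V0(1)] by (auto simp: W_def intro!: subgrp_diff)
  have W_iff: "(\<alpha>1 ` U \<subseteq> U' \<and> \<beta>1 ` U \<subseteq> U') \<longleftrightarrow> W \<subseteq> U'" if U': "subgrp U'" for U'
  proof
    assume "\<alpha>1 ` U \<subseteq> U' \<and> \<beta>1 ` U \<subseteq> U'"
    thus "W \<subseteq> U'" using U' by (auto simp: W_def intro!: subgrp_diff)
  next
    assume W': "W \<subseteq> U'"
    have "\<alpha>1 ` U \<union> \<beta>1 ` U \<subseteq> U'"
    proof
      fix y assume "y \<in> \<alpha>1 ` U \<union> \<beta>1 ` U"
      then consider u where "u \<in> U" "y = \<alpha>1 u" | u where "u \<in> U" "y = \<beta>1 u" by auto
      thus "y \<in> U'"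
      proof cases
        case 1
        hence "y = ?\<theta> (0, u)" by (simp add: additive.zero[OF add1(2)])
        thus ?thesis using 1 W' subgrp_0[OF U(1)] unfolding W_def by blast
      next
        case 2
        hence "- y = ?\<theta> (u, 0)" by (simp add: additive.zero[OF add1(1)])
        hence "- y \<in> U'" using 2 W' subgrp_0[OF U(1)] unfolding W_def by blast
        thus ?thesis using subgrp_minus[OF U', of "- y"] by simp
      qed
    qed
    thus "\<alpha>1 ` U \<subseteq> U' \<and> \<beta>1 ` U \<subseteq> U'" by simp
  qed
  have set_eq: "{U' \<in> subgrps_between {0} V0 (p ^ f). \<alpha>1 ` U \<subseteq> U' \<and> \<beta>1 ` U \<subseteq> U'} = subgrps_between W V0 (p ^ f)"
  proof (rule Set.set_eqI)
    fix H
    show "H \<in> {U' \<in> subgrps_between {0} V0 (p ^ f). \<alpha>1 ` U \<subseteq> U' \<and> \<beta>1 ` U \<subseteq> U'} \<longleftrightarrow>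
        H \<in> subgrps_between W V0 (p ^ f)"
      using W_iff[of H] subgrp_0[OF W]
      by (cases "subgrp H") (auto simp: subgrps_between_def)
  qed
  let ?d = "prank p (rels U)"
  obtain r where r: "card W = p ^ r"
    using card_elementary[OF p elementary_subset[OF V0(1) W W0]] by blast
  have "p ^ (2 * e) = p ^ (r + ?d)"
    using card_generated[OF U(1,2)] card_rels[OF U(1)]
    by (simp add: U(3) W_def[symmetric] r power_add mult_2)
  hence er: "2 * e = r + ?d" using p1 by simp
  have "card W \<le> card V0" by (rule card_mono[OF elementary_finite[OF V0(1)] W0])
  hence rd: "r \<le> d0" using r V0(2) p1 by simp
  show ?thesis
  proof (cases "r \<le> f")
    case True
    have "card V0 = card W * p ^ (d0 - r)" "card W * p ^ (f - r) = p ^ f"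
      using rd True by (simp_all add: V0(2) r flip: power_add)
    thus ?thesis using card_subgrps_between[OF p V0(1) W W0, of "d0 - r" "f - r"] True er
      by (simp add: set_eq extension_poly_def)
  next
    case False
    have "subgrps_between W V0 (p ^ f) = {}"
    proof (rule ccontr)
      assume "subgrps_between W V0 (p ^ f) \<noteq> {}"
      then obtain H where "W \<subseteq> H" "H \<subseteq> V0" "card H = p ^ f" by (auto simp: subgrps_between_def)
      hence "p ^ r \<le> p ^ f"
        using r card_mono[of H W] elementary_finite[OF V0(1)] finite_subset by metis
      thus False using False p1 by simp
    qed
    thus ?thesis using False er by (simp add: set_eq extension_poly_def)
  qed
qed

lemma card_subreps:
  "int (card (subreps \<alpha>1 \<beta>1 V1 V0 (p ^ e) (p ^ f))) =
     (\<Sum>d\<le>d2. int (num_rels e d) * poly (extension_poly e f d) (int p))"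
proof -
  let ?S = "subgrps_between {0} V1 (p ^ e)"
  have "card (subreps \<alpha>1 \<beta>1 V1 V0 (p ^ e) (p ^ f)) =
      (\<Sum>U\<in>?S. card {U' \<in> subgrps_between {0} V0 (p ^ f). \<alpha>1 ` U \<subseteq> U' \<and> \<beta>1 ` U \<subseteq> U'})"
    unfolding subreps_def
    by (rule card_SigmaI[OF finite_subgrps])
       (auto intro: finite_subset[OF _ finite_subgrps_between[OF elementary_finite[OF V0(1)]]])
  hence "int (card (subreps \<alpha>1 \<beta>1 V1 V0 (p ^ e) (p ^ f))) =
      (\<Sum>U\<in>?S. poly (extension_poly e f (prank p (rels U))) (int p))"
    by (simp add: card_extensions)
  also have "\<dots> = (\<Sum>d\<le>d2. int (num_rels e d) * poly (extension_poly e f d) (int p))"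
    unfolding num_rels_def
    by (rule sum_by_rank[OF p finite_subgrps])
       (auto simp: subgrps_between_def card_rels prank_rels_le)
  finally show ?thesis .
qed

end

text \<open>The matrix of Gaussian binomials in \<open>card_subreps_reflected\<close> is triangular with ones on the
  diagonal, so the system can be solved for the numbers of \<open>U\<close> with \<open>d\<close>-dimensional space of relations
  by downward induction on \<open>d\<close>, without divisions; then \<open>card_subreps\<close> applies.\<close>

theorem poly_on_subreps_reflection:
  assumes refl: "\<And>p. p \<in> X \<Longrightarrow> reflection p (V2 p) (V1 p) (V0 p) \<alpha>2 \<beta>2 \<alpha>1 \<beta>1 d2 d1 d0"
    and poly: "\<And>d e. poly_on X (\<lambda>p. int (card (subreps \<alpha>2 \<beta>2 (V2 p) (V1 p) (p ^ d) (p ^ e))))"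
  shows "poly_on X (\<lambda>p. int (card (subreps \<alpha>1 \<beta>1 (V1 p) (V0 p) (p ^ e) (p ^ f))))"
proof -
  let ?T = "\<lambda>d p. int (reflection.num_rels p (V2 p) (V1 p) \<alpha>2 \<beta>2 e d)"
  have T: "poly_on X (?T d)" if "d \<le> d2" for d
    using that
  proof (induction "d2 - d" arbitrary: d rule: less_induct)
    case less
    have "?T d p = int (card (subreps \<alpha>2 \<beta>2 (V2 p) (V1 p) (p ^ d) (p ^ e)))
        - (\<Sum>d'\<in>{d<..d2}. ?T d' p * poly (gauss_binomial d' d) (int p))" if "p \<in> X" for p
    proof -
      have "{..d2} = {..<d} \<union> {d} \<union> {d<..d2}" using less.prems by auto
      hence "(\<Sum>d'\<le>d2. ?T d' p * poly (gauss_binomial d' d) (int p)) =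
          (\<Sum>d'<d. ?T d' p * poly (gauss_binomial d' d) (int p)) + ?T d p
          + (\<Sum>d'\<in>{d<..d2}. ?T d' p * poly (gauss_binomial d' d) (int p))"
        by (subst \<open>{..d2} = _\<close>, subst sum.union_disjoint) (auto simp: sum.union_disjoint)
      also have "(\<Sum>d'<d. ?T d' p * poly (gauss_binomial d' d) (int p)) = 0"
        by (intro sum.neutral) (auto simp: gauss_binomial_eq_0)
      finally show ?thesis
        using reflection.card_subreps_reflected[OF refl[OF that], of d e] by simp
    qed
    moreover have "poly_on X (\<lambda>p. int (card (subreps \<alpha>2 \<beta>2 (V2 p) (V1 p) (p ^ d) (p ^ e)))
        - (\<Sum>d'\<in>{d<..d2}. ?T d' p * poly (gauss_binomial d' d) (int p)))"
      by (intro poly_on_diff poly poly_on_sum poly_on_mult poly_on_poly less.hyps) auto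
    ultimately show ?case using poly_on_cong[of X "?T d"] by simp
  qed
  have "poly_on X (\<lambda>p. \<Sum>d\<le>d2. ?T d p * poly (reflection.extension_poly d0 e f d) (int p))"
    by (intro poly_on_sum poly_on_mult poly_on_poly T) auto
  thus ?thesis
    using reflection.card_subreps[OF refl, of _ e f] by (simp cong: poly_on_cong)
qed

lemma poly_on_subreps_trivial:
  fixes \<alpha> \<beta> :: "'a::ab_group_add \<Rightarrow> 'b::ab_group_add"
  assumes "\<And>p. p \<in> X \<Longrightarrow> prime p"
    and V0: "\<And>p. p \<in> X \<Longrightarrow> elementary p (V0 p)" "\<And>p. p \<in> X \<Longrightarrow> card (V0 p) = p ^ d0"
    and "Modules.additive \<alpha>" "Modules.additive \<beta>"
  shows "poly_on X (\<lambda>p. int (card (subreps \<alpha> \<beta> {0} (V0 p) (p ^ e) (p ^ f))))"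
proof -
  have "int (card (subreps \<alpha> \<beta> {0} (V0 p) (p ^ e) (p ^ f))) =
      poly (if e = 0 then gauss_binomial d0 f else 0) (int p)" if p: "p \<in> X" for p
  proof -
    have p1: "p > 1" using assms(1)[OF p] by (rule prime_gt_1_nat)
    have H: "H = {0}" if "H \<in> subgrps_between {0} ({0} :: 'a set) m" for H m
      using that by (auto simp: subgrps_between_def)
    have S: "subgrps_between {0} ({0} :: 'a set) (p ^ e) = (if e = 0 then {{0}} else {})"
    proof (cases "e = 0")
      case False
      hence "p ^ e \<noteq> 1" using p1 by auto
      moreover have "card ({0} :: 'a set) = 1" by simp
      ultimately have "card ({0} :: 'a set) \<noteq> p ^ e" by metis
      hence "{0} \<notin> subgrps_between {0} ({0} :: 'a set) (p ^ e)"
        unfolding subgrps_between_def by blast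
      hence "subgrps_between {0} ({0} :: 'a set) (p ^ e) = {}" using H by blast
      thus ?thesis using False by simp
    next
      case True
      have "{0} \<in> subgrps_between {0} ({0} :: 'a set) (p ^ 0)"
        by (simp add: subgrps_between_def subgrp_singleton_0)
      with H show ?thesis using True by auto
    qed
    have "\<alpha> 0 = 0" "\<beta> 0 = 0" using assms(4,5) by (auto dest: additive.zero)
    hence "subreps \<alpha> \<beta> {0} (V0 p) (p ^ e) (p ^ f) =
        (if e = 0 then {{0}} \<times> subgrps_between {0} (V0 p) (p ^ f) else {})"
      unfolding subreps_def S by (auto simp: subgrps_between_def)
    thus ?thesis
      using card_subgrps_between[OF assms(1)[OF p] V0(1)[OF p] subgrp_singleton_0, of d0 f] V0(2)[OF p]
        subgrp_0[OF elementary_subgrp[OF V0(1)[OF p]]]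
      by (simp add: card_cartesian_product)
  qed
  thus ?thesis using poly_on_poly[of X] by (simp cong: poly_on_cong)
qed

section \<open>Chains of relations\<close>

text \<open>The iterated reflections of the pair \<open>\<alpha>, \<beta>\<close>.  Chains are extended by zero to functions on all
  natural numbers in order that the chains of all lengths live in the same type.\<close>

definition relation_chains :: "('a \<Rightarrow> 'b) \<Rightarrow> ('a \<Rightarrow> 'b) \<Rightarrow> 'a::ab_group_add set \<Rightarrow> nat \<Rightarrow> (nat \<Rightarrow> 'a) set"
  where "relation_chains \<alpha> \<beta> V i = {a. (\<forall>j\<le>i. a j \<in> V) \<and> (\<forall>j>i. a j = 0) \<and> (\<forall>j<i. \<beta> (a j) = \<alpha> (a (Suc j)))}"

definition drop_last :: "nat \<Rightarrow> (nat \<Rightarrow> 'a) \<Rightarrow> nat \<Rightarrow> 'a::ab_group_add"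
  where "drop_last i a = a(i := 0)"

definition drop_first :: "(nat \<Rightarrow> 'a) \<Rightarrow> nat \<Rightarrow> 'a"
  where "drop_first a = (\<lambda>j. a (Suc j))"

lemma additive_drop_last: "Modules.additive (drop_last i)"
  by unfold_locales (auto simp: drop_last_def fun_eq_iff)

lemma additive_drop_first: "Modules.additive (drop_first :: (nat \<Rightarrow> 'a::ab_group_add) \<Rightarrow> _)"
  by unfold_locales (auto simp: drop_first_def fun_eq_iff)

lemma additive_comp_left: "Modules.additive \<alpha> \<Longrightarrow> Modules.additive (\<lambda>a. \<alpha> \<circ> a)"
  for \<alpha> :: "'a::ab_group_add \<Rightarrow> 'b::ab_group_add"
  by unfold_locales (auto simp: fun_eq_iff additive.add)

lemma elementary_chains:
  fixes \<alpha> \<beta> :: "'a::ab_group_add \<Rightarrow> 'b::ab_group_add"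
  assumes V: "elementary p V" and add: "Modules.additive \<alpha>" "Modules.additive \<beta>"
  shows "elementary p (relation_chains \<alpha> \<beta> V i)"
  unfolding elementary_def
proof (intro conjI ballI)
  show "subgrp (relation_chains \<alpha> \<beta> V i)"
    using elementary_subgrp[OF V] add
    by (auto simp: subgrp_def relation_chains_def additive.diff additive.zero)
  have "relation_chains \<alpha> \<beta> V i \<subseteq> {a. \<forall>j. (j \<in> {..i} \<longrightarrow> a j \<in> V) \<and> (j \<notin> {..i} \<longrightarrow> a j = 0)}"
    by (auto simp: relation_chains_def)
  thus "finite (relation_chains \<alpha> \<beta> V i)"
    by (rule finite_subset) (intro finite_set_of_finite_funs elementary_finite[OF V], simp)
  fix a assume a: "a \<in> relation_chains \<alpha> \<beta> V i"
  show "zsmul (int p) a = 0"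
  proof
    fix j
    show "zsmul (int p) a j = 0 j"
      using a elementary_zsmul[OF V] by (cases "j \<le> i") (auto simp: zsmul_apply relation_chains_def)
  qed
qed

lemma drop_last_chains: "subgrp V \<Longrightarrow> a \<in> relation_chains \<alpha> \<beta> V (Suc i) \<Longrightarrow> drop_last (Suc i) a \<in> relation_chains \<alpha> \<beta> V i"
  by (auto simp: relation_chains_def drop_last_def)

lemma drop_first_chains: "a \<in> relation_chains \<alpha> \<beta> V (Suc i) \<Longrightarrow> drop_first a \<in> relation_chains \<alpha> \<beta> V i"
  by (auto simp: relation_chains_def drop_first_def)

text \<open>A chain is obtained by gluing the two chains that arise from omitting its last or its first entry;
  conversely, two chains can be glued if they agree where they overlap.  So the chains of one length are
  the relations between chains of the length before.  At the bottom, where there is no overlap, the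
  condition is the relation between the two entries.\<close>

lemma chain_glue_inj:
  "inj_on (\<lambda>a. (drop_last (Suc i) a, drop_first a)) (relation_chains \<alpha> \<beta> V (Suc i))"
proof (rule inj_onI)
  fix a b assume "(drop_last (Suc i) a, drop_first a) = (drop_last (Suc i) b, drop_first b)"
  hence *: "drop_last (Suc i) a = drop_last (Suc i) b" "drop_first a = drop_first b" by auto
  show "a = b"
  proof
    fix j
    show "a j = b j"
    proof (cases j)
      case 0
      thus ?thesis using fun_cong[OF *(1), of 0] by (simp add: drop_last_def)
    next
      case (Suc k)
      thus ?thesis using fun_cong[OF *(2), of k] by (simp add: drop_first_def)
    qed
  qed
qed

lemma chain_glue_0:
  fixes \<alpha> \<beta> :: "'a::ab_group_add \<Rightarrow> 'b::ab_group_add"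
  assumes V: "subgrp V" and add: "Modules.additive \<alpha>" "Modules.additive \<beta>"
  shows "bij_betw (\<lambda>a. (drop_last (Suc 0) a, drop_first a)) (relation_chains \<alpha> \<beta> V (Suc 0))
    {(u, u'). u \<in> relation_chains \<alpha> \<beta> V 0 \<and> u' \<in> relation_chains \<alpha> \<beta> V 0 \<and> \<beta> \<circ> u = \<alpha> \<circ> u'}"
  unfolding bij_betw_def
proof (intro conjI equalityI subsetI)
  fix x assume "x \<in> (\<lambda>a. (drop_last (Suc 0) a, drop_first a)) ` relation_chains \<alpha> \<beta> V (Suc 0)"
  then obtain a where a: "a \<in> relation_chains \<alpha> \<beta> V (Suc 0)" "x = (drop_last (Suc 0) a, drop_first a)" by blast
  have "\<beta> (drop_last (Suc 0) a j) = \<alpha> (drop_first a j)" for j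
    using a(1) by (cases j) (auto simp: relation_chains_def drop_last_def drop_first_def additive.zero[OF add(1)] additive.zero[OF add(2)])
  thus "x \<in> {(u, u'). u \<in> relation_chains \<alpha> \<beta> V 0 \<and> u' \<in> relation_chains \<alpha> \<beta> V 0 \<and> \<beta> \<circ> u = \<alpha> \<circ> u'}"
    using a drop_last_chains[OF V a(1)] drop_first_chains[OF a(1)] by (auto simp: fun_eq_iff)
next
  fix x assume "x \<in> {(u, u'). u \<in> relation_chains \<alpha> \<beta> V 0 \<and> u' \<in> relation_chains \<alpha> \<beta> V 0 \<and> \<beta> \<circ> u = \<alpha> \<circ> u'}"
  then obtain u u' where x: "x = (u, u')" "u \<in> relation_chains \<alpha> \<beta> V 0" "u' \<in> relation_chains \<alpha> \<beta> V 0" "\<beta> \<circ> u = \<alpha> \<circ> u'"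
    by blast
  define a where "a = case_nat (u 0) u'"
  have "\<beta> (u 0) = \<alpha> (u' 0)" using fun_cong[OF x(4), of 0] by simp
  hence "a \<in> relation_chains \<alpha> \<beta> V (Suc 0)"
    using x(2,3) by (auto simp: relation_chains_def a_def le_Suc_eq split: nat.splits)
  moreover have "x = (drop_last (Suc 0) a, drop_first a)"
    using x(1-3) by (auto simp: relation_chains_def a_def drop_last_def drop_first_def fun_eq_iff split: nat.splits)
  ultimately show "x \<in> (\<lambda>a. (drop_last (Suc 0) a, drop_first a)) ` relation_chains \<alpha> \<beta> V (Suc 0)" by blast
qed (rule chain_glue_inj)

lemma chain_glue_Suc:
  fixes \<alpha> \<beta> :: "'a::ab_group_add \<Rightarrow> 'b::ab_group_add"
  assumes V: "subgrp V"
  shows "bij_betw (\<lambda>a. (drop_last (Suc (Suc i)) a, drop_first a)) (relation_chains \<alpha> \<beta> V (Suc (Suc i)))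
    {(u, u'). u \<in> relation_chains \<alpha> \<beta> V (Suc i) \<and> u' \<in> relation_chains \<alpha> \<beta> V (Suc i) \<and> drop_first u = drop_last (Suc i) u'}"
  unfolding bij_betw_def
proof (intro conjI equalityI subsetI)
  fix x assume "x \<in> (\<lambda>a. (drop_last (Suc (Suc i)) a, drop_first a)) ` relation_chains \<alpha> \<beta> V (Suc (Suc i))"
  then obtain a where a: "a \<in> relation_chains \<alpha> \<beta> V (Suc (Suc i))" "x = (drop_last (Suc (Suc i)) a, drop_first a)" by blast
  have "drop_first (drop_last (Suc (Suc i)) a) = drop_last (Suc i) (drop_first a)"
    by (auto simp: drop_last_def drop_first_def fun_eq_iff)
  thus "x \<in> {(u, u'). u \<in> relation_chains \<alpha> \<beta> V (Suc i) \<and> u' \<in> relation_chains \<alpha> \<beta> V (Suc i) \<and> drop_first u = drop_last (Suc i) u'}"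
    using a drop_last_chains[OF V a(1)] drop_first_chains[OF a(1)] by auto
next
  fix x assume "x \<in> {(u, u'). u \<in> relation_chains \<alpha> \<beta> V (Suc i) \<and> u' \<in> relation_chains \<alpha> \<beta> V (Suc i) \<and> drop_first u = drop_last (Suc i) u'}"
  then obtain u u' where x: "x = (u, u')" "u \<in> relation_chains \<alpha> \<beta> V (Suc i)" "u' \<in> relation_chains \<alpha> \<beta> V (Suc i)"
      "drop_first u = drop_last (Suc i) u'"
    by blast
  define a where "a = case_nat (u 0) u'"
  have u: "u (Suc j) = (if j = Suc i then 0 else u' j)" for j
    using fun_cong[OF x(4), of j] by (simp add: drop_first_def drop_last_def)
  have "\<beta> (a j) = \<alpha> (a (Suc j))" if "j < Suc (Suc i)" for j
  proof (cases j)
    case 0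
    have "\<beta> (u 0) = \<alpha> (u (Suc 0))" using x(2) by (simp add: relation_chains_def)
    thus ?thesis using 0 u[of 0] by (simp add: a_def)
  next
    case (Suc k)
    thus ?thesis using x(3) that by (simp add: relation_chains_def a_def)
  qed
  hence "a \<in> relation_chains \<alpha> \<beta> V (Suc (Suc i))"
    using x(2,3) by (auto simp: relation_chains_def a_def split: nat.splits)
  moreover have "x = (drop_last (Suc (Suc i)) a, drop_first a)"
    using x(1) u by (auto simp: a_def drop_last_def drop_first_def fun_eq_iff split: nat.splits)
  ultimately show "x \<in> (\<lambda>a. (drop_last (Suc (Suc i)) a, drop_first a)) ` relation_chains \<alpha> \<beta> V (Suc (Suc i))" by blast
qed (rule chain_glue_inj)

text \<open>Repeated reflection leads from \<open>V \<rightrightarrows> W\<close> to a pair of maps out of the zero space.  The space \<open>W\<close>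
  too is written as the space of chains with one entry, for an arbitrary pair of maps \<open>\<alpha>', \<beta>'\<close>, which puts
  it into the same form as \<open>V\<close>.\<close>

theorem poly_on_subreps_chains:
  fixes \<alpha> \<beta> :: "'a::ab_group_add \<Rightarrow> 'b::ab_group_add" and V :: "nat \<Rightarrow> 'a set" and W :: "nat \<Rightarrow> 'b set"
  assumes prime: "\<And>p. p \<in> X \<Longrightarrow> prime p"
    and add: "Modules.additive \<alpha>" "Modules.additive \<beta>"
    and V: "\<And>p. p \<in> X \<Longrightarrow> elementary p (V p)" and W: "\<And>p. p \<in> X \<Longrightarrow> elementary p (W p)"
    and maps: "\<And>p. p \<in> X \<Longrightarrow> \<alpha> ` V p \<subseteq> W p" "\<And>p. p \<in> X \<Longrightarrow> \<beta> ` V p \<subseteq> W p"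
    and cardW: "\<And>p. p \<in> X \<Longrightarrow> card (relation_chains \<alpha>' \<beta>' (W p) 0) = p ^ w"
    and card: "\<And>p i. p \<in> X \<Longrightarrow> i \<le> Suc m \<Longrightarrow> card (relation_chains \<alpha> \<beta> (V p) i) = p ^ d i"
    and trivial: "\<And>p. p \<in> X \<Longrightarrow> relation_chains \<alpha> \<beta> (V p) m = {0}"
    and add': "Modules.additive \<alpha>'" "Modules.additive (\<beta>' :: 'b \<Rightarrow> 'c::ab_group_add)"
  shows "poly_on X (\<lambda>p. int (card (subreps (\<lambda>a. \<alpha> \<circ> a) (\<lambda>a. \<beta> \<circ> a)
           (relation_chains \<alpha> \<beta> (V p) 0) (relation_chains \<alpha>' \<beta>' (W p) 0) (p ^ e) (p ^ f))))"
proof -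
  let ?C = "\<lambda>p. relation_chains \<alpha> \<beta> (V p)"
  have el: "elementary p (?C p i)" if "p \<in> X" for p i
    by (rule elementary_chains[OF V[OF that] add])
  have elW: "elementary p (relation_chains \<alpha>' \<beta>' (W p) 0)" if "p \<in> X" for p
    by (rule elementary_chains[OF W[OF that] add'])
  have sV: "subgrp (V p)" if "p \<in> X" for p using elementary_subgrp[OF V[OF that]] .
  have step0: "reflection p (?C p (Suc 0)) (?C p 0) (relation_chains \<alpha>' \<beta>' (W p) 0)
      (drop_last (Suc 0)) drop_first (\<lambda>a. \<alpha> \<circ> a) (\<lambda>a. \<beta> \<circ> a) (d (Suc 0)) (d 0) w" if p: "p \<in> X" for p
  proof (rule reflection.intro[OF prime[OF p] el[OF p] card[OF p _] el[OF p] card[OF p _] elW[OF p] cardW[OF p]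
      additive_drop_last additive_drop_first additive_comp_left[OF add(1)] additive_comp_left[OF add(2)]])
    show "(\<lambda>a. \<alpha> \<circ> a) ` ?C p 0 \<subseteq> relation_chains \<alpha>' \<beta>' (W p) 0" "(\<lambda>a. \<beta> \<circ> a) ` ?C p 0 \<subseteq> relation_chains \<alpha>' \<beta>' (W p) 0"
      using maps[OF p] by (auto simp: relation_chains_def additive.zero[OF add(1)] additive.zero[OF add(2)])
  qed (simp_all add: chain_glue_0[OF sV[OF p] add])
  have step: "reflection p (?C p (Suc (Suc i))) (?C p (Suc i)) (?C p i)
      (drop_last (Suc (Suc i))) drop_first (drop_last (Suc i)) drop_first (d (Suc (Suc i))) (d (Suc i)) (d i)"
    if p: "p \<in> X" and i: "Suc i \<le> m" for p i
  proof (rule reflection.intro[OF prime[OF p] el[OF p] card[OF p] el[OF p] card[OF p] el[OF p] card[OF p]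
      additive_drop_last additive_drop_first additive_drop_last additive_drop_first])
    show "Suc (Suc i) \<le> Suc m" "Suc i \<le> Suc m" "i \<le> Suc m" using i by simp_all
    show "drop_last (Suc i) ` ?C p (Suc i) \<subseteq> ?C p i" "drop_first ` ?C p (Suc i) \<subseteq> ?C p i"
      using drop_last_chains[OF sV[OF p]] drop_first_chains by blast+
  qed (rule chain_glue_Suc[OF sV[OF p]])
  have tail: "poly_on X (\<lambda>p. int (card (subreps (drop_last (Suc i)) drop_first (?C p (Suc i)) (?C p i) (p ^ e) (p ^ f))))"
    if "i \<le> m" for i e f
    using that
  proof (induction "m - i" arbitrary: i e f)
    case 0
    hence i: "i = m" by simp
    have "?C p (Suc i) = {0}" if p: "p \<in> X" for p
    proof -
      have "a = 0" if a: "a \<in> ?C p (Suc i)" for a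
      proof -
        have "drop_last (Suc i) a = 0" "drop_first a = 0"
          using drop_last_chains[OF sV[OF p] a] drop_first_chains[OF a] trivial[OF p] i by auto
        thus "a = 0"
          using inj_onD[OF chain_glue_inj, of i a 0 \<alpha> \<beta> "V p"] a subgrp_0[OF elementary_subgrp[OF el[OF p]]]
          by (auto simp: additive.zero[OF additive_drop_last] additive.zero[OF additive_drop_first])
      qed
      thus ?thesis using subgrp_0[OF elementary_subgrp[OF el[OF p]]] by blast
    qed
    moreover have "poly_on X (\<lambda>p. int (card (subreps (drop_last (Suc i)) drop_first {0} (?C p i) (p ^ e) (p ^ f))))"
      by (rule poly_on_subreps_trivial[OF prime el card additive_drop_last additive_drop_first]) (simp_all add: i)
    ultimately show ?case by (simp cong: poly_on_cong)
  next
    case (Suc n)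
    hence i: "n = m - Suc i" "Suc i \<le> m" by auto
    from poly_on_subreps_reflection[OF step[OF _ i(2)] Suc.hyps(1)[OF i]] show ?case .
  qed
  show ?thesis by (rule poly_on_subreps_reflection[OF step0 tail]) simp_all
qed

section \<open>Integer linear systems modulo almost all primes\<close>

text \<open>The unknowns \<open>x i\<close> range over the group \<open>T\<close>, which will be of prime order, while the coefficients
  are integers that do not depend on the prime.\<close>

definition solutions :: "'i set \<Rightarrow> ('i \<Rightarrow> int) set \<Rightarrow> 'a::ab_group_add set \<Rightarrow> ('i \<Rightarrow> 'a) set"
  where "solutions I Q T =
    {x. (\<forall>i\<in>I. x i \<in> T) \<and> (\<forall>i. i \<notin> I \<longrightarrow> x i = 0) \<and> (\<forall>q\<in>Q. (\<Sum>i\<in>I. zsmul (q i) (x i)) = 0)}"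

lemma subgrp_solutions: "subgrp T \<Longrightarrow> subgrp (solutions I Q T)"
  by (auto simp: subgrp_def solutions_def zsmul_diff_right sum_subtractf)

lemma finite_solutions:
  assumes "finite I" "finite T"
  shows "finite (solutions I Q T)"
proof (rule finite_subset)
  show "solutions I Q T \<subseteq> {x. \<forall>i. (i \<in> I \<longrightarrow> x i \<in> T) \<and> (i \<notin> I \<longrightarrow> x i = 0)}"
    by (auto simp: solutions_def)
qed (rule finite_set_of_finite_funs[OF assms])

text \<open>Gaussian elimination over the integers uses finitely many pivots; modulo a prime that divides
  none of them it proceeds in the same way.\<close>

theorem card_solutions:
  fixes I :: "'i set"
  assumes "finite I" "finite Q"
  shows "\<exists>d N. \<forall>p (T :: 'a::ab_group_add set). prime p \<longrightarrow> N < p \<longrightarrow> elementary p T \<longrightarrow> card T = p \<longrightarrow>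
    card (solutions I Q T) = p ^ d"
  using assms
proof (induction I arbitrary: Q rule: finite_induct)
  case (empty Q)
  have "solutions {} Q (T :: 'a set) = {\<lambda>_. 0}" for T by (auto simp: solutions_def)
  hence "card (solutions {} Q T) = p ^ 0" for p and T :: "'a set" by simp
  thus ?case by blast
next
  case (insert i0 I Q)
  have sum_x: "(\<Sum>i\<in>insert i0 I. zsmul (q i) (x i)) = zsmul (q i0) (x i0) + (\<Sum>i\<in>I. zsmul (q i) (x i))"
    for q and x :: "'i \<Rightarrow> 'a"
    using insert.hyps by simp
  have sum_0: "(\<Sum>i\<in>I. zsmul (q i) (if i = i0 then t else x i)) = (\<Sum>i\<in>I. zsmul (q i) (x i))"
    for q and x :: "'i \<Rightarrow> 'a" and t
    by (rule sum.cong) (use insert.hyps in auto)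
  show ?case
  proof (cases "\<forall>q\<in>Q. q i0 = 0")
    case True
    from insert.IH[OF insert.prems] obtain d N
      where d: "\<And>p (T :: 'a set). prime p \<Longrightarrow> N < p \<Longrightarrow> elementary p T \<Longrightarrow> card T = p \<Longrightarrow>
        card (solutions I Q T) = p ^ d" by blast
    have "card (solutions (insert i0 I) Q T) = p ^ Suc d"
      if p: "prime p" "N < p" "elementary p T" "card T = p" for p and T :: "'a set"
    proof -
      have sum: "(\<Sum>i\<in>insert i0 I. zsmul (q i) (x i)) = (\<Sum>i\<in>I. zsmul (q i) (x i))"
        if "q \<in> Q" for q and x :: "'i \<Rightarrow> 'a"
        by (simp add: sum_x bspec[OF True that])
      have sol: "solutions (insert i0 I) Q T =
          {x. (\<forall>i\<in>insert i0 I. x i \<in> T) \<and> (\<forall>i. i \<notin> insert i0 I \<longrightarrow> x i = 0) \<and>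
              (\<forall>q\<in>Q. (\<Sum>i\<in>I. zsmul (q i) (x i)) = 0)}"
        unfolding solutions_def by (simp only: sum cong: ball_cong)
      have "bij_betw (\<lambda>x. (x i0, x(i0 := 0))) (solutions (insert i0 I) Q T) (T \<times> solutions I Q T)"
        by (rule bij_betw_byWitness[where f' = "\<lambda>(t, x). x(i0 := t)"])
           (use insert.hyps in \<open>auto simp: sol solutions_def[of I] sum_0 fun_eq_iff split: if_splits\<close>)
      from bij_betw_same_card[OF this] d[OF p] p(4) show ?thesis by (simp add: card_cartesian_product)
    qed
    thus ?thesis by blast
  next
    case False
    then obtain r where r: "r \<in> Q" "r i0 \<noteq> 0" by blast
    \<comment> \<open>The equation \<open>r\<close> is the pivot by which the unknown \<open>x i0\<close> is eliminated from the others.\<close>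
    define Q' where "Q' = (\<lambda>q i. r i0 * q i - q i0 * r i) ` Q"
    have "finite Q'" using insert.prems by (simp add: Q'_def)
    from insert.IH[OF this] obtain d N
      where d: "\<And>p (T :: 'a set). prime p \<Longrightarrow> N < p \<Longrightarrow> elementary p T \<Longrightarrow> card T = p \<Longrightarrow>
        card (solutions I Q' T) = p ^ d" by blast
    have elim: "(\<Sum>i\<in>I. zsmul (r i0 * q i - q i0 * r i) (x i)) =
        zsmul (r i0) (\<Sum>i\<in>I. zsmul (q i) (x i)) - zsmul (q i0) (\<Sum>i\<in>I. zsmul (r i) (x i))"
      for q and x :: "'i \<Rightarrow> 'a"
      by (simp add: zsmul_sum_right zsmul_zsmul zsmul_diff_left sum_subtractf)
    have "card (solutions (insert i0 I) Q T) = p ^ d"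
      if p: "prime p" "max N (nat \<bar>r i0\<bar>) < p" "elementary p T" "card T = p" for p and T :: "'a set"
    proof -
      have T: "subgrp T" using elementary_subgrp[OF p(3)] .
      have ndvd: "\<not> int p dvd r i0"
      proof
        assume "int p dvd r i0"
        from dvd_imp_le_int[OF r(2) this] have "int p \<le> \<bar>r i0\<bar>" by simp
        thus False using p(2) by linarith
      qed
      have cancel: "t = 0" if "t \<in> T" "zsmul (r i0) t = 0" for t
        using zsmul_mem_imp_mem[OF p(1) subgrp_singleton_0 _ ndvd, of t] that elementary_zsmul[OF p(3)] by simp
      have "bij_betw (\<lambda>x. x(i0 := 0)) (solutions (insert i0 I) Q T) (solutions I Q' T)"
        unfolding bij_betw_def
      proof (intro conjI equalityI subsetI)
        show "inj_on (\<lambda>x. x(i0 := 0)) (solutions (insert i0 I) Q T)"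
        proof (rule inj_onI)
          fix x y :: "'i \<Rightarrow> 'a"
          assume x: "x \<in> solutions (insert i0 I) Q T" and y: "y \<in> solutions (insert i0 I) Q T"
            and eq: "x(i0 := 0) = y(i0 := 0)"
          have off: "x i = y i" if "i \<noteq> i0" for i using fun_cong[OF eq, of i] that by simp
          have "(\<Sum>i\<in>I. zsmul (r i) (x i)) = (\<Sum>i\<in>I. zsmul (r i) (y i))"
          proof (rule sum.cong[OF refl])
            fix i assume "i \<in> I"
            hence "i \<noteq> i0" using insert.hyps by blast
            thus "zsmul (r i) (x i) = zsmul (r i) (y i)" by (simp add: off)
          qed
          hence "zsmul (r i0) (x i0) = zsmul (r i0) (y i0)"
            using x y r(1) by (simp add: solutions_def sum_x) (metis add_right_imp_eq)
          hence "zsmul (r i0) (x i0 - y i0) = 0" by (simp add: zsmul_diff_right)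
          moreover have "x i0 - y i0 \<in> T"
            using x y by (auto simp: solutions_def intro: subgrp_diff[OF T])
          ultimately have "x i0 - y i0 = 0" by (rule cancel[rotated])
          hence "x i = y i" for i using off[of i] by (cases "i = i0") auto
          thus "x = y" by blast
        qed
      next
        fix z assume "z \<in> (\<lambda>x. x(i0 := 0)) ` solutions (insert i0 I) Q T"
        then obtain x where x: "x \<in> solutions (insert i0 I) Q T" "z = x(i0 := 0)" by blast
        have "(\<Sum>i\<in>I. zsmul (q i) (x i)) = - zsmul (q i0) (x i0)" if "q \<in> Q" for q
          using x(1) that by (simp add: solutions_def sum_x eq_neg_iff_add_eq_0 add.commute)
        hence "(\<Sum>i\<in>I. zsmul (r i0 * q i - q i0 * r i) (x i)) = 0" if "q \<in> Q" for q
          using that r(1) unfolding elim by (simp add: zsmul_minus_right zsmul_zsmul mult.commute)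
        thus "z \<in> solutions I Q' T"
          using x insert.hyps by (auto simp: solutions_def Q'_def sum_0)
      next
        fix y assume y: "y \<in> solutions I Q' T"
        define s where "s = - (\<Sum>i\<in>I. zsmul (r i) (y i))"
        have s: "s \<in> T" unfolding s_def
          using y T by (auto simp: solutions_def intro!: subgrp_minus subgrp_sum subgrp_zsmul)
        have "coprime (int p) (r i0)" using p(1) ndvd by (simp add: prime_imp_coprime)
        then obtain a b where ab: "a * int p + b * r i0 = 1"
          using bezout_int[of "int p" "r i0"] by (auto simp: coprime_iff_gcd_eq_1)
        define t where "t = zsmul b s"
        have t: "t \<in> T" unfolding t_def using s T by (intro subgrp_zsmul)
        have "s = zsmul (a * int p + b * r i0) s" using ab by simp
        also have "\<dots> = zsmul (r i0) t"
          using elementary_zsmul[OF p(3) s]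
          by (simp add: zsmul_add_left t_def zsmul_zsmul mult.commute) (simp flip: zsmul_zsmul)
        finally have rt: "zsmul (r i0) t = s" ..
        have "zsmul (q i0) t + (\<Sum>i\<in>I. zsmul (q i) (y i)) = 0" if q: "q \<in> Q" for q
        proof (rule cancel)
          show "zsmul (q i0) t + (\<Sum>i\<in>I. zsmul (q i) (y i)) \<in> T"
            using y T t by (auto simp: solutions_def intro!: subgrp_add subgrp_sum subgrp_zsmul)
          have "(\<Sum>i\<in>I. zsmul (r i0 * q i - q i0 * r i) (y i)) = 0"
            using y q by (auto simp: solutions_def Q'_def)
          hence "zsmul (r i0) (\<Sum>i\<in>I. zsmul (q i) (y i)) = - zsmul (q i0) s"
            unfolding elim by (simp add: s_def zsmul_minus_right)
          moreover have "zsmul (r i0) (zsmul (q i0) t) = zsmul (q i0) s"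
            using rt by (simp add: zsmul_zsmul mult.commute) (metis zsmul_zsmul mult.commute)
          ultimately show "zsmul (r i0) (zsmul (q i0) t + (\<Sum>i\<in>I. zsmul (q i) (y i))) = 0"
            by (simp add: zsmul_add_right)
        qed
        hence "y(i0 := t) \<in> solutions (insert i0 I) Q T"
          using y t insert.hyps by (auto simp: solutions_def sum_0)
        moreover have "y = (y(i0 := t))(i0 := 0)"
          using y insert.hyps by (auto simp: solutions_def fun_eq_iff)
        ultimately show "y \<in> (\<lambda>x. x(i0 := 0)) ` solutions (insert i0 I) Q T" by blast
      qed
      from bij_betw_same_card[OF this] d[OF p(1) _ p(3,4)] p(2) show ?thesis by simp
    qed
    thus ?thesis by blast
  qed
qed

text \<open>The kernel of \<open>G\<close> on the solutions is again the solution set of an integer system.\<close>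

corollary card_image_solutions:
  fixes G :: "('i \<Rightarrow> 'a::ab_group_add) \<Rightarrow> 'b::ab_group_add"
  assumes fin: "finite I" "finite Q" "finite Q'" and G: "Modules.additive G"
    and ker: "\<And>x. G x = 0 \<longleftrightarrow> (\<forall>q\<in>Q'. (\<Sum>i\<in>I. zsmul (q i) (x i)) = 0)"
  shows "\<exists>d N. \<forall>p (T :: 'a set). prime p \<longrightarrow> N < p \<longrightarrow> elementary p T \<longrightarrow> card T = p \<longrightarrow>
    card (G ` solutions I Q T) = p ^ d"
proof -
  from card_solutions[OF fin(1,2)] obtain d N
    where d: "\<And>p (T :: 'a set). prime p \<Longrightarrow> N < p \<Longrightarrow> elementary p T \<Longrightarrow> card T = p \<Longrightarrow>
        card (solutions I Q T) = p ^ d" by blast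
  have "finite (Q \<union> Q')" using fin by simp
  from card_solutions[OF fin(1) this] obtain d' N'
    where d': "\<And>p (T :: 'a set). prime p \<Longrightarrow> N' < p \<Longrightarrow> elementary p T \<Longrightarrow> card T = p \<Longrightarrow>
        card (solutions I (Q \<union> Q') T) = p ^ d'" by blast
  have "card (G ` solutions I Q T) = p ^ (d - d')"
    if p: "prime p" "max N N' < p" "elementary p T" "card T = p" for p and T :: "'a set"
  proof -
    have p1: "p > 1" using p(1) by (rule prime_gt_1_nat)
    have "{x \<in> solutions I Q T. G x = 0} = solutions I (Q \<union> Q') T"
      by (auto simp: solutions_def ker)
    hence eq: "p ^ d = card (G ` solutions I Q T) * p ^ d'"
      using card_additive_image[OF G subgrp_solutions finite_solutions, of T I Q] fin(1) p d d'
      by (simp add: elementary_subgrp elementary_finite)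
    hence "p ^ d' dvd p ^ d" by simp
    hence "d' \<le> d" using p1 by (simp add: dvd_power_iff_le)
    hence "p ^ (d - d') * p ^ d' = card (G ` solutions I Q T) * p ^ d'"
      using eq by (simp flip: power_add)
    thus ?thesis using p1 by simp
  qed
  thus ?thesis by blast
qed

section \<open>The group of rational numbers modulo the integers\<close>

text \<open>The elements of \<open>\<rat>/\<int>\<close> killed by \<open>p\<close> form a copy of $\mathbb{F}_p$.  Counts for different primes
  thus concern subsets of one and the same type.\<close>

quotient_type rat_mod_int = rat / "\<lambda>x y. x - y \<in> \<int>"
proof (rule equivpI)
  show "reflp (\<lambda>x y :: rat. x - y \<in> \<int>)" by (simp add: reflp_def)
  show "symp (\<lambda>x y :: rat. x - y \<in> \<int>)"
    by (auto simp: symp_def) (metis Ints_minus minus_diff_eq)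
  show "transp (\<lambda>x y :: rat. x - y \<in> \<int>)"
    by (auto simp: transp_def) (metis Ints_add diff_add_cancel add_diff_eq)
qed

instantiation rat_mod_int :: ab_group_add
begin

lift_definition zero_rat_mod_int :: rat_mod_int is 0 .

lift_definition plus_rat_mod_int :: "rat_mod_int \<Rightarrow> rat_mod_int \<Rightarrow> rat_mod_int" is "(+)"
  by (metis Ints_add add_diff_add)

lift_definition uminus_rat_mod_int :: "rat_mod_int \<Rightarrow> rat_mod_int" is uminus
  by (metis Ints_minus minus_diff_minus)

lift_definition minus_rat_mod_int :: "rat_mod_int \<Rightarrow> rat_mod_int \<Rightarrow> rat_mod_int" is "(-)"
  by (metis Ints_diff diff_diff_eq2 diff_add_eq diff_diff_add add.commute)

instance
  by standard (transfer; simp add: algebra_simps)+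

end

lift_definition residue :: "nat \<Rightarrow> int \<Rightarrow> rat_mod_int" is "\<lambda>p n. of_int n / of_nat p" .

lemma additive_residue: "Modules.additive (residue p)"
  by unfold_locales (transfer, simp add: add_divide_distrib)

lemma residue_eq_0_iff: "p > 0 \<Longrightarrow> residue p n = 0 \<longleftrightarrow> int p dvd n"
proof transfer
  fix p :: nat and n :: int assume p: "p > 0"
  have "(of_int n / of_nat p :: rat) \<in> \<int> \<longleftrightarrow> int p dvd n"
  proof
    assume "(of_int n / of_nat p :: rat) \<in> \<int>"
    then obtain k where "(of_int n / of_nat p :: rat) = of_int k" by (rule Ints_cases)
    hence "(of_int n :: rat) = of_int (k * int p)" using p by (simp add: field_simps)
    hence "n = k * int p" by (simp only: of_int_eq_iff)
    thus "int p dvd n" by simp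
  next
    assume "int p dvd n"
    then obtain k where "n = int p * k" ..
    thus "(of_int n / of_nat p :: rat) \<in> \<int>" using p by simp
  qed
  thus "(of_int n / of_nat p - 0 :: rat) \<in> \<int> \<longleftrightarrow> int p dvd n" by simp
qed

lemma residue_eq_iff: "p > 0 \<Longrightarrow> residue p m = residue p n \<longleftrightarrow> int p dvd m - n"
  using residue_eq_0_iff[of p "m - n"] by (simp add: additive.diff[OF additive_residue])

lemma zsmul_residue: "zsmul m (residue p n) = residue p (m * n)"
  using additive_zsmul[OF additive_residue, of p m n] by (simp add: zsmul_int)

definition residues_mod :: "nat \<Rightarrow> rat_mod_int set"
  where "residues_mod p = range (residue p)"

lemma card_residues_mod: "p > 0 \<Longrightarrow> card (residues_mod p) = p"
proof -
  assume p: "p > 0"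
  have "residues_mod p = residue p ` {0..<int p}"
  proof -
    have "residue p n \<in> residue p ` {0..<int p}" for n
    proof (rule image_eqI)
      show "residue p n = residue p (n mod int p)" using p by (simp add: residue_eq_iff)
      show "n mod int p \<in> {0..<int p}" using p by simp
    qed
    thus ?thesis by (auto simp: residues_mod_def)
  qed
  moreover have "inj_on (residue p) {0..<int p}"
  proof (rule inj_onI)
    fix m n assume mn: "m \<in> {0..<int p}" "n \<in> {0..<int p}" "residue p m = residue p n"
    hence "int p dvd m - n" using p by (simp only: residue_eq_iff)
    hence "m mod int p = n mod int p" by (simp only: mod_eq_dvd_iff)
    thus "m = n" using mn by simp
  qed
  ultimately show ?thesis by (simp add: card_image)
qed

lemma elementary_residues_mod: "p > 0 \<Longrightarrow> elementary p (residues_mod p)"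
  unfolding elementary_def
proof (intro conjI ballI)
  show "subgrp (residues_mod p)"
    unfolding residues_mod_def
    by (rule subgrp_image[OF additive_residue]) (simp add: subgrp_def)
  assume p: "p > 0"
  show "finite (residues_mod p)" using card_residues_mod[OF p] p card_gt_0_iff by metis
  show "zsmul (int p) v = 0" if "v \<in> residues_mod p" for v
    using that p by (auto simp: residues_mod_def zsmul_residue residue_eq_0_iff)
qed

section \<open>Lie polynomials as functions on words\<close>

text \<open>The product of the free associative ring, whose elements are viewed as functions on words.  The
  recursion over the words makes the ring laws follow by plain inductions;
  \<open>conv_eq_sum\<close> is the usual formula.\<close>

fun conv :: "('x list \<Rightarrow> int) \<Rightarrow> ('x list \<Rightarrow> int) \<Rightarrow> 'x list \<Rightarrow> int" where
  "conv g h [] = g [] * h []"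
| "conv g h (x # v) = g [] * h (x # v) + conv (\<lambda>u. g (x # u)) h v"

lemma conv_add_left: "conv (\<lambda>u. g u + g' u) h v = conv g h v + conv g' h v"
  by (induction v arbitrary: g g') (simp_all add: algebra_simps)

lemma conv_add_right: "conv g (\<lambda>u. h u + h' u) v = conv g h v + conv g h' v"
  by (induction v arbitrary: g) (simp_all add: algebra_simps)

lemma conv_mult_left: "conv (\<lambda>u. a * g u) h v = a * conv g h v"
  by (induction v arbitrary: g) (simp_all add: algebra_simps)

lemma conv_assoc: "conv (conv g h) l v = conv g (conv h l) v"
proof (induction v arbitrary: g)
  case (Cons x v)
  have "(\<lambda>u. conv g h (x # u)) = (\<lambda>u. g [] * h (x # u) + conv (\<lambda>u. g (x # u)) h u)" by simp
  thus ?case using Cons.IH[of "\<lambda>u. g (x # u)"]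
    by (simp only: conv.simps conv_add_left conv_mult_left) (simp add: algebra_simps)
qed (simp add: algebra_simps)

lemma additive_conv_left: "Modules.additive (\<lambda>g. conv g h)"
  by unfold_locales (auto simp: fun_eq_iff conv_add_left plus_fun_def)

lemma additive_conv_right: "Modules.additive (\<lambda>h. conv g h)"
  by unfold_locales (auto simp: fun_eq_iff conv_add_right plus_fun_def)

lemma conv_nonzeroE:
  assumes "conv g h v \<noteq> 0"
  obtains s t where "v = s @ t" "g s \<noteq> 0" "h t \<noteq> 0"
  using assms
proof (induction v arbitrary: g thesis)
  case Nil
  show ?case by (rule Nil(1)[of "[]" "[]"]) (use Nil in auto)
next
  case (Cons x v)
  show ?case
  proof (cases "g [] * h (x # v) = 0")
    case True
    hence "conv (\<lambda>u. g (x # u)) h v \<noteq> 0" using Cons.prems(2) by (metis add_0 conv.simps(2))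
    then obtain s t where "v = s @ t" "g (x # s) \<noteq> 0" "h t \<noteq> 0" using Cons.IH[of "\<lambda>u. g (x # u)"] by metis
    thus ?thesis by (intro Cons.prems(1)[of "x # s" t]) auto
  next
    case False
    thus ?thesis by (intro Cons.prems(1)[of "[]" "x # v"]) auto
  qed
qed

lemma conv_eq_sum: "conv g h v = (\<Sum>i\<le>length v. g (take i v) * h (drop i v))"
  by (induction v arbitrary: g) (simp_all add: sum.atMost_Suc_shift del: sum.atMost_Suc)

text \<open>Exchanging the two factors of a factorisation of \<open>x\<^sup>n\<close> gives a factorisation of \<open>x\<^sup>n\<close> again.
  Hence commutators vanish at such words.\<close>

lemma conv_replicate_commute: "conv g h (replicate n x) = conv h g (replicate n x)"
proof -
  have "conv g h (replicate n x) = (\<Sum>i\<le>n. g (replicate i x) * h (replicate (n - i) x))"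
    unfolding conv_eq_sum by (rule sum.cong) (auto simp: min_def)
  also have "\<dots> = (\<Sum>i\<le>n. g (replicate (n - i) x) * h (replicate (n - (n - i)) x))"
    by (rule sum.nat_diff_reindex[symmetric, where n = "Suc n", simplified lessThan_Suc_atMost, simplified])
  also have "\<dots> = (\<Sum>i\<le>n. h (replicate i x) * g (replicate (n - i) x))"
    by (rule sum.cong) auto
  also have "\<dots> = conv h g (replicate n x)"
    unfolding conv_eq_sum by (rule sum.cong) (auto simp: min_def)
  finally show ?thesis .
qed

definition commutator :: "('x list \<Rightarrow> int) \<Rightarrow> ('x list \<Rightarrow> int) \<Rightarrow> 'x list \<Rightarrow> int"
  where "commutator g h = conv g h - conv h g"

lemma commutator_self: "commutator g g = 0"
  by (simp add: commutator_def)

lemma commutator_jacobi: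
  "commutator (commutator g h) l + commutator (commutator h l) g + commutator (commutator l g) h = 0"
  by (simp add: commutator_def additive.diff[OF additive_conv_left] additive.diff[OF additive_conv_right]
      conv_assoc fun_eq_iff)

lemma additive_commutator_left: "Modules.additive (\<lambda>g. commutator g h)"
  by unfold_locales
     (simp add: commutator_def additive.add[OF additive_conv_left] additive.add[OF additive_conv_right])

lemma additive_commutator_right: "Modules.additive (commutator g)"
  by unfold_locales
     (simp add: commutator_def additive.add[OF additive_conv_left] additive.add[OF additive_conv_right])

text \<open>The coefficients of the words in a Lie monomial, expanded in the free associative ring.\<close>

primrec lie_coeff :: "'x magma \<Rightarrow> 'x list \<Rightarrow> int" where
  "lie_coeff (Gen x) = (\<lambda>v. if v = [x] then 1 else 0)"
| "lie_coeff (Br u v) = commutator (lie_coeff u) (lie_coeff v)"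

lemma lie_coeff_support: "lie_coeff w v \<noteq> 0 \<Longrightarrow> length v = degree_magma w"
proof (induction w arbitrary: v)
  case (Br w1 w2)
  hence "conv (lie_coeff w1) (lie_coeff w2) v \<noteq> 0 \<or> conv (lie_coeff w2) (lie_coeff w1) v \<noteq> 0"
    by (auto simp: commutator_def)
  thus ?case using Br.IH by (auto elim!: conv_nonzeroE)
qed (auto split: if_splits)

lemma lie_coeff_replicate: "degree_magma w \<noteq> 1 \<Longrightarrow> lie_coeff w (replicate n x) = 0"
  by (cases w) (auto simp: commutator_def conv_replicate_commute)

text \<open>The commutator with a letter from the right, written out in a form that makes sense for
  coefficients in an arbitrary abelian group; see \<open>commutator_letter\<close>.\<close>

definition bracket_letter :: "'x \<Rightarrow> ('x list \<Rightarrow> 'a::ab_group_add) \<Rightarrow> 'x list \<Rightarrow> 'a"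
  where "bracket_letter x f v =
    (if v \<noteq> [] \<and> last v = x then f (butlast v) else 0) - (if v \<noteq> [] \<and> hd v = x then f (tl v) else 0)"

lemma conv_zero_left: "conv (\<lambda>u. 0) h v = 0"
  by (induction v) auto

lemma conv_letter_right:
  "conv f (lie_coeff (Gen x)) v = (if v \<noteq> [] \<and> last v = x then f (butlast v) else 0)"
  by (induction v arbitrary: f) auto

lemma conv_letter_left:
  "conv (lie_coeff (Gen x)) f v = (if v \<noteq> [] \<and> hd v = x then f (tl v) else 0)"
proof (cases v)
  case (Cons y u)
  have unit: "conv (\<lambda>u. if u = [] then 1 else 0) f u = f u" for u :: "'a list"
    by (cases u) (simp_all add: conv_zero_left)
  show ?thesis
    by (cases "y = x") (simp_all add: Cons unit conv_zero_left cong: if_cong)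
qed simp

lemma commutator_letter: "commutator f (lie_coeff (Gen x)) = bracket_letter x f"
  unfolding commutator_def by (rule ext) (simp only: minus_apply conv_letter_right conv_letter_left bracket_letter_def)

lemma additive_bracket_letter: "Modules.additive (bracket_letter x)"
  by unfold_locales (auto simp: bracket_letter_def fun_eq_iff)

lemma bracket_letter_sum_zsmul:
  "bracket_letter x (\<lambda>v. \<Sum>w\<in>S. zsmul (n w v) (t w)) v = (\<Sum>w\<in>S. zsmul (bracket_letter x (n w) v) (t w))"
  by (simp add: bracket_letter_def zsmul_diff_left sum_subtractf zsmul_minus_left sum_negf)

section \<open>The bracket with a letter is injective\<close>

text \<open>The kernel of the bracket with \<open>x\<close> on the homogeneous polynomials of degree \<open>k\<close> consists of the
  multiples of \<open>x\<^sup>k\<close>.  The Lie polynomials of degree at least two have no such terms, which is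
  all that injectivity requires of them.\<close>

definition no_pure_powers :: "nat \<Rightarrow> ('x list \<Rightarrow> 'a::ab_group_add) set"
  where "no_pure_powers k = {f. (\<forall>v. length v \<noteq> k \<longrightarrow> f v = 0) \<and> (\<forall>x. f (replicate k x) = 0)}"

text \<open>If \<open>f x = x f\<close>, the coefficients do not change when leading letters \<open>x\<close> are rotated to the
  end of a word, and they vanish at the words \<open>y u\<close> with \<open>y \<noteq> x\<close>, because \<open>f x\<close> has the coefficient of
  \<open>y u\<close> at the word \<open>y u x\<close> and \<open>x f\<close> has zero there.\<close>

lemma bracket_letter_inject:
  assumes f: "f \<in> no_pure_powers k" and 0: "bracket_letter x f = 0"
  shows "f = 0"
proof
  have rot: "f (x # u) = f (u @ [x])" for u
    using fun_cong[OF 0, of "x # u @ [x]"] by (simp add: bracket_letter_def butlast_append)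
  have other: "f (y # u) = 0" if "y \<noteq> x" for y u
    using fun_cong[OF 0, of "y # u @ [x]"] that by (simp add: bracket_letter_def butlast_append)
  have rots: "f (replicate i x @ u) = f (u @ replicate i x)" for i u
  proof (induction i arbitrary: u)
    case (Suc i)
    show ?case using rot[of "replicate i x @ u"] Suc.IH[of "u @ [x]"] by simp
  qed simp
  fix v
  show "f v = 0 v"
  proof (cases "length v = k")
    case True
    show ?thesis
    proof (cases "dropWhile (\<lambda>y. y = x) v")
      case Nil
      hence "\<forall>y\<in>set v. y = x" by (simp add: dropWhile_eq_Nil_conv)
      hence "v = replicate k x" using replicate_length_same[of v x] True by simp
      thus ?thesis using f by (simp add: no_pure_powers_def)
    next
      case (Cons y u)
      have y: "y \<noteq> x" using hd_dropWhile[of "\<lambda>y. y = x" v] Cons by auto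
      have "takeWhile (\<lambda>y. y = x) v = replicate (length (takeWhile (\<lambda>y. y = x) v)) x"
        by (rule replicate_length_same[symmetric]) (auto dest: set_takeWhileD)
      hence "v = replicate (length (takeWhile (\<lambda>y. y = x) v)) x @ y # u"
        using takeWhile_dropWhile_id[of "\<lambda>y. y = x" v] Cons by simp
      hence "f v = f (y # u @ replicate (length (takeWhile (\<lambda>y. y = x) v)) x)"
        using rots[of "length (takeWhile (\<lambda>y. y = x) v)" "y # u"] by simp
      thus ?thesis using other[OF y] by simp
    qed
  next
    case False
    thus ?thesis using f by (simp add: no_pure_powers_def)
  qed
qed

text \<open>The part of \<open>f\<close> of degree \<open>i\<close> in \<open>x\<close>.\<close>

definition part :: "'x \<Rightarrow> nat \<Rightarrow> ('x list \<Rightarrow> 'a) \<Rightarrow> 'x list \<Rightarrow> 'a::zero"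
  where "part x i f = (\<lambda>v. if count_list v x = i then f v else 0)"

lemma part_no_pure_powers: "f \<in> no_pure_powers k \<Longrightarrow> part x i f \<in> no_pure_powers k"
  by (simp add: no_pure_powers_def part_def)

lemma count_list_butlast: "v \<noteq> [] \<Longrightarrow> count_list v x = count_list (butlast v) x + (if last v = x then 1 else 0)"
  by (induction v rule: rev_induct) auto

lemma count_list_tl: "v \<noteq> [] \<Longrightarrow> count_list v x = count_list (tl v) x + (if hd v = x then 1 else 0)"
  by (cases v) auto

lemma part_bracket_same_0: "part x 0 (bracket_letter x f) = 0"
  by (auto simp: part_def bracket_letter_def fun_eq_iff count_list_0_iff)

lemma part_bracket_same: "part x (Suc i) (bracket_letter x f) = bracket_letter x (part x i f)"
proof
  fix v show "part x (Suc i) (bracket_letter x f) v = bracket_letter x (part x i f) v"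
    using count_list_butlast[of v x] count_list_tl[of v x] by (auto simp: part_def bracket_letter_def)
qed

lemma part_bracket_other: "y \<noteq> x \<Longrightarrow> part x i (bracket_letter y f) = bracket_letter y (part x i f)"
proof
  fix v assume "y \<noteq> x"
  thus "part x i (bracket_letter y f) v = bracket_letter y (part x i f) v"
    using count_list_butlast[of v x] count_list_tl[of v x] by (auto simp: part_def bracket_letter_def)
qed

text \<open>Write \<open>a\<^sub>j\<^sub>,\<^sub>i\<close> for the part of \<open>a\<^sub>j\<close> of degree \<open>i\<close> in \<open>x\<close>.  The equation \<open>[a\<^sub>j, y] = [a\<^sub>j\<^sub>+\<^sub>1, x]\<close> gives
  \<open>[a\<^sub>j\<^sub>,\<^sub>0, y] = 0\<close> and \<open>[a\<^sub>j\<^sub>,\<^sub>i\<^sub>+\<^sub>1, y] = [a\<^sub>j\<^sub>+\<^sub>1\<^sub>,\<^sub>i, x]\<close>; by injectivity each further link of the chain forces one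
  more part of \<open>a\<^sub>0\<close> to vanish.  As the degree in \<open>x\<close> is at most \<open>k\<close>, a chain with \<open>k + 1\<close> links has
  \<open>a\<^sub>0 = 0\<close>, and then the remaining entries vanish one after the other because the bracket with \<open>x\<close> is
  injective, too.\<close>

theorem no_long_chains:
  fixes V :: "('x list \<Rightarrow> 'a::ab_group_add) set"
  assumes V: "V \<subseteq> no_pure_powers k" "0 \<in> V" and xy: "y \<noteq> x"
  shows "relation_chains (bracket_letter x) (bracket_letter y) V (Suc k) = {0}"
proof (intro equalityI subsetI)
  fix a assume a: "a \<in> relation_chains (bracket_letter x) (bracket_letter y) V (Suc k)"
  have npp: "a j \<in> no_pure_powers k" if "j \<le> Suc k" for j
    using a that V by (auto simp: relation_chains_def)
  have rel: "bracket_letter y (a j) = bracket_letter x (a (Suc j))" if "j < Suc k" for j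
    using a that by (auto simp: relation_chains_def)
  have part: "part x i (a j) = 0" if "j + i < Suc k" for i j
    using that
  proof (induction i arbitrary: j)
    case 0
    hence "bracket_letter y (part x 0 (a j)) = 0"
      using part_bracket_other[OF xy, of 0 "a j"] rel[of j] by (simp add: part_bracket_same_0)
    thus ?case by (rule bracket_letter_inject[OF part_no_pure_powers[OF npp], rotated]) (use 0 in simp)
  next
    case (Suc i)
    hence "bracket_letter y (part x (Suc i) (a j)) = bracket_letter x (part x i (a (Suc j)))"
      using part_bracket_other[OF xy, of "Suc i" "a j"] rel[of j] by (simp add: part_bracket_same)
    also have "part x i (a (Suc j)) = 0" by (rule Suc.IH) (use Suc.prems in simp)
    also have "bracket_letter x 0 = (0 :: 'x list \<Rightarrow> 'a)" by (rule additive.zero[OF additive_bracket_letter])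
    finally show ?case
      by (rule bracket_letter_inject[OF part_no_pure_powers[OF npp], rotated]) (use Suc.prems in simp)
  qed
  have "a 0 v = 0" for v
  proof (cases "length v = k")
    case True
    hence "part x (count_list v x) (a 0) = 0" using part[of 0 "count_list v x"] count_le_length[of v x] by simp
    from fun_cong[OF this, of v] show ?thesis by (simp add: part_def)
  next
    case False
    thus ?thesis using npp[of 0] by (simp add: no_pure_powers_def)
  qed
  hence a0: "a 0 = 0" by (simp add: fun_eq_iff)
  have "a j = 0" if "j \<le> Suc k" for j
    using that
  proof (induction j)
    case (Suc j)
    hence "bracket_letter x (a (Suc j)) = bracket_letter y 0"
      using rel[of j] by (metis Suc_leD Suc_le_lessD)
    also have "bracket_letter y 0 = (0 :: 'x list \<Rightarrow> 'a)" by (rule additive.zero[OF additive_bracket_letter])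
    finally show ?case by (rule bracket_letter_inject[OF npp[OF Suc.prems]])
  qed (rule a0)
  moreover have "a j = 0" if "j > Suc k" for j using a that by (simp add: relation_chains_def)
  ultimately have "a j = 0" for j by (cases "j \<le> Suc k") auto
  thus "a \<in> {0}" by (simp add: fun_eq_iff)
next
  fix a :: "nat \<Rightarrow> 'x list \<Rightarrow> 'a" assume "a \<in> {0}"
  thus "a \<in> relation_chains (bracket_letter x) (bracket_letter y) V (Suc k)"
    using V by (auto simp: relation_chains_def additive.zero[OF additive_bracket_letter])
qed

section \<open>Lie polynomials of degree \<open>k\<close> modulo \<open>p\<close>\<close>

text \<open>The homogeneous component of degree \<open>k\<close> of the Lie subring generated by the letters, with
  scalars in \<open>T\<close>.  The coefficients \<open>c w\<close> need not be unique.\<close>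

definition lie_polys :: "'a::ab_group_add set \<Rightarrow> nat \<Rightarrow> ('x list \<Rightarrow> 'a) set"
  where "lie_polys T k =
    {\<lambda>v. \<Sum>w | degree_magma w = k. zsmul (lie_coeff w v) (c w) | c. \<forall>w. c w \<in> T}"

lemma lie_polysI:
  "(\<And>w. c w \<in> T) \<Longrightarrow> f = (\<lambda>v. \<Sum>w | degree_magma w = k. zsmul (lie_coeff w v) (c w)) \<Longrightarrow>
     f \<in> lie_polys T k"
  by (auto simp: lie_polys_def)

lemma degree_magma_pos: "degree_magma w > 0"
  by (induction w) auto

lemma finite_magma_degree_le:
  assumes "finite (UNIV :: 'x set)"
  shows "finite {w :: 'x magma. degree_magma w \<le> k}"
proof (induction k)
  case 0
  have "{w :: 'x magma. degree_magma w \<le> 0} = {}" using degree_magma_pos by (auto simp: not_le)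
  thus ?case by (metis finite.emptyI)
next
  case (Suc k)
  have "{w :: 'x magma. degree_magma w \<le> Suc k} \<subseteq> range Gen \<union>
      (\<lambda>(u, v). Br u v) ` ({w. degree_magma w \<le> k} \<times> {w. degree_magma w \<le> k})"
  proof
    fix w :: "'x magma" assume w: "w \<in> {w. degree_magma w \<le> Suc k}"
    show "w \<in> range Gen \<union> (\<lambda>(u, v). Br u v) ` ({w. degree_magma w \<le> k} \<times> {w. degree_magma w \<le> k})"
    proof (cases w)
      case (Br u v)
      thus ?thesis using w degree_magma_pos[of u] degree_magma_pos[of v] by auto
    qed auto
  qed
  thus ?case by (rule finite_subset) (use Suc assms in auto)
qed

lemma finite_magma_degree: "finite (UNIV :: 'x set) \<Longrightarrow> finite {w :: 'x magma. degree_magma w = k}"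
  by (rule finite_subset[OF _ finite_magma_degree_le[of k]]) auto

lemma subgrp_lie_polys:
  assumes T: "subgrp T"
  shows "subgrp (lie_polys T k :: ('x list \<Rightarrow> 'a::ab_group_add) set)"
proof (rule subgrpI)
  show "0 \<in> (lie_polys T k :: ('x list \<Rightarrow> 'a) set)"
    by (rule lie_polysI[of "\<lambda>_. 0"]) (auto simp: subgrp_0[OF T])
  fix f g :: "'x list \<Rightarrow> 'a" assume f: "f \<in> lie_polys T k" and g: "g \<in> lie_polys T k"
  from f obtain c where c: "\<forall>w. c w \<in> T" "f = (\<lambda>v. \<Sum>w | degree_magma w = k. zsmul (lie_coeff w v) (c w))"
    by (auto simp: lie_polys_def)
  from g obtain d where d: "\<forall>w. d w \<in> T" "g = (\<lambda>v. \<Sum>w | degree_magma w = k. zsmul (lie_coeff w v) (d w))"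
    by (auto simp: lie_polys_def)
  show "f - g \<in> lie_polys T k"
  proof (rule lie_polysI)
    show "c w - d w \<in> T" for w using c d subgrp_diff[OF T] by auto
    show "f - g = (\<lambda>v. \<Sum>w | degree_magma w = k. zsmul (lie_coeff w v) (c w - d w))"
      by (auto simp: c d fun_eq_iff zsmul_diff_right sum_subtractf)
  qed
qed

lemma lie_polys_single:
  assumes fin: "finite (UNIV :: 'x set)" and T: "subgrp T" and t: "t \<in> T"
  shows "(\<lambda>v. zsmul (lie_coeff (w :: 'x magma) v) t) \<in> lie_polys T (degree_magma w)"
proof -
  let ?c = "\<lambda>w'. if w' = w then t else 0"
  have eq: "zsmul (lie_coeff w' v) (?c w') = (if w' = w then zsmul (lie_coeff w v) t else 0)" for w' v
    by simp
  have "(\<lambda>v. zsmul (lie_coeff w v) t) =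
      (\<lambda>v. \<Sum>w' | degree_magma w' = degree_magma w. zsmul (lie_coeff w' v) (?c w'))"
    unfolding eq by (subst sum.delta) (auto intro: finite_magma_degree[OF fin])
  moreover have "?c w' \<in> T" for w' using t subgrp_0[OF T] by auto
  ultimately show ?thesis by (intro lie_polysI[of ?c])
qed

lemma sum_fun_apply: "(\<Sum>i\<in>S. f i) v = (\<Sum>i\<in>S. f i v)" for f :: "'i \<Rightarrow> 'b \<Rightarrow> 'a::ab_group_add"
  by (induction S rule: infinite_finite_induct) auto

lemma lie_polys_induct:
  assumes f: "f \<in> lie_polys T k" and P: "subgrp P"
    and single: "\<And>w t. degree_magma w = k \<Longrightarrow> t \<in> T \<Longrightarrow> (\<lambda>v. zsmul (lie_coeff w v) t) \<in> P"
  shows "f \<in> P"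
proof -
  from f obtain c where c: "\<forall>w. c w \<in> T" "f = (\<lambda>v. \<Sum>w | degree_magma w = k. zsmul (lie_coeff w v) (c w))"
    by (auto simp: lie_polys_def)
  have "f = (\<Sum>w | degree_magma w = k. (\<lambda>v. zsmul (lie_coeff w v) (c w)))"
    by (rule ext) (simp add: c sum_fun_apply)
  also have "\<dots> \<in> P" by (rule subgrp_sum[OF P]) (use c single in auto)
  finally show ?thesis .
qed

lemma bracket_letter_zsmul:
  "bracket_letter x (\<lambda>v. zsmul (n v) t) = (\<lambda>v. zsmul (bracket_letter x n v) t)"
  by (rule ext) (simp add: bracket_letter_def zsmul_diff_left zsmul_minus_left)

lemma bracket_letter_lie_polys:
  assumes fin: "finite (UNIV :: 'x set)" and T: "subgrp T"
  shows "bracket_letter x ` lie_polys T k \<subseteq> (lie_polys T (Suc k) :: ('x list \<Rightarrow> 'a::ab_group_add) set)"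
proof (rule image_subsetI)
  fix f :: "'x list \<Rightarrow> 'a" assume f: "f \<in> lie_polys T k"
  have "f \<in> {f. bracket_letter x f \<in> lie_polys T (Suc k)}"
  proof (rule lie_polys_induct[OF f subgrp_vimage[OF additive_bracket_letter subgrp_lie_polys[OF T]]])
    fix w :: "'x magma" and t assume w: "degree_magma w = k" "t \<in> T"
    have "bracket_letter x (\<lambda>v. zsmul (lie_coeff w v) t) = (\<lambda>v. zsmul (lie_coeff (Br w (Gen x)) v) t)"
      by (simp add: bracket_letter_zsmul commutator_letter[symmetric])
    thus "(\<lambda>v. zsmul (lie_coeff w v) t) \<in> {f. bracket_letter x f \<in> lie_polys T (Suc k)}"
      using lie_polys_single[OF fin T w(2), of "Br w (Gen x)"] w(1) by simp
  qed
  thus "bracket_letter x f \<in> lie_polys T (Suc k)" by simp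
qed

lemma lie_polys_support:
  assumes f: "f \<in> lie_polys T k" and v: "length v \<noteq> k"
  shows "f v = 0"
proof -
  have "lie_coeff w v = 0" if "degree_magma w = k" for w
    using lie_coeff_support[of w v] that v by auto
  thus ?thesis using f by (auto simp: lie_polys_def)
qed

lemma lie_polys_no_pure_powers: "k \<ge> 2 \<Longrightarrow> lie_polys T k \<subseteq> no_pure_powers k"
  by (auto simp: no_pure_powers_def lie_polys_support) (auto simp: lie_polys_def lie_coeff_replicate)

lemma elementary_lie_polys:
  assumes fin: "finite (UNIV :: 'x set)" and T: "elementary p T"
  shows "elementary p (lie_polys T k :: ('x list \<Rightarrow> 'a::ab_group_add) set)"
  unfolding elementary_def
proof (intro conjI ballI)
  show "subgrp (lie_polys T k :: ('x list \<Rightarrow> 'a) set)" by (rule subgrp_lie_polys[OF elementary_subgrp[OF T]])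
  have "(lie_polys T k :: ('x list \<Rightarrow> 'a) set) \<subseteq>
      {f. \<forall>v. (v \<in> {v. length v = k} \<longrightarrow> f v \<in> T) \<and> (v \<notin> {v. length v = k} \<longrightarrow> f v = 0)}"
    using elementary_subgrp[OF T]
    by (auto simp: lie_polys_support) (auto simp: lie_polys_def intro!: subgrp_sum subgrp_zsmul)
  moreover have "finite {v :: 'x list. length v = k}"
    using finite_lists_length_eq[OF fin, of k] by simp
  ultimately show "finite (lie_polys T k :: ('x list \<Rightarrow> 'a) set)"
    by (intro finite_subset[OF _ finite_set_of_finite_funs[OF _ elementary_finite[OF T]]])
  fix f :: "'x list \<Rightarrow> 'a" assume f: "f \<in> lie_polys T k"
  have "zsmul (int p) (\<Sum>w\<in>S. zsmul (n w) (c w)) = 0"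
    if c: "\<forall>w. c w \<in> T" for S :: "'x magma set" and n c
    by (intro elementary_zsmul[OF T] subgrp_sum[OF elementary_subgrp[OF T]]
        subgrp_zsmul[OF elementary_subgrp[OF T]]) (use c in blast)
  thus "zsmul (int p) f = 0"
    using f by (auto simp: lie_polys_def fun_eq_iff zsmul_apply)
qed

subsection \<open>Dimensions are constant for almost all primes\<close>

text \<open>A chain is given by the coefficients of its entries with respect to the Lie monomials.
  Both the condition to be a chain and the condition that such coefficients represent the zero chain
  are integer linear systems that do not depend on \<open>p\<close>.\<close>

theorem card_chains_lie_polys:
  fixes x y :: 'x
  assumes fin: "finite (UNIV :: 'x set)"
  shows "\<exists>d N. \<forall>p (T :: 'a::ab_group_add set). prime p \<longrightarrow> N < p \<longrightarrow> elementary p T \<longrightarrow> card T = p \<longrightarrow>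
    card (relation_chains (bracket_letter x) (bracket_letter y) (lie_polys T k) i) = p ^ d"
proof -
  let ?M = "{w :: 'x magma. degree_magma w = k}"
  let ?I = "{..i} \<times> ?M"
  \<comment> \<open>The linear form \<open>n\<close> in the coefficients of the \<open>j\<close>-th entry of a chain.\<close>
  define slot where "slot j n = (\<lambda>(j', w). if j' = j then n w else 0)" for j :: nat and n :: "'x magma \<Rightarrow> int"
  define G where "G c = (\<lambda>j v. if j \<le> i then \<Sum>w\<in>?M. zsmul (lie_coeff w v) (c (j, w)) else 0)"
    for c :: "nat \<times> 'x magma \<Rightarrow> 'a"
  \<comment> \<open>The equations of a chain, one for each link and each word.\<close>
  define Q where "Q = (\<lambda>(j, v). slot j (\<lambda>w. bracket_letter y (lie_coeff w) v) -
      slot (Suc j) (\<lambda>w. bracket_letter x (lie_coeff w) v)) ` ({..<i} \<times> {v. length v = Suc k})"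
  \<comment> \<open>The equations of the kernel of \<open>G\<close>.\<close>
  define Q' where "Q' = (\<lambda>(j, v). slot j (\<lambda>w. lie_coeff w v)) ` ({..i} \<times> {v. length v = k})"
  have finM: "finite ?M" by (rule finite_magma_degree[OF fin])
  have finW: "finite {v :: 'x list. length v = l}" for l
    using finite_lists_length_eq[OF fin, of l] by simp
  have finQ: "finite ?I" "finite Q" "finite Q'"
    using finM finW by (auto simp: Q_def Q'_def)
  have sum_slot: "(\<Sum>l\<in>?I. zsmul (slot j n l) (c l)) = (\<Sum>w\<in>?M. zsmul (n w) (c (j, w)))"
    if "j \<le> i" for j n and c :: "nat \<times> 'x magma \<Rightarrow> 'a"
  proof -
    have "(\<Sum>l\<in>?I. zsmul (slot j n l) (c l)) = (\<Sum>j'\<le>i. \<Sum>w\<in>?M. zsmul (slot j n (j', w)) (c (j', w)))"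
      by (simp add: sum.cartesian_product)
    also have "\<dots> = (\<Sum>j'\<le>i. if j' = j then \<Sum>w\<in>?M. zsmul (n w) (c (j, w)) else 0)"
      by (rule sum.cong) (auto simp: slot_def)
    also have "\<dots> = (\<Sum>w\<in>?M. zsmul (n w) (c (j, w)))" using that by (simp add: sum.delta)
    finally show ?thesis .
  qed
  have addG: "Modules.additive G"
    by unfold_locales (auto simp: G_def fun_eq_iff zsmul_add_right sum.distrib)
  have bracket_G: "bracket_letter z (G c j) v = (\<Sum>w\<in>?M. zsmul (bracket_letter z (lie_coeff w) v) (c (j, w)))"
    if "j \<le> i" for z c j v
    using that by (simp add: G_def bracket_letter_sum_zsmul)
  have G_support: "G c j v = 0" if "length v \<noteq> k" for c j v
  proof -
    have "lie_coeff w v = 0" if "w \<in> ?M" for w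
      using lie_coeff_support[of w v] that \<open>length v \<noteq> k\<close> by auto
    thus ?thesis by (simp add: G_def)
  qed
  have ker: "G c = 0 \<longleftrightarrow> (\<forall>q\<in>Q'. (\<Sum>l\<in>?I. zsmul (q l) (c l)) = 0)" for c
  proof -
    have "(\<forall>q\<in>Q'. (\<Sum>l\<in>?I. zsmul (q l) (c l)) = 0) \<longleftrightarrow>
        (\<forall>j\<le>i. \<forall>v. length v = k \<longrightarrow> G c j v = 0)"
      by (auto simp: Q'_def sum_slot G_def)
    also have "\<dots> \<longleftrightarrow> G c = 0"
    proof
      assume *: "\<forall>j\<le>i. \<forall>v. length v = k \<longrightarrow> G c j v = 0"
      have "G c j v = 0" for j v
      proof (cases "j \<le> i \<and> length v = k")
        case False
        thus ?thesis using G_support[of v c j] by (auto simp: G_def)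
      qed (use * in auto)
      thus "G c = 0" by (simp add: fun_eq_iff)
    qed auto
    finally show ?thesis ..
  qed
  have bracket_support: "bracket_letter z (G c j) v = 0" if "length v \<noteq> Suc k" for z c j v
    using that G_support[of "butlast v" c j] G_support[of "tl v" c j] by (cases v) (auto simp: bracket_letter_def)
  have sol: "(\<forall>q\<in>Q. (\<Sum>l\<in>?I. zsmul (q l) (c l)) = 0) \<longleftrightarrow>
      (\<forall>j<i. bracket_letter y (G c j) = bracket_letter x (G c (Suc j)))" for c
  proof -
    have diff: "(\<Sum>l\<in>?I. zsmul ((q - r) l) (c l)) = (\<Sum>l\<in>?I. zsmul (q l) (c l)) - (\<Sum>l\<in>?I. zsmul (r l) (c l))"
      for q r
      by (simp add: zsmul_diff_left sum_subtractf)
    have "(\<forall>q\<in>Q. (\<Sum>l\<in>?I. zsmul (q l) (c l)) = 0) \<longleftrightarrow>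
        (\<forall>j<i. \<forall>v. length v = Suc k \<longrightarrow> bracket_letter y (G c j) v = bracket_letter x (G c (Suc j)) v)"
      unfolding Q_def by (auto simp: diff sum_slot bracket_G simp del: minus_apply)
    also have "\<dots> \<longleftrightarrow> (\<forall>j<i. bracket_letter y (G c j) = bracket_letter x (G c (Suc j)))"
      using bracket_support by (metis ext)
    finally show ?thesis .
  qed
  have image: "G ` solutions ?I Q T = relation_chains (bracket_letter x) (bracket_letter y) (lie_polys T k) i"
    if T: "subgrp T" for T
  proof (intro equalityI subsetI)
    fix a assume "a \<in> G ` solutions ?I Q T"
    then obtain c where c: "c \<in> solutions ?I Q T" "a = G c" by blast
    have *: "\<forall>l\<in>?I. c l \<in> T" "\<forall>l. l \<notin> ?I \<longrightarrow> c l = 0"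
      using c(1) unfolding solutions_def by blast+
    have cT: "c l \<in> T" for l
    proof (cases "l \<in> ?I")
      case True
      thus ?thesis using *(1) by blast
    next
      case False
      hence "c l = 0" using *(2) by blast
      thus ?thesis using subgrp_0[OF T] by simp
    qed
    have "a j \<in> lie_polys T k" if "j \<le> i" for j
      by (rule lie_polysI[of "\<lambda>w. c (j, w)"]) (use that cT in \<open>auto simp: c(2) G_def\<close>)
    moreover have "a j = 0" if "j > i" for j using that by (simp add: c(2) G_def fun_eq_iff)
    moreover have "\<forall>q\<in>Q. (\<Sum>l\<in>?I. zsmul (q l) (c l)) = 0"
      using c(1) unfolding solutions_def by blast
    ultimately show "a \<in> relation_chains (bracket_letter x) (bracket_letter y) (lie_polys T k) i"
      unfolding sol by (simp add: relation_chains_def c(2))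
  next
    fix a assume a: "a \<in> relation_chains (bracket_letter x) (bracket_letter y) (lie_polys T k) i"
    have "\<forall>j\<in>{..i}. \<exists>c. (\<forall>w. c w \<in> T) \<and> a j = (\<lambda>v. \<Sum>w\<in>?M. zsmul (lie_coeff w v) (c w))"
    proof
      fix j assume "j \<in> {..i}"
      hence "a j \<in> lie_polys T k" using a by (simp add: relation_chains_def)
      thus "\<exists>c. (\<forall>w. c w \<in> T) \<and> a j = (\<lambda>v. \<Sum>w\<in>?M. zsmul (lie_coeff w v) (c w))"
        unfolding lie_polys_def by blast
    qed
    from bchoice[OF this] obtain C where "\<forall>j\<in>{..i}. (\<forall>w. C j w \<in> T) \<and>
        a j = (\<lambda>v. \<Sum>w\<in>?M. zsmul (lie_coeff w v) (C j w))" by blast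
    hence C: "\<And>j w. j \<le> i \<Longrightarrow> C j w \<in> T"
        "\<And>j. j \<le> i \<Longrightarrow> a j = (\<lambda>v. \<Sum>w\<in>?M. zsmul (lie_coeff w v) (C j w))"
      by auto
    define c where "c = (\<lambda>(j, w). if j \<le> i \<and> w \<in> ?M then C j w else 0)"
    have "a j = G c j" for j
    proof (cases "j \<le> i")
      case True
      thus ?thesis by (auto simp: C(2) G_def c_def fun_eq_iff intro!: sum.cong)
    next
      case False
      thus ?thesis using a by (auto simp: relation_chains_def G_def fun_eq_iff)
    qed
    hence G: "a = G c" by blast
    have "\<forall>q\<in>Q. (\<Sum>l\<in>?I. zsmul (q l) (c l)) = 0"
      unfolding sol using a by (auto simp: relation_chains_def G)
    hence "c \<in> solutions ?I Q T"
      using C(1) by (auto simp: solutions_def c_def)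
    thus "a \<in> G ` solutions ?I Q T" using G by blast
  qed
  from card_image_solutions[OF finQ addG ker] obtain d N
    where "\<And>p (T :: 'a set). prime p \<Longrightarrow> N < p \<Longrightarrow> elementary p T \<Longrightarrow> card T = p \<Longrightarrow>
      card (G ` solutions ?I Q T) = p ^ d" by blast
  hence "\<forall>p (T :: 'a set). prime p \<longrightarrow> N < p \<longrightarrow> elementary p T \<longrightarrow> card T = p \<longrightarrow>
    card (relation_chains (bracket_letter x) (bracket_letter y) (lie_polys T k) i) = p ^ d"
    by (simp add: image elementary_subgrp)
  thus ?thesis by blast
qed

section \<open>Polynomial counts for Lie polynomials\<close>

text \<open>Isomorphic pairs of maps have the same counts.  This is needed to replace the chains with a
  single entry by the entries themselves.\<close>

lemma card_subreps_transfer: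
  fixes \<alpha> \<beta> :: "'a::ab_group_add \<Rightarrow> 'b::ab_group_add" and \<alpha>' \<beta>' :: "'c::ab_group_add \<Rightarrow> 'd::ab_group_add"
  assumes add: "Modules.additive \<phi>" "Modules.additive \<psi>"
    and inj: "inj_on \<phi> V" "inj_on \<psi> W"
    and V: "subgrp V" and W: "subgrp W"
    and maps: "\<alpha> ` V \<subseteq> W" "\<beta> ` V \<subseteq> W"
    and comm: "\<And>u. u \<in> V \<Longrightarrow> \<alpha>' (\<phi> u) = \<psi> (\<alpha> u)" "\<And>u. u \<in> V \<Longrightarrow> \<beta>' (\<phi> u) = \<psi> (\<beta> u)"
  shows "card (subreps \<alpha>' \<beta>' (\<phi> ` V) (\<psi> ` W) a b) = card (subreps \<alpha> \<beta> V W a b)"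
proof -
  have image_subgrps: "(`) f ` subgrps_between {0} G m = subgrps_between {0} (f ` G) m"
    if f: "Modules.additive f" "inj_on f G" "subgrp G" for f :: "'e::ab_group_add \<Rightarrow> 'f::ab_group_add" and G m
  proof (intro equalityI subsetI)
    fix H assume "H \<in> (`) f ` subgrps_between {0} G m"
    then obtain K where K: "subgrp K" "K \<subseteq> G" "card K = m" "H = f ` K" by (auto simp: subgrps_between_def)
    have "inj_on f K" using f(2) K(2) by (rule inj_on_subset)
    thus "H \<in> subgrps_between {0} (f ` G) m"
      using K subgrp_image[OF f(1) K(1)] by (auto simp: subgrps_between_def card_image subgrp_0)
  next
    fix H assume "H \<in> subgrps_between {0} (f ` G) m"
    hence H: "subgrp H" "H \<subseteq> f ` G" "card H = m" by (auto simp: subgrps_between_def)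
    define K where "K = G \<inter> {u. f u \<in> H}"
    have K: "subgrp K" "K \<subseteq> G" "f ` K = H"
      using H f by (auto simp: K_def intro!: subgrp_Int subgrp_vimage)
    moreover have "card K = m"
      using card_image[OF inj_on_subset[OF f(2) K(2)]] K(3) H(3) by simp
    ultimately show "H \<in> (`) f ` subgrps_between {0} G m"
      by (auto simp: subgrps_between_def subgrp_0 intro!: image_eqI[of _ _ K])
  qed
  have inj_image: "inj_on ((`) f) (subgrps_between {0} G m)" if "inj_on f G"
    for f :: "'e::ab_group_add \<Rightarrow> 'f::ab_group_add" and G m
    using inj_on_image_Pow[OF that] by (rule inj_on_subset) (auto simp: subgrps_between_def)
  have sub_iff: "\<gamma>' ` \<phi> ` U \<subseteq> \<psi> ` U' \<longleftrightarrow> \<gamma> ` U \<subseteq> U'"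
    if "U \<subseteq> V" "U' \<subseteq> W" "\<gamma> ` V \<subseteq> W" "\<And>u. u \<in> V \<Longrightarrow> \<gamma>' (\<phi> u) = \<psi> (\<gamma> u)" for \<gamma> \<gamma>' U U'
  proof -
    have "\<gamma>' ` \<phi> ` U = \<psi> ` \<gamma> ` U" using that(1,4) by (auto simp: image_image intro!: image_cong)
    moreover have "\<gamma> ` U \<subseteq> W" using that by blast
    moreover have "\<psi> ` \<gamma> ` U \<subseteq> \<psi> ` U' \<longleftrightarrow> \<gamma> ` U \<subseteq> U'" if "\<gamma> ` U \<subseteq> W"
    proof
      assume *: "\<psi> ` \<gamma> ` U \<subseteq> \<psi> ` U'"
      show "\<gamma> ` U \<subseteq> U'"
      proof
        fix w assume w: "w \<in> \<gamma> ` U"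
        hence "\<psi> w \<in> \<psi> ` U'" using * by blast
        thus "w \<in> U'" using inj_on_image_mem_iff[OF inj(2) _ \<open>U' \<subseteq> W\<close>] w that by blast
      qed
    qed blast
    ultimately show ?thesis by simp
  qed
  have "bij_betw (\<lambda>(U, U'). (\<phi> ` U, \<psi> ` U')) (subreps \<alpha> \<beta> V W a b) (subreps \<alpha>' \<beta>' (\<phi> ` V) (\<psi> ` W) a b)"
    unfolding bij_betw_def
  proof (intro conjI equalityI subsetI)
    show "inj_on (\<lambda>(U, U'). (\<phi> ` U, \<psi> ` U')) (subreps \<alpha> \<beta> V W a b)"
      using inj_image[OF inj(1), of a] inj_image[OF inj(2), of b]
      by (auto simp: subreps_def inj_on_def)
  next
    fix x assume "x \<in> (\<lambda>(U, U'). (\<phi> ` U, \<psi> ` U')) ` subreps \<alpha> \<beta> V W a b"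
    then obtain U U' where x: "x = (\<phi> ` U, \<psi> ` U')" and U: "U \<in> subgrps_between {0} V a"
        "U' \<in> subgrps_between {0} W b" "\<alpha> ` U \<subseteq> U'" "\<beta> ` U \<subseteq> U'"
      by (auto simp: subreps_def)
    have "\<phi> ` U \<in> subgrps_between {0} (\<phi> ` V) a" "\<psi> ` U' \<in> subgrps_between {0} (\<psi> ` W) b"
      unfolding image_subgrps[OF add(1) inj(1) V, symmetric] image_subgrps[OF add(2) inj(2) W, symmetric]
      using U by (auto intro: imageI)
    moreover have "U \<subseteq> V" "U' \<subseteq> W" using U by (auto simp: subgrps_between_def)
    ultimately show "x \<in> subreps \<alpha>' \<beta>' (\<phi> ` V) (\<psi> ` W) a b"
      using U sub_iff[OF _ _ maps(1) comm(1), of U U'] sub_iff[OF _ _ maps(2) comm(2), of U U']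
      by (simp add: subreps_def x)
  next
    fix x assume "x \<in> subreps \<alpha>' \<beta>' (\<phi> ` V) (\<psi> ` W) a b"
    then obtain H H' where x: "x = (H, H')" and H: "H \<in> subgrps_between {0} (\<phi> ` V) a"
        "H' \<in> subgrps_between {0} (\<psi> ` W) b" "\<alpha>' ` H \<subseteq> H'" "\<beta>' ` H \<subseteq> H'"
      by (auto simp: subreps_def)
    obtain U U' where U: "U \<in> subgrps_between {0} V a" "H = \<phi> ` U"
        "U' \<in> subgrps_between {0} W b" "H' = \<psi> ` U'"
      using H(1,2) unfolding image_subgrps[OF add(1) inj(1) V, symmetric]
        image_subgrps[OF add(2) inj(2) W, symmetric] by blast
    have "U \<subseteq> V" "U' \<subseteq> W" using U by (auto simp: subgrps_between_def)
    hence "(U, U') \<in> subreps \<alpha> \<beta> V W a b"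
      using U H(3,4) sub_iff[OF _ _ maps(1) comm(1), of U U'] sub_iff[OF _ _ maps(2) comm(2), of U U']
      by (simp add: subreps_def)
    thus "x \<in> (\<lambda>(U, U'). (\<phi> ` U, \<psi> ` U')) ` subreps \<alpha> \<beta> V W a b"
      using U x by force
  qed
  thus ?thesis by (rule bij_betw_same_card[symmetric])
qed

lemma additive_head: "Modules.additive (\<lambda>a :: nat \<Rightarrow> 'a::ab_group_add. a 0)"
  by unfold_locales simp

lemma inj_on_head: "inj_on (\<lambda>a. a 0) (relation_chains \<alpha> \<beta> V 0)"
proof (rule inj_onI)
  fix a b assume *: "a \<in> relation_chains \<alpha> \<beta> V 0" "b \<in> relation_chains \<alpha> \<beta> V 0" "a 0 = b 0"
  show "a = b"
  proof
    fix j show "a j = b j" using * by (cases j) (auto simp: relation_chains_def)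
  qed
qed

lemma image_head: "(\<lambda>a. a 0) ` relation_chains \<alpha> \<beta> V 0 = V"
proof (intro equalityI subsetI)
  fix v assume v: "v \<in> V"
  show "v \<in> (\<lambda>a. a 0) ` relation_chains \<alpha> \<beta> V 0"
    by (rule image_eqI[of _ _ "\<lambda>j. if j = 0 then v else 0"]) (use v in \<open>auto simp: relation_chains_def\<close>)
qed (auto simp: relation_chains_def)

lemma card_relation_chains_0: "card (relation_chains \<alpha> \<beta> V 0) = card V"
  using card_image[OF inj_on_head, of \<alpha> \<beta> V] by (simp add: image_head)

lemma card_lie_polys:
  assumes "finite (UNIV :: 'x set)"
  shows "\<exists>d N. \<forall>p (T :: 'a::ab_group_add set). prime p \<longrightarrow> N < p \<longrightarrow> elementary p T \<longrightarrow> card T = p \<longrightarrow>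
    card (lie_polys T k :: ('x list \<Rightarrow> 'a) set) = p ^ d"
  using card_chains_lie_polys[OF assms, where i = 0] by (simp add: card_relation_chains_0)

text \<open>The bounds for the finitely many chain lengths that occur are combined into one; beyond it all
  the dimensions are independent of \<open>p\<close>.\<close>

theorem poly_on_subreps_lie_polys_ge2:
  fixes x y :: 'x
  assumes fin: "finite (UNIV :: 'x set)" and xy: "y \<noteq> x" and k: "k \<ge> 2"
  shows "\<exists>N. \<forall>e f. poly_on {p. prime p \<and> N < p} (\<lambda>p. int (card (subreps (bracket_letter x) (bracket_letter y)
    (lie_polys (residues_mod p) k) (lie_polys (residues_mod p) (Suc k)) (p ^ e) (p ^ f))))"
proof -
  let ?\<alpha> = "bracket_letter x :: ('x list \<Rightarrow> rat_mod_int) \<Rightarrow> _" and ?\<beta> = "bracket_letter y"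
  let ?V = "\<lambda>p. lie_polys (residues_mod p) k :: ('x list \<Rightarrow> _) set"
  let ?W = "\<lambda>p. lie_polys (residues_mod p) (Suc k) :: ('x list \<Rightarrow> _) set"
  let ?m = "Suc k"
  have "\<forall>i. \<exists>d N. \<forall>p (T :: rat_mod_int set). prime p \<longrightarrow> N < p \<longrightarrow> elementary p T \<longrightarrow> card T = p \<longrightarrow>
      card (relation_chains ?\<alpha> ?\<beta> (lie_polys T k) i) = p ^ d"
    using card_chains_lie_polys[OF fin] by blast
  from choice[OF this] obtain d where "\<forall>i. \<exists>N. \<forall>p (T :: rat_mod_int set). prime p \<longrightarrow> N < p \<longrightarrow>
      elementary p T \<longrightarrow> card T = p \<longrightarrow> card (relation_chains ?\<alpha> ?\<beta> (lie_polys T k) i) = p ^ d i"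
    by blast
  from choice[OF this] obtain N where N: "\<forall>i p (T :: rat_mod_int set). prime p \<longrightarrow> N i < p \<longrightarrow>
      elementary p T \<longrightarrow> card T = p \<longrightarrow> card (relation_chains ?\<alpha> ?\<beta> (lie_polys T k) i) = p ^ d i"
    by blast
  obtain w N' where N': "\<forall>p (T :: rat_mod_int set). prime p \<longrightarrow> N' < p \<longrightarrow> elementary p T \<longrightarrow> card T = p \<longrightarrow>
      card (lie_polys T (Suc k) :: ('x list \<Rightarrow> rat_mod_int) set) = p ^ w"
    using card_lie_polys[OF fin, where k = "Suc k"] by blast
  define M where "M = Max (insert N' (N ` {..Suc ?m}))"
  have M: "N' \<le> M" "\<And>i. i \<le> Suc ?m \<Longrightarrow> N i \<le> M"
    unfolding M_def by (rule Max_ge; simp)+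
  let ?X = "{p. prime p \<and> M < p}"
  have T: "elementary p (residues_mod p)" "card (residues_mod p) = p" if "p \<in> ?X" for p
    using that by (auto simp: elementary_residues_mod card_residues_mod prime_gt_0_nat)
  have V: "elementary p (?V p)" "elementary p (?W p)" if "p \<in> ?X" for p
    using elementary_lie_polys[OF fin T(1)[OF that]] by blast+
  have maps: "?\<alpha> ` ?V p \<subseteq> ?W p" "?\<beta> ` ?V p \<subseteq> ?W p" if "p \<in> ?X" for p
    using bracket_letter_lie_polys[OF fin elementary_subgrp[OF T(1)[OF that]]] by blast+
  have "poly_on ?X (\<lambda>p. int (card (subreps (\<lambda>a. ?\<alpha> \<circ> a) (\<lambda>a. ?\<beta> \<circ> a)
      (relation_chains ?\<alpha> ?\<beta> (?V p) 0) (relation_chains ?\<alpha> ?\<beta> (?W p) 0) (p ^ e) (p ^ f))))"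
    (is "poly_on _ (?F e f)") for e f
  proof (rule poly_on_subreps_chains[where m = ?m and d = d and w = w])
    fix p assume p: "p \<in> ?X"
    show "prime p" using p by simp
    show "elementary p (?V p)" "elementary p (?W p)" by (rule V[OF p])+
    show "?\<alpha> ` ?V p \<subseteq> ?W p" "?\<beta> ` ?V p \<subseteq> ?W p" by (rule maps[OF p])+
    show "card (relation_chains ?\<alpha> ?\<beta> (?W p) 0) = p ^ w"
      using N' p T[OF p] M(1) by (simp add: card_relation_chains_0)
    show "card (relation_chains ?\<alpha> ?\<beta> (?V p) i) = p ^ d i" if "i \<le> Suc ?m" for i
      using N p T[OF p] M(2)[OF that] by simp
    show "relation_chains ?\<alpha> ?\<beta> (?V p) ?m = {0}"
      by (rule no_long_chains[OF lie_polys_no_pure_powers[OF k] subgrp_0 xy])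
         (rule elementary_subgrp[OF V(1)[OF p]])
  qed (rule additive_bracket_letter)+
  moreover have "card (subreps (\<lambda>a. ?\<alpha> \<circ> a) (\<lambda>a. ?\<beta> \<circ> a)
      (relation_chains ?\<alpha> ?\<beta> (?V p) 0) (relation_chains ?\<alpha> ?\<beta> (?W p) 0) a b) =
      card (subreps ?\<alpha> ?\<beta> (?V p) (?W p) a b)" if p: "p \<in> ?X" for p a b
  proof -
    have "card (subreps ?\<alpha> ?\<beta> ((\<lambda>a. a 0) ` relation_chains ?\<alpha> ?\<beta> (?V p) 0)
        ((\<lambda>a. a 0) ` relation_chains ?\<alpha> ?\<beta> (?W p) 0) a b) =
      card (subreps (\<lambda>a. ?\<alpha> \<circ> a) (\<lambda>a. ?\<beta> \<circ> a)
        (relation_chains ?\<alpha> ?\<beta> (?V p) 0) (relation_chains ?\<alpha> ?\<beta> (?W p) 0) a b)"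
    proof (rule card_subreps_transfer[OF additive_head additive_head inj_on_head inj_on_head])
      show "subgrp (relation_chains ?\<alpha> ?\<beta> (?V p) 0)"
        by (rule elementary_subgrp[OF elementary_chains[OF V(1)[OF p] additive_bracket_letter additive_bracket_letter]])
      show "subgrp (relation_chains ?\<alpha> ?\<beta> (?W p) 0)"
        by (rule elementary_subgrp[OF elementary_chains[OF V(2)[OF p] additive_bracket_letter additive_bracket_letter]])
      show "(\<lambda>a. ?\<alpha> \<circ> a) ` relation_chains ?\<alpha> ?\<beta> (?V p) 0 \<subseteq> relation_chains ?\<alpha> ?\<beta> (?W p) 0"
        "(\<lambda>a. ?\<beta> \<circ> a) ` relation_chains ?\<alpha> ?\<beta> (?V p) 0 \<subseteq> relation_chains ?\<alpha> ?\<beta> (?W p) 0"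
        using maps[OF p] additive.zero[OF additive_bracket_letter, of x] additive.zero[OF additive_bracket_letter, of y]
        by (auto simp: relation_chains_def)
    qed simp_all
    thus ?thesis by (simp only: image_head)
  qed
  hence "poly_on ?X (?F e f) \<longleftrightarrow>
      poly_on ?X (\<lambda>p. int (card (subreps ?\<alpha> ?\<beta> (?V p) (?W p) (p ^ e) (p ^ f))))" for e f
    by (intro poly_on_cong) (simp add: comp_def[abs_def])
  ultimately have "poly_on ?X (\<lambda>p. int (card (subreps ?\<alpha> ?\<beta> (?V p) (?W p) (p ^ e) (p ^ f))))" for e f
    by blast
  thus ?thesis by blast
qed

text \<open>Every monomial of degree two is a multiple of \<open>[x, y]\<close>.  If \<open>u = a x + b y\<close>, then
  \<open>[u, y] = a [x, y]\<close> and \<open>[u, x] = - b [x, y]\<close>, and one of the scalars is a generator of the cyclic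
  group \<open>T\<close>.\<close>

lemma lie_polys_2_subset:
  fixes x y :: 'x
  assumes xy: "(UNIV :: 'x set) = {x, y}" "x \<noteq> y"
    and p: "prime p" and T: "elementary p T" "card T = p"
    and u: "u \<in> lie_polys T 1" "u \<noteq> (0 :: 'x list \<Rightarrow> 'a::ab_group_add)"
    and U': "subgrp U'" "bracket_letter x u \<in> U'" "bracket_letter y u \<in> U'"
  shows "lie_polys T 2 \<subseteq> U'"
proof -
  let ?b = "lie_coeff (Br (Gen x) (Gen y))"
  have multiple: "\<exists>n. r = zsmul n s" if "s \<in> T" "s \<noteq> 0" "r \<in> T" for r s
  proof -
    have sub: "adjoin {0} s \<subseteq> T"
      using adjoin_subset[OF elementary_subgrp[OF T(1)], of "{0}" s] that subgrp_0[OF elementary_subgrp[OF T(1)]] by auto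
    have "card (adjoin {0} s) = card T"
      using card_adjoin(1)[OF p subgrp_singleton_0 _ elementary_zsmul[OF T(1) that(1)]] that(2) T(2) by simp
    hence "adjoin {0} s = T" by (rule card_subset_eq[OF elementary_finite[OF T(1)] sub])
    thus ?thesis using that(3) by (auto simp: adjoin_def)
  qed
  have deg1: "{w :: 'x magma. degree_magma w = 1} = {Gen x, Gen y}"
  proof (intro equalityI subsetI)
    fix w :: "'x magma" assume w: "w \<in> {w. degree_magma w = 1}"
    show "w \<in> {Gen x, Gen y}"
    proof (cases w)
      case (Gen z)
      thus ?thesis using UNIV_I[of z] unfolding xy(1) by auto
    next
      case (Br w1 w2)
      thus ?thesis using w degree_magma_pos[of w1] degree_magma_pos[of w2] by simp
    qed
  qed auto
  from u(1) obtain c where c: "\<forall>w. c w \<in> T" "u = (\<lambda>v. \<Sum>w | degree_magma w = 1. zsmul (lie_coeff w v) (c w))"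
    by (auto simp: lie_polys_def)
  have self: "bracket_letter z (lie_coeff (Gen z)) = 0" for z :: 'x
    by (simp only: commutator_letter[symmetric] commutator_self)
  have anti: "bracket_letter x (lie_coeff (Gen y)) = - ?b"
    unfolding commutator_letter[symmetric] by (simp add: commutator_def)
  have by_xy: "bracket_letter y (lie_coeff (Gen x)) = ?b"
    unfolding commutator_letter[symmetric] by simp
  have bx: "bracket_letter z u = (\<lambda>v. \<Sum>w | degree_magma w = 1. zsmul (bracket_letter z (lie_coeff w) v) (c w))" for z
    unfolding c(2) by (rule ext) (rule bracket_letter_sum_zsmul)
  have u_y: "bracket_letter y u = (\<lambda>v. zsmul (?b v) (c (Gen x)))"
    using self[of y] xy(2) by (simp add: bx deg1[unfolded One_nat_def] by_xy[symmetric] del: lie_coeff.simps)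
  have u_x: "bracket_letter x u = (\<lambda>v. - zsmul (?b v) (c (Gen y)))"
    using self[of x] anti xy(2) by (simp add: bx deg1[unfolded One_nat_def] zsmul_minus_left del: lie_coeff.simps)
  have nonzero: "c (Gen x) \<noteq> 0 \<or> c (Gen y) \<noteq> 0"
  proof (rule ccontr)
    assume "\<not> ?thesis"
    hence "\<forall>w\<in>{w. degree_magma w = 1}. c w = 0" unfolding deg1 by auto
    hence "u = (\<lambda>_. 0)" unfolding c(2) by (auto intro!: sum.neutral)
    thus False using u(2) by (auto simp: fun_eq_iff)
  qed
  have b: "(\<lambda>v. zsmul (?b v) r) \<in> U'" if r: "r \<in> T" for r
    using nonzero
  proof
    assume "c (Gen x) \<noteq> 0"
    then obtain n where n: "r = zsmul n (c (Gen x))" using multiple[of "c (Gen x)" r] c(1) r by blast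
    have "(\<lambda>v. zsmul (?b v) r) = zsmul n (bracket_letter y u)"
      unfolding u_y n by (rule ext) (simp add: zsmul_apply zsmul_zsmul mult.commute)
    thus ?thesis using subgrp_zsmul[OF U'(1,3)] by simp
  next
    assume "c (Gen y) \<noteq> 0"
    then obtain n where n: "r = zsmul n (c (Gen y))" using multiple[of "c (Gen y)" r] c(1) r by blast
    have "(\<lambda>v. zsmul (?b v) r) = zsmul (- n) (bracket_letter x u)"
      unfolding u_x n by (rule ext)
        (simp add: zsmul_apply zsmul_zsmul zsmul_minus_left zsmul_minus_right mult.commute)
    thus ?thesis using subgrp_zsmul[OF U'(1,2)] by simp
  qed
  show ?thesis
  proof
    fix f :: "'x list \<Rightarrow> 'a" assume f: "f \<in> lie_polys T 2"
    show "f \<in> U'"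
    proof (rule lie_polys_induct[OF f U'(1)])
      fix w :: "'x magma" and t assume w: "degree_magma w = 2" and t: "t \<in> T"
      obtain w1 w2 where w12: "w = Br w1 w2" using w by (cases w) auto
      have "degree_magma w1 = 1" "degree_magma w2 = 1"
        using w w12 degree_magma_pos[of w1] degree_magma_pos[of w2] by auto
      hence "w1 \<in> {Gen x, Gen y}" "w2 \<in> {Gen x, Gen y}" unfolding deg1[symmetric] by auto
      moreover have "lie_coeff (Br (Gen z) (Gen z)) = 0" for z :: 'x by (simp add: commutator_self)
      moreover have "lie_coeff (Br (Gen y) (Gen x)) = - ?b" by (simp add: commutator_def)
      moreover have "- (\<lambda>v. zsmul (?b v) t) \<in> U'" by (rule subgrp_minus[OF U'(1) b[OF t]])
      hence "(\<lambda>v. - zsmul (?b v) t) \<in> U'" by (simp add: fun_Compl_def)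
      ultimately show "(\<lambda>v. zsmul (lie_coeff w v) t) \<in> U'"
        using b[OF t] subgrp_0[OF U'(1)]
        by (auto simp: w12 zsmul_minus_left zero_fun_def simp del: lie_coeff.simps)
    qed
  qed
qed

text \<open>The bracket with \<open>x\<close> kills \<open>x\<close>, so chains in degree one need not end.  But a nonzero \<open>U\<close> forces
  \<open>U'\<close> to be everything by \<open>lie_polys_2_subset\<close>, and \<open>U = 0\<close> leaves \<open>U'\<close> arbitrary.\<close>

theorem poly_on_subreps_lie_polys_1:
  fixes x y :: 'x
  assumes xy: "(UNIV :: 'x set) = {x, y}" "x \<noteq> y"
  shows "\<exists>N. \<forall>e f. poly_on {p. prime p \<and> N < p} (\<lambda>p. int (card (subreps (bracket_letter x) (bracket_letter y)
    (lie_polys (residues_mod p) 1) (lie_polys (residues_mod p) 2) (p ^ e) (p ^ f))))"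
proof -
  let ?V = "\<lambda>p. lie_polys (residues_mod p) 1 :: ('x list \<Rightarrow> _) set"
  let ?W = "\<lambda>p. lie_polys (residues_mod p) 2 :: ('x list \<Rightarrow> _) set"
  have fin: "finite (UNIV :: 'x set)" unfolding xy by simp
  obtain d1 N1 where N1: "\<forall>p (T :: rat_mod_int set). prime p \<longrightarrow> N1 < p \<longrightarrow> elementary p T \<longrightarrow> card T = p \<longrightarrow>
      card (lie_polys T 1 :: ('x list \<Rightarrow> rat_mod_int) set) = p ^ d1"
    using card_lie_polys[OF fin, where k = 1] by blast
  obtain d2 N2 where N2: "\<forall>p (T :: rat_mod_int set). prime p \<longrightarrow> N2 < p \<longrightarrow> elementary p T \<longrightarrow> card T = p \<longrightarrow>
      card (lie_polys T 2 :: ('x list \<Rightarrow> rat_mod_int) set) = p ^ d2"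
    using card_lie_polys[OF fin, where k = 2] by blast
  let ?X = "{p. prime p \<and> max N1 N2 < p}"
  have "int (card (subreps (bracket_letter x) (bracket_letter y) (?V p) (?W p) (p ^ e) (p ^ f))) =
      poly (if e = 0 then gauss_binomial d2 f else if f = d2 then gauss_binomial d1 e else 0) (int p)"
    if p: "p \<in> ?X" for p e f
  proof -
    have prime: "prime p" and p1: "p > 1" using p prime_gt_1_nat by auto
    have T: "elementary p (residues_mod p)" "card (residues_mod p) = p"
      using p1 by (auto simp: elementary_residues_mod card_residues_mod)
    have V: "elementary p (?V p)" "elementary p (?W p)"
      using elementary_lie_polys[OF fin T(1)] by blast+
    have cards: "card (?V p) = p ^ d1" "card (?W p) = p ^ d2"
      using p T N1 N2 by auto
    have 0: "0 \<in> ?V p" "0 \<in> ?W p" using V by (auto intro: subgrp_0 elementary_subgrp)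
    have countV: "int (card (subgrps_between {0} (?V p) (p ^ e))) = poly (gauss_binomial d1 e) (int p)"
      using card_subgrps_between[OF prime V(1) subgrp_singleton_0, of d1 e] cards 0 by simp
    have countW: "int (card (subgrps_between {0} (?W p) (p ^ f))) = poly (gauss_binomial d2 f) (int p)"
      using card_subgrps_between[OF prime V(2) subgrp_singleton_0, of d2 f] cards 0 by simp
    show ?thesis
    proof (cases "e = 0")
      case True
      have "H = {0}" if "H \<in> subgrps_between {0} (?V p) (p ^ e)" for H
        using that True by (auto simp: subgrps_between_def card_1_singleton_iff)
      moreover have "{0} \<in> subgrps_between {0} (?V p) (p ^ e)"
        using True 0 by (simp add: subgrps_between_def subgrp_singleton_0)
      ultimately have S: "subgrps_between {0} (?V p) (p ^ e) = {{0}}" by blast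
      have b0: "bracket_letter z (0 :: 'x list \<Rightarrow> rat_mod_int) = 0" for z :: 'x
        by (rule additive.zero[OF additive_bracket_letter])
      have "subreps (bracket_letter x) (bracket_letter y) (?V p) (?W p) (p ^ e) (p ^ f) =
          {{0}} \<times> subgrps_between {0} (?W p) (p ^ f)"
        unfolding subreps_def S by (auto simp: subgrps_between_def b0)
      thus ?thesis using countW True by (simp add: card_cartesian_product)
    next
      case False
      have full: "U' = ?W p" if U: "U \<in> subgrps_between {0} (?V p) (p ^ e)"
        and U': "U' \<in> subgrps_between {0} (?W p) (p ^ f)"
        and maps: "bracket_letter x ` U \<subseteq> U'" "bracket_letter y ` U \<subseteq> U'" for U U'
      proof -
        have "card U \<noteq> 1" using U False p1 by (auto simp: subgrps_between_def)
        hence "U \<noteq> {0}" by auto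
        then obtain u where u: "u \<in> U" "u \<noteq> 0" using U by (auto simp: subgrps_between_def)
        have "?W p \<subseteq> U'"
          by (rule lie_polys_2_subset[OF xy prime T _ u(2)]) (use u U U' maps in \<open>auto simp: subgrps_between_def\<close>)
        thus ?thesis using U' by (auto simp: subgrps_between_def)
      qed
      have fd: "p ^ f = p ^ d2 \<longleftrightarrow> f = d2" using p1 by simp
      have maps: "bracket_letter z ` ?V p \<subseteq> ?W p" for z
        using bracket_letter_lie_polys[OF fin elementary_subgrp[OF T(1)], of z 1] by (simp add: numeral_2_eq_2)
      have W: "?W p \<in> subgrps_between {0} (?W p) (p ^ f)" if "f = d2"
        using that cards 0 elementary_subgrp[OF V(2)] by (simp add: subgrps_between_def)
      have "subreps (bracket_letter x) (bracket_letter y) (?V p) (?W p) (p ^ e) (p ^ f) =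
          (if f = d2 then subgrps_between {0} (?V p) (p ^ e) \<times> {?W p} else {})"
      proof (intro equalityI subsetI)
        fix a assume "a \<in> subreps (bracket_letter x) (bracket_letter y) (?V p) (?W p) (p ^ e) (p ^ f)"
        then obtain U U' where a: "a = (U, U')" "U \<in> subgrps_between {0} (?V p) (p ^ e)"
            "U' \<in> subgrps_between {0} (?W p) (p ^ f)" "bracket_letter x ` U \<subseteq> U'" "bracket_letter y ` U \<subseteq> U'"
          by (auto simp: subreps_def)
        have "U' = ?W p" by (rule full[OF a(2-5)])
        moreover from this a(3) have "p ^ f = p ^ d2" using cards by (auto simp: subgrps_between_def)
        ultimately show "a \<in> (if f = d2 then subgrps_between {0} (?V p) (p ^ e) \<times> {?W p} else {})"
          using a(1,2) fd by simp
      next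
        fix a assume a: "a \<in> (if f = d2 then subgrps_between {0} (?V p) (p ^ e) \<times> {?W p} else {})"
        then obtain U where "f = d2" "a = (U, ?W p)" "U \<in> subgrps_between {0} (?V p) (p ^ e)"
          by (auto split: if_splits)
        thus "a \<in> subreps (bracket_letter x) (bracket_letter y) (?V p) (?W p) (p ^ e) (p ^ f)"
          using maps W by (auto simp: subreps_def subgrps_between_def)
      qed
      thus ?thesis using countV False by (simp add: card_cartesian_product)
    qed
  qed
  hence "poly_on ?X (\<lambda>p. int (card (subreps (bracket_letter x) (bracket_letter y) (?V p) (?W p) (p ^ e) (p ^ f))))"
    for e f
    unfolding poly_on_def by blast
  thus ?thesis by blast
qed

theorem poly_on_subreps_lie_polys:
  fixes x y :: 'x
  assumes xy: "(UNIV :: 'x set) = {x, y}" "x \<noteq> y" and k: "k \<ge> 1"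
  shows "\<exists>N. \<forall>e f. poly_on {p. prime p \<and> N < p} (\<lambda>p. int (card (subreps (bracket_letter x) (bracket_letter y)
    (lie_polys (residues_mod p) k) (lie_polys (residues_mod p) (Suc k)) (p ^ e) (p ^ f))))"
proof (cases "k = 1")
  case True
  thus ?thesis using poly_on_subreps_lie_polys_1[OF xy] by (simp add: numeral_2_eq_2)
next
  case False
  have "finite (UNIV :: 'x set)" unfolding xy by simp
  thus ?thesis using poly_on_subreps_lie_polys_ge2[of y x k] xy(2) k False by auto
qed

section \<open>Integral combinations of magma elements\<close>

text \<open>The set \<open>fin_supp\<close> with the product \<open>brk\<close> is the free nonassociative ring.  Calculations take place
  here, with integer coefficients, and are carried to the quotients modulo \<open>p\<close> afterwards.\<close>

definition fin_supp :: "('x magma \<Rightarrow> int) set"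
  where "fin_supp = {f. finite {w. f w \<noteq> 0}}"

definition brk :: "('x magma \<Rightarrow> int) \<Rightarrow> ('x magma \<Rightarrow> int) \<Rightarrow> 'x magma \<Rightarrow> int"
  where "brk f g = (\<lambda>w. case w of Gen x \<Rightarrow> 0 | Br u v \<Rightarrow> f u * g v)"

definition single :: "'x magma \<Rightarrow> 'x magma \<Rightarrow> int"
  where "single w = (\<lambda>w'. if w' = w then 1 else 0)"

definition eval_words :: "('x magma \<Rightarrow> int) \<Rightarrow> 'x list \<Rightarrow> int"
  where "eval_words f v = (\<Sum>w | degree_magma w = length v. f w * lie_coeff w v)"

lemma subgrp_fin_supp: "subgrp fin_supp"
proof (rule subgrpI)
  fix f g :: "'x magma \<Rightarrow> int" assume "f \<in> fin_supp" "g \<in> fin_supp"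
  hence "finite ({w. f w \<noteq> 0} \<union> {w. g w \<noteq> 0})" by (simp add: fin_supp_def)
  thus "f - g \<in> fin_supp" unfolding fin_supp_def mem_Collect_eq by (rule finite_subset[rotated]) auto
qed (simp add: fin_supp_def)

lemma single_fin_supp: "single w \<in> fin_supp"
  by (simp add: fin_supp_def single_def)

lemma brk_fin_supp: "f \<in> fin_supp \<Longrightarrow> g \<in> fin_supp \<Longrightarrow> brk f g \<in> fin_supp"
proof -
  assume "f \<in> fin_supp" "g \<in> fin_supp"
  hence "finite ((\<lambda>(u, v). Br u v) ` ({w. f w \<noteq> 0} \<times> {w. g w \<noteq> 0}))" by (simp add: fin_supp_def)
  moreover have "{w. brk f g w \<noteq> 0} \<subseteq> (\<lambda>(u, v). Br u v) ` ({w. f w \<noteq> 0} \<times> {w. g w \<noteq> 0})"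
  proof
    fix w assume w: "w \<in> {w. brk f g w \<noteq> 0}"
    show "w \<in> (\<lambda>(u, v). Br u v) ` ({w. f w \<noteq> 0} \<times> {w. g w \<noteq> 0})"
    proof (cases w)
      case (Br u v)
      thus ?thesis using w by (intro image_eqI[of _ _ "(u, v)"]) (auto simp: brk_def)
    qed (use w in \<open>simp add: brk_def\<close>)
  qed
  ultimately show ?thesis unfolding fin_supp_def by (auto intro: finite_subset)
qed

lemma additive_brk_left: "Modules.additive (\<lambda>f. brk f g)"
  by unfold_locales (auto simp: brk_def fun_eq_iff algebra_simps split: magma.splits)

lemma additive_brk_right: "Modules.additive (brk f)"
  by unfold_locales (auto simp: brk_def fun_eq_iff algebra_simps split: magma.splits)

lemma brk_single: "brk (single u) (single v) = single (Br u v)"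
  by (auto simp: brk_def single_def fun_eq_iff split: magma.splits)

lemma additive_eval_words: "Modules.additive (eval_words :: ('x magma \<Rightarrow> int) \<Rightarrow> _)"
  by unfold_locales (simp add: eval_words_def fun_eq_iff sum.distrib algebra_simps)

lemma eval_words_single:
  assumes "finite (UNIV :: 'x set)"
  shows "eval_words (single (w :: 'x magma)) = lie_coeff w"
proof
  fix v :: "'x list"
  have "single w w' * lie_coeff w' v = (if w' = w then lie_coeff w v else 0)" for w'
    by (simp add: single_def)
  hence "eval_words (single w) v = (if degree_magma w = length v then lie_coeff w v else 0)"
    unfolding eval_words_def by (simp add: sum.delta' sum.delta finite_magma_degree[OF assms])
  moreover have "lie_coeff w v = 0" if "degree_magma w \<noteq> length v"
    using lie_coeff_support[of w v] that by metis
  ultimately show "eval_words (single w) v = lie_coeff w v" by simp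
qed

lemma sum_singles:
  assumes "finite F" "{w. f w \<noteq> 0} \<subseteq> F"
  shows "f = (\<Sum>w\<in>F. zsmul (f w) (single w))"
proof
  fix w'
  have "(\<Sum>w\<in>F. zsmul (f w) (single w)) w' = (\<Sum>w\<in>F. if w = w' then f w' else 0)"
    unfolding sum_fun_apply by (rule sum.cong) (auto simp: zsmul_apply zsmul_int single_def)
  also have "\<dots> = f w'" using assms by (auto simp: sum.delta)
  finally show "f w' = (\<Sum>w\<in>F. zsmul (f w) (single w)) w'" ..
qed

text \<open>Additive statements about the free nonassociative ring need to be checked on monomials only.\<close>

lemma fin_supp_induct:
  assumes f: "f \<in> fin_supp" and G: "subgrp G" and "\<And>w. single w \<in> G"
  shows "f \<in> G"
proof -
  have "f = (\<Sum>w | f w \<noteq> 0. zsmul (f w) (single w))"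
    by (rule sum_singles) (use f in \<open>auto simp: fin_supp_def\<close>)
  also have "\<dots> \<in> G" by (intro subgrp_sum subgrp_zsmul G assms)
  finally show ?thesis .
qed

lemma eval_words_brk:
  assumes fin: "finite (UNIV :: 'x set)" and f: "f \<in> fin_supp" and g: "g \<in> fin_supp"
  shows "eval_words (brk f g) = commutator (eval_words f) (eval_words (g :: 'x magma \<Rightarrow> int))"
proof -
  note addE = additive_eval_words
  have 1: "eval_words (brk (single u) g) = commutator (lie_coeff u) (eval_words g)" for u
  proof -
    have "g \<in> {g. eval_words (brk (single u) g) = commutator (lie_coeff u) (eval_words g)}"
    proof (rule fin_supp_induct[OF g])
      show "subgrp {g. eval_words (brk (single u) g) = commutator (lie_coeff u) (eval_words g)}"
        by (simp add: subgrp_def additive.diff[OF additive_brk_right] additive.diff[OF addE]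
            additive.diff[OF additive_commutator_right] additive.zero[OF additive_brk_right]
            additive.zero[OF addE] additive.zero[OF additive_commutator_right])
    qed (simp add: brk_single eval_words_single[OF fin])
    thus ?thesis by simp
  qed
  have "f \<in> {f. eval_words (brk f g) = commutator (eval_words f) (eval_words g)}"
  proof (rule fin_supp_induct[OF f])
    show "subgrp {f. eval_words (brk f g) = commutator (eval_words f) (eval_words g)}"
      by (simp add: subgrp_def additive.diff[OF additive_brk_left] additive.diff[OF addE]
          additive.diff[OF additive_commutator_left] additive.zero[OF additive_brk_left]
          additive.zero[OF addE] additive.zero[OF additive_commutator_left])
  qed (simp add: 1 eval_words_single[OF fin])
  thus ?thesis by simp
qed

section \<open>The Dynkin--Specht--Wever identity\<close>

text \<open>The monomial \<open>[\<dots>[[x\<^sub>1, x\<^sub>2], x\<^sub>3], \<dots>, x\<^sub>n]\<close>.\<close>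

fun left_normed :: "'x list \<Rightarrow> 'x magma" where
  "left_normed [] = undefined"
| "left_normed (x # v) = foldl (\<lambda>w y. Br w (Gen y)) (Gen x) v"

text \<open>The word \<open>v\<close> acts by successive brackets with its letters from the right.\<close>

definition act :: "('x magma \<Rightarrow> int) \<Rightarrow> 'x list \<Rightarrow> 'x magma \<Rightarrow> int"
  where "act f v = foldl (\<lambda>f y. brk f (single (Gen y))) f v"

lemma act_simps: "act f [] = f" "act f (y # v) = act (brk f (single (Gen y))) v"
  "act f (s @ t) = act (act f s) t"
  by (simp_all add: act_def)

lemma act_left_normed: "s \<noteq> [] \<Longrightarrow> act (single (left_normed s)) t = single (left_normed (s @ t))"
proof (induction t rule: rev_induct)
  case (snoc y t)
  then obtain x v where s: "s = x # v" by (cases s) auto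
  show ?case using snoc by (simp add: s act_simps brk_single)
qed (simp add: act_simps)

lemma additive_act: "Modules.additive (\<lambda>f. act f v)"
proof (induction v)
  case (Cons y v)
  show ?case
    by unfold_locales (simp only: act_simps additive.add[OF Cons] additive.add[OF additive_brk_left])
qed (unfold_locales, simp only: act_simps)

lemma lie_coeff_Br:
  "lie_coeff (Br u w) r = conv (lie_coeff u) (lie_coeff w) r - conv (lie_coeff w) (lie_coeff u) r"
  by (simp add: commutator_def)

lemma conv_append:
  assumes "\<And>v. g v \<noteq> 0 \<Longrightarrow> length v = length s"
  shows "conv g h (s @ t) = g s * h t"
proof -
  have "conv g h (s @ t) = (\<Sum>i\<le>length (s @ t). if i = length s then g s * h t else 0)"
    unfolding conv_eq_sum
  proof (rule sum.cong[OF refl])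
    fix i assume i: "i \<in> {..length (s @ t)}"
    show "g (take i (s @ t)) * h (drop i (s @ t)) = (if i = length s then g s * h t else 0)"
    proof (cases "i = length s")
      case False
      hence "length (take i (s @ t)) \<noteq> length s" using i by auto
      hence "g (take i (s @ t)) = 0" using assms by blast
      thus ?thesis using False by simp
    qed simp
  qed
  thus ?thesis by (simp add: sum.delta)
qed

text \<open>The word \<open>r\<close> is cut after \<open>m\<close> letters, the only place where the product can contribute.\<close>

lemma sum_words_conv:
  fixes F :: "'x list \<Rightarrow> 'a::ab_group_add"
  assumes g: "\<And>v. g v \<noteq> 0 \<Longrightarrow> length v = m"
  shows "(\<Sum>r | length r = m + n. zsmul (conv g h r) (F r)) =
    (\<Sum>s | length s = m. \<Sum>t | length t = n. zsmul (g s * h t) (F (s @ t)))"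
proof -
  have "bij_betw (\<lambda>(s, t). s @ t) ({s :: 'x list. length s = m} \<times> {t. length t = n}) {r. length r = m + n}"
    by (rule bij_betw_byWitness[where f' = "\<lambda>r. (take m r, drop m r)"]) auto
  hence "(\<Sum>r | length r = m + n. zsmul (conv g h r) (F r)) =
      (\<Sum>(s, t)\<in>{s. length s = m} \<times> {t. length t = n}. zsmul (conv g h (s @ t)) (F (s @ t)))"
    by (subst sum.reindex_bij_betw[symmetric]) (auto simp: case_prod_unfold)
  also have "\<dots> = (\<Sum>(s, t)\<in>{s. length s = m} \<times> {t. length t = n}. zsmul (g s * h t) (F (s @ t)))"
    by (rule sum.cong) (use g in \<open>auto simp: conv_append\<close>)
  also have "\<dots> = (\<Sum>s | length s = m. \<Sum>t | length t = n. zsmul (g s * h t) (F (s @ t)))"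
    by (rule sum.cartesian_product[symmetric])
  finally show ?thesis .
qed

text \<open>Here \<open>R\<close> is an ideal of the free nonassociative ring modulo which the product is a Lie
  bracket.\<close>

locale lie_relations =
  fixes R :: "('x magma \<Rightarrow> int) set"
  assumes fin: "finite (UNIV :: 'x set)"
    and R: "subgrp R"
    and brk_R: "f \<in> R \<Longrightarrow> g \<in> fin_supp \<Longrightarrow> brk f g \<in> R" "f \<in> R \<Longrightarrow> g \<in> fin_supp \<Longrightarrow> brk g f \<in> R"
    and square: "f \<in> fin_supp \<Longrightarrow> brk f f \<in> R"
    and jacobi: "f \<in> fin_supp \<Longrightarrow> g \<in> fin_supp \<Longrightarrow> l \<in> fin_supp \<Longrightarrow>
      brk (brk f g) l + brk (brk g l) f + brk (brk l f) g \<in> R"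
begin

definition eqv (infix "\<approx>\<^sub>R" 50) where "f \<approx>\<^sub>R g \<longleftrightarrow> f - g \<in> R"

lemma eqv_refl [simp]: "f \<approx>\<^sub>R f"
  by (simp add: eqv_def subgrp_0[OF R])

lemma eqv_trans [trans]: "f \<approx>\<^sub>R g \<Longrightarrow> g \<approx>\<^sub>R l \<Longrightarrow> f \<approx>\<^sub>R l"
  using subgrp_add[OF R, of "f - g" "g - l"] by (simp add: eqv_def)

lemma eq_eqv_trans [trans]: "f = g \<Longrightarrow> g \<approx>\<^sub>R l \<Longrightarrow> f \<approx>\<^sub>R l"
  and eqv_eq_trans [trans]: "f \<approx>\<^sub>R g \<Longrightarrow> g = l \<Longrightarrow> f \<approx>\<^sub>R l"
  by simp_all

lemma eqv_sym: "f \<approx>\<^sub>R g \<Longrightarrow> g \<approx>\<^sub>R f"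
  using subgrp_minus[OF R, of "f - g"] by (simp add: eqv_def)

lemma eqv_diff: "f \<approx>\<^sub>R f' \<Longrightarrow> g \<approx>\<^sub>R g' \<Longrightarrow> f - g \<approx>\<^sub>R f' - g'"
  using subgrp_diff[OF R, of "f - f'" "g - g'"] by (simp add: eqv_def algebra_simps)

lemma eqv_zsmul: "f \<approx>\<^sub>R g \<Longrightarrow> zsmul n f \<approx>\<^sub>R zsmul n g"
  using subgrp_zsmul[OF R, of "f - g" n] by (simp add: eqv_def zsmul_diff_right)

lemma eqv_sum: "(\<And>i. i \<in> S \<Longrightarrow> f i \<approx>\<^sub>R g i) \<Longrightarrow> sum f S \<approx>\<^sub>R sum g S"
  by (simp add: eqv_def sum_subtractf[symmetric] subgrp_sum[OF R])

lemma eqv_brk_left: "f \<approx>\<^sub>R f' \<Longrightarrow> g \<in> fin_supp \<Longrightarrow> brk f g \<approx>\<^sub>R brk f' g"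
  by (simp add: eqv_def additive.diff[OF additive_brk_left, symmetric] brk_R)

lemma eqv_act: "f \<approx>\<^sub>R f' \<Longrightarrow> act f v \<approx>\<^sub>R act f' v"
  by (induction v arbitrary: f f') (simp_all add: act_simps eqv_brk_left single_fin_supp)

lemma brk_anti: "f \<in> fin_supp \<Longrightarrow> g \<in> fin_supp \<Longrightarrow> brk f g \<approx>\<^sub>R - brk g f"
proof -
  assume f: "f \<in> fin_supp" and g: "g \<in> fin_supp"
  have "brk (f + g) (f + g) - brk f f - brk g g \<in> R"
    using f g by (intro subgrp_diff[OF R] square subgrp_add[OF subgrp_fin_supp])
  moreover have "brk (f + g) (f + g) - brk f f - brk g g = brk f g - (- brk g f)"
    by (simp add: additive.add[OF additive_brk_left] additive.add[OF additive_brk_right])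
  ultimately show ?thesis by (simp add: eqv_def)
qed

lemma brk_brk:
  assumes f: "f \<in> fin_supp" and g: "g \<in> fin_supp" and l: "l \<in> fin_supp"
  shows "brk f (brk g l) \<approx>\<^sub>R brk (brk f g) l - brk (brk f l) g"
proof -
  have 1: "brk f (brk g l) + brk (brk g l) f \<in> R"
    using brk_anti[OF f brk_fin_supp[OF g l]] by (simp add: eqv_def)
  have "brk l f + brk f l \<in> R" using brk_anti[OF l f] by (simp add: eqv_def)
  hence 2: "brk (brk l f) g + brk (brk f l) g \<in> R"
    using brk_R(1)[OF _ g] additive.add[OF additive_brk_left] by metis
  have "(brk f (brk g l) + brk (brk g l) f) - (brk (brk f g) l + brk (brk g l) f + brk (brk l f) g)
      + (brk (brk l f) g + brk (brk f l) g) \<in> R"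
    by (intro subgrp_add[OF R] subgrp_diff[OF R] 1 2 jacobi f g l)
  thus ?thesis by (simp add: eqv_def algebra_simps)
qed

text \<open>The Jacobi identity says that \<open>w \<mapsto> [-, w]\<close> turns brackets into commutators of operators, so \<open>[-, w]\<close>
  is the expansion of \<open>w\<close> in the free associative ring, with letters acting as brackets.\<close>

lemma brk_eq_sum_act:
  "f \<in> fin_supp \<Longrightarrow> brk f (single w) \<approx>\<^sub>R (\<Sum>v | length v = degree_magma w. zsmul (lie_coeff w v) (act f v))"
proof (induction w arbitrary: f)
  case (Gen x)
  have "(\<Sum>v | length v = 1. zsmul (lie_coeff (Gen x) v) (act f v)) =
      (\<Sum>v | length v = 1. if v = [x] then act f [x] else 0)"
    by (rule sum.cong) auto
  also have "\<dots> = act f [x]"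
    using finite_lists_length_eq[OF fin, of 1] by (simp add: sum.delta)
  finally show ?case by (simp add: act_simps)
next
  case (Br w1 w2)
  have supp: "lie_coeff w v \<noteq> 0 \<Longrightarrow> length v = degree_magma w" for w and v :: "'x list"
    by (rule lie_coeff_support)
  have step: "brk (brk f (single u)) (single w) \<approx>\<^sub>R
      (\<Sum>r | length r = degree_magma u + degree_magma w. zsmul (conv (lie_coeff u) (lie_coeff w) r) (act f r))"
    if IHu: "\<And>f. f \<in> fin_supp \<Longrightarrow> brk f (single u) \<approx>\<^sub>R (\<Sum>v | length v = degree_magma u. zsmul (lie_coeff u v) (act f v))"
      and IHw: "\<And>f. f \<in> fin_supp \<Longrightarrow> brk f (single w) \<approx>\<^sub>R (\<Sum>v | length v = degree_magma w. zsmul (lie_coeff w v) (act f v))"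
    for u w
  proof -
    have "brk (brk f (single u)) (single w) \<approx>\<^sub>R
        (\<Sum>t | length t = degree_magma w. zsmul (lie_coeff w t) (act (brk f (single u)) t))"
      by (intro IHw brk_fin_supp Br.prems single_fin_supp)
    also have "\<dots> \<approx>\<^sub>R (\<Sum>t | length t = degree_magma w. zsmul (lie_coeff w t)
        (act (\<Sum>s | length s = degree_magma u. zsmul (lie_coeff u s) (act f s)) t))"
      by (intro eqv_sum eqv_zsmul eqv_act IHu Br.prems)
    also have "\<dots> = (\<Sum>t | length t = degree_magma w. \<Sum>s | length s = degree_magma u.
        zsmul (lie_coeff u s * lie_coeff w t) (act f (s @ t)))"
      by (simp add: additive.sum[OF additive_act] additive_zsmul[OF additive_act] zsmul_sum_right
          zsmul_zsmul act_simps mult.commute)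
    also have "\<dots> = (\<Sum>s | length s = degree_magma u. \<Sum>t | length t = degree_magma w.
        zsmul (lie_coeff u s * lie_coeff w t) (act f (s @ t)))"
      by (rule sum.swap)
    also have "\<dots> = (\<Sum>r | length r = degree_magma u + degree_magma w.
        zsmul (conv (lie_coeff u) (lie_coeff w) r) (act f r))"
      by (rule sum_words_conv[OF supp, symmetric])
    finally show ?thesis .
  qed
  have "brk f (single (Br w1 w2)) \<approx>\<^sub>R brk (brk f (single w1)) (single w2) - brk (brk f (single w2)) (single w1)"
    unfolding brk_single[symmetric] by (rule brk_brk[OF Br.prems single_fin_supp single_fin_supp])
  also have "\<dots> \<approx>\<^sub>R (\<Sum>r | length r = degree_magma (Br w1 w2). zsmul (lie_coeff (Br w1 w2) r) (act f r))"
  proof -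
    have eq: "(\<Sum>r | length r = degree_magma (Br w1 w2). zsmul (lie_coeff (Br w1 w2) r) (act f r)) =
      (\<Sum>r | length r = degree_magma w1 + degree_magma w2. zsmul (conv (lie_coeff w1) (lie_coeff w2) r) (act f r)) -
      (\<Sum>r | length r = degree_magma w2 + degree_magma w1. zsmul (conv (lie_coeff w2) (lie_coeff w1) r) (act f r))"
      by (simp only: lie_coeff_Br degree_magma.simps zsmul_diff_left sum_subtractf
          add.commute[of "degree_magma w2" "degree_magma w1"])
    show ?thesis unfolding eq
      by (rule eqv_diff; rule step; rule Br.IH; assumption)
  qed
  finally show ?case .
qed

text \<open>The identity of Dynkin, Specht and Wever.  Induction: for \<open>w = [w1, w2]\<close> of degree \<open>d1 + d2\<close> one has
  \<open>(d1 + d2) w = [d1 w1, w2] - [d2 w2, w1]\<close>; the left arguments are combinations of left-normed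
  monomials by induction, and \<open>brk_eq_sum_act\<close> prolongs these by the words of the right arguments.\<close>

lemma dynkin:
  "zsmul (int (degree_magma w)) (single w) \<approx>\<^sub>R
     (\<Sum>v | length v = degree_magma w. zsmul (lie_coeff w v) (single (left_normed v)))"
proof (induction w)
  case (Gen x)
  have "(\<Sum>v | length v = 1. zsmul (lie_coeff (Gen x) v) (single (left_normed v))) =
      (\<Sum>v | length v = 1. if v = [x] then single (Gen x) else 0)"
    by (rule sum.cong) auto
  also have "\<dots> = single (Gen x)"
    using finite_lists_length_eq[OF fin, of 1] by (simp add: sum.delta)
  finally show ?case by simp
next
  case (Br w1 w2)
  have supp: "lie_coeff w v \<noteq> 0 \<Longrightarrow> length v = degree_magma w" for w and v :: "'x list"
    by (rule lie_coeff_support)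
  have step: "brk (zsmul (int (degree_magma u)) (single u)) (single w) \<approx>\<^sub>R
      (\<Sum>r | length r = degree_magma u + degree_magma w.
        zsmul (conv (lie_coeff u) (lie_coeff w) r) (single (left_normed r)))"
    if IHu: "zsmul (int (degree_magma u)) (single u) \<approx>\<^sub>R
      (\<Sum>v | length v = degree_magma u. zsmul (lie_coeff u v) (single (left_normed v)))" for u w
  proof -
    have "brk (zsmul (int (degree_magma u)) (single u)) (single w) \<approx>\<^sub>R
        brk (\<Sum>s | length s = degree_magma u. zsmul (lie_coeff u s) (single (left_normed s))) (single w)"
      by (rule eqv_brk_left[OF IHu single_fin_supp])
    also have "\<dots> = (\<Sum>s | length s = degree_magma u. zsmul (lie_coeff u s) (brk (single (left_normed s)) (single w)))"
      by (simp add: additive.sum[OF additive_brk_left] additive_zsmul[OF additive_brk_left])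
    also have "\<dots> \<approx>\<^sub>R (\<Sum>s | length s = degree_magma u. zsmul (lie_coeff u s)
        (\<Sum>t | length t = degree_magma w. zsmul (lie_coeff w t) (act (single (left_normed s)) t)))"
      by (intro eqv_sum eqv_zsmul brk_eq_sum_act single_fin_supp)
    also have "\<dots> = (\<Sum>s | length s = degree_magma u. \<Sum>t | length t = degree_magma w.
        zsmul (lie_coeff u s * lie_coeff w t) (single (left_normed (s @ t))))"
    proof (rule sum.cong[OF refl])
      fix s :: "'x list" assume "s \<in> {s. length s = degree_magma u}"
      hence "s \<noteq> []" using degree_magma_pos[of u] by auto
      thus "zsmul (lie_coeff u s) (\<Sum>t | length t = degree_magma w. zsmul (lie_coeff w t) (act (single (left_normed s)) t)) =
          (\<Sum>t | length t = degree_magma w. zsmul (lie_coeff u s * lie_coeff w t) (single (left_normed (s @ t))))"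
        by (simp add: zsmul_sum_right zsmul_zsmul act_left_normed)
    qed
    also have "\<dots> = (\<Sum>r | length r = degree_magma u + degree_magma w.
        zsmul (conv (lie_coeff u) (lie_coeff w) r) (single (left_normed r)))"
      by (rule sum_words_conv[OF supp, symmetric])
    finally show ?thesis .
  qed
  let ?s1 = "single w1" and ?s2 = "single w2"
  let ?d1 = "int (degree_magma w1)" and ?d2 = "int (degree_magma w2)"
  have split: "zsmul (int (degree_magma (Br w1 w2))) (single (Br w1 w2)) =
      brk (zsmul ?d1 ?s1) ?s2 - (- brk ?s1 (zsmul ?d2 ?s2))"
    by (simp add: zsmul_add_left additive_zsmul[OF additive_brk_left] additive_zsmul[OF additive_brk_right] brk_single)
  have "zsmul (int (degree_magma (Br w1 w2))) (single (Br w1 w2)) \<approx>\<^sub>R brk (zsmul ?d1 ?s1) ?s2 - brk (zsmul ?d2 ?s2) ?s1"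
    unfolding split
  proof (rule eqv_diff[OF eqv_refl])
    have "brk (zsmul ?d2 ?s2) ?s1 \<approx>\<^sub>R - brk ?s1 (zsmul ?d2 ?s2)"
      by (intro brk_anti single_fin_supp subgrp_zsmul[OF subgrp_fin_supp])
    thus "- brk ?s1 (zsmul ?d2 ?s2) \<approx>\<^sub>R brk (zsmul ?d2 ?s2) ?s1" by (rule eqv_sym)
  qed
  also have "\<dots> \<approx>\<^sub>R (\<Sum>r | length r = degree_magma (Br w1 w2). zsmul (lie_coeff (Br w1 w2) r) (single (left_normed r)))"
  proof -
    have eq: "(\<Sum>r | length r = degree_magma (Br w1 w2). zsmul (lie_coeff (Br w1 w2) r) (single (left_normed r))) =
      (\<Sum>r | length r = degree_magma w1 + degree_magma w2. zsmul (conv (lie_coeff w1) (lie_coeff w2) r) (single (left_normed r))) -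
      (\<Sum>r | length r = degree_magma w2 + degree_magma w1. zsmul (conv (lie_coeff w2) (lie_coeff w1) r) (single (left_normed r)))"
      by (simp only: lie_coeff_Br degree_magma.simps zsmul_diff_left sum_subtractf
          add.commute[of "degree_magma w2" "degree_magma w1"])
    show ?thesis unfolding eq
      by (rule eqv_diff; rule step; rule Br.IH)
  qed
  finally show ?case .
qed

definition graded_part :: "nat \<Rightarrow> ('x magma \<Rightarrow> int) \<Rightarrow> 'x magma \<Rightarrow> int"
  where "graded_part k f = (\<lambda>w. if degree_magma w = k then f w else 0)"

text \<open>By the identity of Dynkin, Specht and Wever, \<open>k\<close> times the part of degree \<open>k\<close> is a combination of
  left-normed monomials with the coefficients of the words as coefficients; these are divisible by \<open>p\<close>,
  and \<open>k\<close> is invertible modulo \<open>p\<close>.\<close>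

theorem graded_part_relation:
  assumes p: "prime p" and char: "\<And>f. f \<in> fin_supp \<Longrightarrow> zsmul (int p) f \<in> R"
    and k: "0 < k" "k < p" and f: "f \<in> fin_supp"
    and ev: "\<And>v. length v = k \<Longrightarrow> int p dvd eval_words f v"
  shows "graded_part k f \<in> R"
proof -
  let ?M = "{w :: 'x magma. degree_magma w = k}" and ?W = "{v :: 'x list. length v = k}"
  have finM: "finite ?M" by (rule finite_magma_degree[OF fin])
  have gp: "graded_part k f = (\<Sum>w\<in>?M. zsmul (f w) (single w))"
  proof -
    have "graded_part k f = (\<Sum>w\<in>?M. zsmul (graded_part k f w) (single w))"
      by (rule sum_singles[OF finM]) (auto simp: graded_part_def)
    thus ?thesis by (simp add: graded_part_def)
  qed
  have "zsmul (int k) (graded_part k f) = (\<Sum>w\<in>?M. zsmul (f w) (zsmul (int (degree_magma w)) (single w)))"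
    unfolding gp zsmul_sum_right by (rule sum.cong) (auto simp: zsmul_zsmul mult.commute)
  also have "\<dots> \<approx>\<^sub>R (\<Sum>w\<in>?M. zsmul (f w) (\<Sum>v | length v = degree_magma w. zsmul (lie_coeff w v) (single (left_normed v))))"
    by (intro eqv_sum eqv_zsmul dynkin)
  also have "\<dots> = (\<Sum>w\<in>?M. \<Sum>v\<in>?W. zsmul (f w * lie_coeff w v) (single (left_normed v)))"
    by (rule sum.cong) (auto simp: zsmul_sum_right zsmul_zsmul)
  also have "\<dots> = (\<Sum>v\<in>?W. \<Sum>w\<in>?M. zsmul (f w * lie_coeff w v) (single (left_normed v)))"
    by (rule sum.swap)
  also have "\<dots> = (\<Sum>v\<in>?W. zsmul (eval_words f v) (single (left_normed v)))"
  proof (rule sum.cong[OF refl])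
    fix v :: "'x list" assume "v \<in> ?W"
    have "Modules.additive (\<lambda>n. zsmul n (single (left_normed v)))"
      by unfold_locales (rule zsmul_add_left)
    from additive.sum[OF this, of "\<lambda>w. f w * lie_coeff w v" ?M]
    show "(\<Sum>w\<in>?M. zsmul (f w * lie_coeff w v) (single (left_normed v))) = zsmul (eval_words f v) (single (left_normed v))"
      using \<open>v \<in> ?W\<close> by (simp add: eval_words_def)
  qed
  also have "\<dots> \<approx>\<^sub>R 0"
  proof -
    have "zsmul (eval_words f v) (single (left_normed v)) \<in> R" if "v \<in> ?W" for v
    proof -
      from ev[of v] that obtain n where "eval_words f v = int p * n" by auto
      hence "zsmul (eval_words f v) (single (left_normed v)) = zsmul n (zsmul (int p) (single (left_normed v)))"
        by (simp add: zsmul_zsmul mult.commute)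
      thus ?thesis using subgrp_zsmul[OF R char[OF single_fin_supp]] by simp
    qed
    hence "(\<Sum>v\<in>?W. zsmul (eval_words f v) (single (left_normed v))) \<in> R"
      by (rule subgrp_sum[OF R])
    thus ?thesis by (simp add: eqv_def)
  qed
  finally have "zsmul (int k) (graded_part k f) \<in> R" by (simp add: eqv_def)
  moreover have "graded_part k f \<in> fin_supp"
    unfolding gp by (intro subgrp_sum subgrp_zsmul subgrp_fin_supp single_fin_supp)
  moreover have "\<not> int p dvd int k" using k by (auto dest: dvd_imp_le)
  ultimately show ?thesis using zsmul_mem_imp_mem[OF p R char] by blast
qed

end

section \<open>Algebras presented by magma elements\<close>

text \<open>An algebra \<open>B\<close> over $\mathbb{F}_p$ that is a homomorphic image of the free nonassociative ring.  The
  free algebra modulo \<open>p\<close> is of this kind and so is every quotient of it; subspaces and ideals of \<open>B\<close>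
  correspond to their inverse images, which are ordinary subgroups of a group of functions.\<close>

locale magma_presentation =
  fixes p :: nat and B :: "(int, 'b, 'n) module_scheme" and h :: "('x magma \<Rightarrow> int) \<Rightarrow> 'b"
  assumes p: "prime p"
    and surj: "h ` fin_supp = carrier B"
    and h_add: "f \<in> fin_supp \<Longrightarrow> g \<in> fin_supp \<Longrightarrow> h (f + g) = h f \<oplus>\<^bsub>B\<^esub> h g"
    and h_brk: "f \<in> fin_supp \<Longrightarrow> g \<in> fin_supp \<Longrightarrow> h (brk f g) = h f \<otimes>\<^bsub>B\<^esub> h g"
    and h_smult: "f \<in> fin_supp \<Longrightarrow> a \<in> carrier (residue_ring (int p)) \<Longrightarrow> h (zsmul a f) = a \<odot>\<^bsub>B\<^esub> h f"
    and h_zero: "h 0 = \<zero>\<^bsub>B\<^esub>"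
    and h_char: "f \<in> fin_supp \<Longrightarrow> h (zsmul (int p) f) = \<zero>\<^bsub>B\<^esub>"
begin

lemma h_closed: "f \<in> fin_supp \<Longrightarrow> h f \<in> carrier B"
  using surj by blast

lemma carrierE:
  assumes "x \<in> carrier B"
  obtains f where "f \<in> fin_supp" "x = h f"
  using assms surj by blast

lemma fin_supp_0: "0 \<in> fin_supp"
  by (rule subgrp_0[OF subgrp_fin_supp])

lemma fin_supp_minus: "f \<in> fin_supp \<Longrightarrow> - f \<in> fin_supp"
  by (rule subgrp_minus[OF subgrp_fin_supp])

lemma fin_supp_add: "f \<in> fin_supp \<Longrightarrow> g \<in> fin_supp \<Longrightarrow> f + g \<in> fin_supp"
  by (rule subgrp_add[OF subgrp_fin_supp])

lemma fin_supp_diff: "f \<in> fin_supp \<Longrightarrow> g \<in> fin_supp \<Longrightarrow> f - g \<in> fin_supp"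
  by (rule subgrp_diff[OF subgrp_fin_supp])

lemma abelian_group: "abelian_group B"
proof (rule abelian_groupI)
  show "\<zero>\<^bsub>B\<^esub> \<in> carrier B" using h_closed[OF fin_supp_0] by (simp add: h_zero)
next
  fix x y assume "x \<in> carrier B" "y \<in> carrier B"
  then obtain f g where "f \<in> fin_supp" "g \<in> fin_supp" "x = h f" "y = h g" by (metis carrierE)
  thus "x \<oplus>\<^bsub>B\<^esub> y \<in> carrier B" "x \<oplus>\<^bsub>B\<^esub> y = y \<oplus>\<^bsub>B\<^esub> x"
    by (simp_all add: h_add[symmetric] h_closed fin_supp_add add.commute)
next
  fix x y z assume "x \<in> carrier B" "y \<in> carrier B" "z \<in> carrier B"
  then obtain f g l where "f \<in> fin_supp" "g \<in> fin_supp" "l \<in> fin_supp" "x = h f" "y = h g" "z = h l"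
    by (metis carrierE)
  thus "x \<oplus>\<^bsub>B\<^esub> y \<oplus>\<^bsub>B\<^esub> z = x \<oplus>\<^bsub>B\<^esub> (y \<oplus>\<^bsub>B\<^esub> z)"
    by (simp add: h_add[symmetric] fin_supp_add add.assoc)
next
  fix x assume "x \<in> carrier B"
  then obtain f where f: "f \<in> fin_supp" "x = h f" by (rule carrierE)
  show "\<zero>\<^bsub>B\<^esub> \<oplus>\<^bsub>B\<^esub> x = x"
    using h_add[OF fin_supp_0 f(1)] by (simp add: f h_zero)
  have "h (- f) \<oplus>\<^bsub>B\<^esub> x = \<zero>\<^bsub>B\<^esub>"
    using h_add[OF fin_supp_minus[OF f(1)] f(1)] by (simp add: f h_zero[symmetric])
  thus "\<exists>y\<in>carrier B. y \<oplus>\<^bsub>B\<^esub> x = \<zero>\<^bsub>B\<^esub>" using h_closed[OF fin_supp_minus[OF f(1)]] by blast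
qed

lemma h_minus: "f \<in> fin_supp \<Longrightarrow> h (- f) = \<ominus>\<^bsub>B\<^esub> h f"
proof -
  assume f: "f \<in> fin_supp"
  interpret abelian_group B by (rule abelian_group)
  have "h (- f) \<oplus>\<^bsub>B\<^esub> h f = \<zero>\<^bsub>B\<^esub>"
    using h_add[OF fin_supp_minus[OF f] f] by (simp add: h_zero[symmetric])
  from minus_equality[OF this h_closed[OF f] h_closed[OF fin_supp_minus[OF f]]] show ?thesis by simp
qed

lemma h_diff: "f \<in> fin_supp \<Longrightarrow> g \<in> fin_supp \<Longrightarrow> h (f - g) = h f \<oplus>\<^bsub>B\<^esub> (\<ominus>\<^bsub>B\<^esub> h g)"
  using h_add[of f "- g"] by (simp add: h_minus fin_supp_minus)

lemma h_eq_iff: "f \<in> fin_supp \<Longrightarrow> g \<in> fin_supp \<Longrightarrow> h f = h g \<longleftrightarrow> h (f - g) = \<zero>\<^bsub>B\<^esub>"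
proof -
  assume f: "f \<in> fin_supp" and g: "g \<in> fin_supp"
  interpret abelian_group B by (rule abelian_group)
  show ?thesis
  proof
    assume "h f = h g"
    thus "h (f - g) = \<zero>\<^bsub>B\<^esub>" using h_diff[OF f g] r_neg[OF h_closed[OF g]] by simp
  next
    assume "h (f - g) = \<zero>\<^bsub>B\<^esub>"
    thus "h f = h g" using h_add[OF fin_supp_diff[OF f g] g] h_closed[OF g] by simp
  qed
qed

definition preim :: "'b set \<Rightarrow> ('x magma \<Rightarrow> int) set"
  where "preim H = {f \<in> fin_supp. h f \<in> H}"

lemma preimD: "f \<in> preim H \<Longrightarrow> f \<in> fin_supp" "f \<in> preim H \<Longrightarrow> h f \<in> H"
  by (auto simp: preim_def)

lemma submodule_iff: "submodule H (residue_ring (int p)) B \<longleftrightarrow> H \<subseteq> carrier B \<and> subgrp (preim H)"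
proof
  assume H: "submodule H (residue_ring (int p)) B"
  then interpret S: subgroup H "add_monoid B" by (rule submodule.axioms(1))
  have sub: "H \<subseteq> carrier B" using S.subset by simp
  have "subgrp (preim H)"
  proof (rule subgrpI)
    show "0 \<in> preim H" using S.one_closed by (simp add: preim_def fin_supp_0 h_zero)
    fix f g assume f: "f \<in> preim H" and g: "g \<in> preim H"
    have "\<ominus>\<^bsub>B\<^esub> h g \<in> H" using S.m_inv_closed[OF preimD(2)[OF g]] by (simp add: a_inv_def)
    from S.m_closed[OF preimD(2)[OF f] this] show "f - g \<in> preim H"
      by (simp add: preim_def preimD(1)[OF f] preimD(1)[OF g] fin_supp_diff h_diff)
  qed
  with sub show "H \<subseteq> carrier B \<and> subgrp (preim H)" by simp
next
  assume H: "H \<subseteq> carrier B \<and> subgrp (preim H)"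
  have ex: "\<exists>f\<in>preim H. x = h f" if "x \<in> H" for x
    using that H by (auto simp: preim_def elim!: carrierE)
  show "submodule H (residue_ring (int p)) B"
  proof (intro submodule.intro subgroup.intro submodule_axioms.intro)
    show "H \<subseteq> carrier (add_monoid B)" using H by simp
    fix x y assume "x \<in> H" "y \<in> H"
    then obtain f g where f: "f \<in> preim H" "x = h f" and g: "g \<in> preim H" "y = h g" using ex by metis
    hence "f + g \<in> preim H" using H subgrp_add by blast
    thus "x \<otimes>\<^bsub>add_monoid B\<^esub> y \<in> H" using f g by (simp add: preim_def h_add)
  next
    have "0 \<in> preim H" using H subgrp_0 by blast
    thus "\<one>\<^bsub>add_monoid B\<^esub> \<in> H" by (simp add: preim_def h_zero)
  next
    fix x assume "x \<in> H"
    then obtain f where f: "f \<in> preim H" "x = h f" using ex by metis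
    hence "- f \<in> preim H" using H subgrp_minus by blast
    thus "inv\<^bsub>add_monoid B\<^esub> x \<in> H" using f by (simp add: preim_def h_minus a_inv_def)
  next
    fix a x assume a: "a \<in> carrier (residue_ring (int p))" "x \<in> H"
    then obtain f where f: "f \<in> preim H" "x = h f" using ex by metis
    hence "zsmul a f \<in> preim H" using H subgrp_zsmul by blast
    thus "a \<odot>\<^bsub>B\<^esub> x \<in> H" using f a by (simp add: preim_def h_smult)
  qed
qed

lemma submodule_image: "subgrp G \<Longrightarrow> G \<subseteq> fin_supp \<Longrightarrow> submodule (h ` G) (residue_ring (int p)) B"
proof -
  assume G: "subgrp G" "G \<subseteq> fin_supp"
  have "subgrp (preim (h ` G))"
  proof (rule subgrpI)
    show "0 \<in> preim (h ` G)" using subgrp_0[OF G(1)] by (simp add: preim_def fin_supp_0)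
    fix f g assume f: "f \<in> preim (h ` G)" and g: "g \<in> preim (h ` G)"
    obtain f' g' where f': "f' \<in> G" "h f = h f'" and g': "g' \<in> G" "h g = h g'"
      using preimD(2)[OF f] preimD(2)[OF g] by blast
    have "h (f - g) = h (f' - g')"
      using h_diff[OF subsetD[OF G(2) f'(1)] subsetD[OF G(2) g'(1)]]
        h_diff[OF preimD(1)[OF f] preimD(1)[OF g]] f'(2) g'(2) by simp
    moreover have "f' - g' \<in> G" using f' g' subgrp_diff[OF G(1)] by blast
    ultimately show "f - g \<in> preim (h ` G)"
      using preimD(1)[OF f] preimD(1)[OF g] by (auto simp: preim_def fin_supp_diff)
  qed
  thus ?thesis using G(2) h_closed by (auto simp: submodule_iff)
qed

text \<open>The minimality of \<open>G\<close> concerns the subgroups that contain \<open>S\<close>; scalars come for free as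
  $\mathbb{F}_p$ is generated by its unit.\<close>

lemma lin_span_image:
  assumes G: "subgrp G" "G \<subseteq> fin_supp" "S \<subseteq> G" and least: "\<And>P. subgrp P \<Longrightarrow> S \<subseteq> P \<Longrightarrow> G \<subseteq> P"
  shows "lin_span (residue_ring (int p)) B (h ` S) = h ` G"
proof
  show "lin_span (residue_ring (int p)) B (h ` S) \<subseteq> h ` G"
    unfolding lin_span_def using submodule_image[OF G(1,2)] G(3) by blast
  show "h ` G \<subseteq> lin_span (residue_ring (int p)) B (h ` S)"
    unfolding lin_span_def
  proof (rule Inter_greatest)
    fix H assume H: "H \<in> {H. submodule H (residue_ring (int p)) B \<and> h ` S \<subseteq> H}"
    hence "subgrp (preim H)" "S \<subseteq> preim H" using G by (auto simp: submodule_iff preim_def)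
    hence "G \<subseteq> preim H" by (rule least)
    thus "h ` G \<subseteq> H" by (auto simp: preim_def)
  qed
qed

lemma alg_ideal_iff:
  "alg_ideal (residue_ring (int p)) B I \<longleftrightarrow> I \<subseteq> carrier B \<and> subgrp (preim I) \<and>
     (\<forall>f\<in>fin_supp. \<forall>g\<in>preim I. brk f g \<in> preim I \<and> brk g f \<in> preim I)"
proof -
  have "(\<forall>a\<in>carrier B. \<forall>x\<in>I. a \<otimes>\<^bsub>B\<^esub> x \<in> I \<and> x \<otimes>\<^bsub>B\<^esub> a \<in> I) \<longleftrightarrow>
      (\<forall>f\<in>fin_supp. \<forall>g\<in>preim I. brk f g \<in> preim I \<and> brk g f \<in> preim I)" if I: "I \<subseteq> carrier B"
  proof -
    have *: "(\<forall>x\<in>I. P x) \<longleftrightarrow> (\<forall>g\<in>preim I. P (h g))" for P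
      using I by (auto simp: preim_def elim!: carrierE)
    have **: "(\<forall>a\<in>carrier B. P a) \<longleftrightarrow> (\<forall>f\<in>fin_supp. P (h f))" for P
      unfolding surj[symmetric] by simp
    show ?thesis unfolding * ** by (auto simp: preim_def h_brk brk_fin_supp)
  qed
  thus ?thesis unfolding alg_ideal_def submodule_iff by blast
qed

lemma alg_ideal_gen:
  assumes S: "S \<subseteq> carrier B"
  shows "alg_ideal (residue_ring (int p)) B (gen_alg_ideal (residue_ring (int p)) B S)"
proof -
  let ?\<I> = "{I. alg_ideal (residue_ring (int p)) B I \<and> S \<subseteq> I}"
  have carr: "carrier B \<in> ?\<I>"
  proof -
    have "preim (carrier B) = fin_supp" by (auto simp: preim_def h_closed)
    thus ?thesis using S by (simp add: alg_ideal_iff subgrp_fin_supp brk_fin_supp)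
  qed
  have pre: "preim (\<Inter>?\<I>) = (\<Inter>I\<in>?\<I>. preim I)" using carr by (auto simp: preim_def)
  have "subgrp (\<Inter>I\<in>?\<I>. preim I)"
    by (auto simp: subgrp_def alg_ideal_iff)
  moreover have "brk f g \<in> (\<Inter>I\<in>?\<I>. preim I) \<and> brk g f \<in> (\<Inter>I\<in>?\<I>. preim I)"
    if "f \<in> fin_supp" "g \<in> (\<Inter>I\<in>?\<I>. preim I)" for f g
    using that by (auto simp: alg_ideal_iff)
  ultimately show ?thesis
    unfolding gen_alg_ideal_def using carr unfolding alg_ideal_iff[of "\<Inter>?\<I>"] pre by blast
qed

lemma coset_mem:
  assumes I: "I \<subseteq> carrier B" and f: "f \<in> fin_supp"
  shows "a \<in> I +>\<^bsub>B\<^esub> h f \<longleftrightarrow> (\<exists>f'\<in>fin_supp. a = h f' \<and> f' - f \<in> preim I)"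
proof
  assume "a \<in> I +>\<^bsub>B\<^esub> h f"
  then obtain i where i: "i \<in> I" "a = i \<oplus>\<^bsub>B\<^esub> h f" by (auto simp: a_r_coset_def')
  then obtain l where l: "l \<in> fin_supp" "i = h l" using I by (auto elim!: carrierE)
  have "a = h (l + f)" "l + f - f \<in> preim I" using i l f by (auto simp: h_add preim_def)
  thus "\<exists>f'\<in>fin_supp. a = h f' \<and> f' - f \<in> preim I" using fin_supp_add[OF l(1) f] by blast
next
  assume "\<exists>f'\<in>fin_supp. a = h f' \<and> f' - f \<in> preim I"
  then obtain f' where f': "f' \<in> fin_supp" "a = h f'" "f' - f \<in> preim I" by blast
  have "a = h (f' - f) \<oplus>\<^bsub>B\<^esub> h f" using h_add[OF fin_supp_diff[OF f'(1) f] f] f'(2) by simp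
  thus "a \<in> I +>\<^bsub>B\<^esub> h f" using preimD(2)[OF f'(3)] by (auto simp: a_r_coset_def')
qed

lemma coset_eq_iff:
  assumes I: "I \<subseteq> carrier B" "subgrp (preim I)" and f: "f \<in> fin_supp" and g: "g \<in> fin_supp"
  shows "I +>\<^bsub>B\<^esub> h f = I +>\<^bsub>B\<^esub> h g \<longleftrightarrow> f - g \<in> preim I"
proof
  assume eq: "I +>\<^bsub>B\<^esub> h f = I +>\<^bsub>B\<^esub> h g"
  have "h f \<in> I +>\<^bsub>B\<^esub> h f"
    unfolding coset_mem[OF I(1) f] using f subgrp_0[OF I(2)] by (intro bexI[of _ f]) auto
  hence "h f \<in> I +>\<^bsub>B\<^esub> h g" by (simp add: eq)
  then obtain f' where f': "f' \<in> fin_supp" "h f = h f'" "f' - g \<in> preim I"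
    unfolding coset_mem[OF I(1) g] by blast
  have "h (f - g) = h (f' - g)" using f' f g by (simp add: h_diff)
  thus "f - g \<in> preim I" using f' f g by (simp add: preim_def fin_supp_diff)
next
  assume fg: "f - g \<in> preim I"
  have "f' - f \<in> preim I \<longleftrightarrow> f' - g \<in> preim I" for f'
    using subgrp_add[OF I(2) _ fg, of "f' - f"] subgrp_diff[OF I(2) _ fg, of "f' - g"] by auto
  thus "I +>\<^bsub>B\<^esub> h f = I +>\<^bsub>B\<^esub> h g"
    by (intro Set.set_eqI) (simp add: coset_mem[OF I(1) f] coset_mem[OF I(1) g])
qed

lemma coset_0:
  assumes I: "I \<subseteq> carrier B"
  shows "I +>\<^bsub>B\<^esub> h 0 = I"
proof -
  interpret abelian_group B by (rule abelian_group)
  have "i \<oplus>\<^bsub>B\<^esub> \<zero>\<^bsub>B\<^esub> = i" if "i \<in> I" for i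
    by (rule r_zero[OF subsetD[OF I that]])
  thus ?thesis by (auto simp: a_r_coset_def' h_zero)
qed

text \<open>In \<open>quot_alg\<close> the operations are defined by unions over the elements of cosets; that they are
  single-valued is checked on representatives in the free nonassociative ring.\<close>

theorem quotient_presentation:
  assumes "alg_ideal (residue_ring (int p)) B I"
  shows "magma_presentation p (quot_alg B I) (\<lambda>f. I +>\<^bsub>B\<^esub> h f)"
proof -
  from assms have I: "I \<subseteq> carrier B" "subgrp (preim I)"
    and brk_I: "\<And>f g. f \<in> fin_supp \<Longrightarrow> g \<in> preim I \<Longrightarrow> brk f g \<in> preim I"
      "\<And>f g. f \<in> fin_supp \<Longrightarrow> g \<in> preim I \<Longrightarrow> brk g f \<in> preim I"
    by (auto simp: alg_ideal_iff)
  note mem = coset_mem[OF I(1)] and eq = coset_eq_iff[OF I]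
  have self: "h f \<in> I +>\<^bsub>B\<^esub> h f" if "f \<in> fin_supp" for f
    unfolding mem[OF that] using that subgrp_0[OF I(2)] by (intro bexI[of _ f]) auto
  show ?thesis
  proof
    show "prime p" by (rule p)
    show "(\<lambda>f. I +>\<^bsub>B\<^esub> h f) ` fin_supp = carrier (quot_alg B I)"
      by (auto simp: quot_alg_def A_RCOSETS_def' surj[symmetric])
    fix f :: "'x magma \<Rightarrow> int" assume f: "f \<in> fin_supp"
    have "zsmul (int p) f \<in> preim I"
      using f subgrp_0[OF I(2)] by (simp add: preim_def h_char h_zero[symmetric] subgrp_zsmul[OF subgrp_fin_supp])
    hence "I +>\<^bsub>B\<^esub> h (zsmul (int p) f) = I +>\<^bsub>B\<^esub> h 0"
      using f by (subst eq) (auto simp: subgrp_zsmul[OF subgrp_fin_supp] fin_supp_0)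
    thus "I +>\<^bsub>B\<^esub> h (zsmul (int p) f) = \<zero>\<^bsub>quot_alg B I\<^esub>"
      by (simp add: coset_0[OF I(1)] quot_alg_def)
    { fix a assume a: "a \<in> carrier (residue_ring (int p))"
      have "I +>\<^bsub>B\<^esub> (a \<odot>\<^bsub>B\<^esub> x) = I +>\<^bsub>B\<^esub> h (zsmul a f)" if "x \<in> I +>\<^bsub>B\<^esub> h f" for x
      proof -
        from that obtain f' where f': "f' \<in> fin_supp" "x = h f'" "f' - f \<in> preim I"
          unfolding mem[OF f] by blast
        have "zsmul a f' - zsmul a f \<in> preim I"
          using subgrp_zsmul[OF I(2) f'(3), of a] by (simp add: zsmul_diff_right)
        thus ?thesis using f f' a
          by (simp add: h_smult[symmetric] eq subgrp_zsmul[OF subgrp_fin_supp])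
      qed
      thus "I +>\<^bsub>B\<^esub> h (zsmul a f) = a \<odot>\<^bsub>quot_alg B I\<^esub> (I +>\<^bsub>B\<^esub> h f)"
        using self[OF f] by (auto simp: quot_alg_def) }
    fix g :: "'x magma \<Rightarrow> int" assume g: "g \<in> fin_supp"
    show "I +>\<^bsub>B\<^esub> h (f + g) = (I +>\<^bsub>B\<^esub> h f) \<oplus>\<^bsub>quot_alg B I\<^esub> (I +>\<^bsub>B\<^esub> h g)"
    proof (intro equalityI subsetI)
      fix x assume "x \<in> I +>\<^bsub>B\<^esub> h (f + g)"
      then obtain l where l: "l \<in> fin_supp" "x = h l" "l - (f + g) \<in> preim I"
        unfolding mem[OF fin_supp_add[OF f g]] by blast
      have "h (l - g) \<in> I +>\<^bsub>B\<^esub> h f"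
        unfolding mem[OF f] using l g by (intro bexI[of _ "l - g"]) (auto simp: fin_supp_diff algebra_simps)
      moreover have "x = h (l - g) \<oplus>\<^bsub>B\<^esub> h g" using h_add[OF fin_supp_diff[OF l(1) g] g] l(2) by simp
      ultimately show "x \<in> (I +>\<^bsub>B\<^esub> h f) \<oplus>\<^bsub>quot_alg B I\<^esub> (I +>\<^bsub>B\<^esub> h g)"
        using self[OF g] by (auto simp: quot_alg_def set_add_def')
    next
      fix x assume "x \<in> (I +>\<^bsub>B\<^esub> h f) \<oplus>\<^bsub>quot_alg B I\<^esub> (I +>\<^bsub>B\<^esub> h g)"
      then obtain y z where yz: "y \<in> I +>\<^bsub>B\<^esub> h f" "z \<in> I +>\<^bsub>B\<^esub> h g" "x = y \<oplus>\<^bsub>B\<^esub> z"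
        by (auto simp: quot_alg_def set_add_def')
      obtain f' where f': "f' \<in> fin_supp" "y = h f'" "f' - f \<in> preim I" using yz(1) unfolding mem[OF f] by blast
      obtain g' where g': "g' \<in> fin_supp" "z = h g'" "g' - g \<in> preim I" using yz(2) unfolding mem[OF g] by blast
      have "f' + g' - (f + g) \<in> preim I"
        using subgrp_add[OF I(2) f'(3) g'(3)] by (simp add: algebra_simps)
      thus "x \<in> I +>\<^bsub>B\<^esub> h (f + g)"
        unfolding mem[OF fin_supp_add[OF f g]] using f' g' yz(3)
        by (intro bexI[of _ "f' + g'"]) (auto simp: h_add fin_supp_add)
    qed
    have "I +>\<^bsub>B\<^esub> (y \<otimes>\<^bsub>B\<^esub> z) = I +>\<^bsub>B\<^esub> h (brk f g)"
      if y: "y \<in> I +>\<^bsub>B\<^esub> h f" and z: "z \<in> I +>\<^bsub>B\<^esub> h g" for y z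
    proof -
      obtain f' where f': "f' \<in> fin_supp" "y = h f'" "f' - f \<in> preim I" using y unfolding mem[OF f] by blast
      obtain g' where g': "g' \<in> fin_supp" "z = h g'" "g' - g \<in> preim I" using z unfolding mem[OF g] by blast
      have "brk f' g' - brk f g = brk (f' - f) g' + brk f (g' - g)"
        by (simp add: additive.diff[OF additive_brk_left] additive.diff[OF additive_brk_right])
      also have "\<dots> \<in> preim I"
        by (intro subgrp_add[OF I(2)] brk_I f' g' f)
      finally show ?thesis using f g f' g' by (simp add: h_brk[symmetric] eq brk_fin_supp)
    qed
    thus "I +>\<^bsub>B\<^esub> h (brk f g) = (I +>\<^bsub>B\<^esub> h f) \<otimes>\<^bsub>quot_alg B I\<^esub> (I +>\<^bsub>B\<^esub> h g)"
      using self[OF f] self[OF g] by (auto simp: quot_alg_def rcoset_mult_def)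
  qed (simp add: quot_alg_def coset_0[OF I(1)])
qed

lemma quotient_zero_iff:
  assumes "alg_ideal (residue_ring (int p)) B I" and f: "f \<in> fin_supp"
  shows "I +>\<^bsub>B\<^esub> h f = \<zero>\<^bsub>quot_alg B I\<^esub> \<longleftrightarrow> f \<in> preim I"
proof -
  have I: "I \<subseteq> carrier B" "subgrp (preim I)" using assms(1) by (auto simp: alg_ideal_iff)
  have "I +>\<^bsub>B\<^esub> h f = \<zero>\<^bsub>quot_alg B I\<^esub> \<longleftrightarrow> I +>\<^bsub>B\<^esub> h f = I +>\<^bsub>B\<^esub> h 0"
    by (simp add: quot_alg_def coset_0[OF I(1)])
  thus ?thesis using coset_eq_iff[OF I f fin_supp_0] by simp
qed

lemma lin_span_submodule:
  assumes S: "S \<subseteq> carrier B"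
  shows "submodule (lin_span (residue_ring (int p)) B S) (residue_ring (int p)) B"
proof -
  let ?\<H> = "{H. submodule H (residue_ring (int p)) B \<and> S \<subseteq> H}"
  have carr: "carrier B \<in> ?\<H>"
  proof -
    have "preim (carrier B) = fin_supp" by (auto simp: preim_def h_closed)
    thus ?thesis using S by (simp add: submodule_iff subgrp_fin_supp)
  qed
  have pre: "preim (\<Inter>?\<H>) = (\<Inter>H\<in>?\<H>. preim H)" using carr by (auto simp: preim_def)
  have "subgrp (\<Inter>H\<in>?\<H>. preim H)"
    by (auto simp: subgrp_def submodule_iff)
  thus ?thesis
    unfolding lin_span_def using carr unfolding submodule_iff[of "\<Inter>?\<H>"] pre by blast
qed

lemma lin_span_incl: "S \<subseteq> lin_span (residue_ring (int p)) B S"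
  by (auto simp: lin_span_def)

lemma lin_span_least: "submodule H (residue_ring (int p)) B \<Longrightarrow> S \<subseteq> H \<Longrightarrow> lin_span (residue_ring (int p)) B S \<subseteq> H"
  by (auto simp: lin_span_def)

lemma lin_span_mono: "S \<subseteq> S' \<Longrightarrow> lin_span (residue_ring (int p)) B S \<subseteq> lin_span (residue_ring (int p)) B S'"
  by (auto simp: lin_span_def)

lemma h_sum:
  assumes "finite S" "\<And>j. j \<in> S \<Longrightarrow> f j \<in> fin_supp"
  shows "h (\<Sum>j\<in>S. f j) = (\<Oplus>\<^bsub>B\<^esub>j\<in>S. h (f j))"
proof -
  interpret abelian_group B by (rule abelian_group)
  from assms show ?thesis
  proof (induction S rule: finite_induct)
    case empty
    show ?case by (simp add: h_zero[unfolded zero_fun_def] zero_fun_def)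
  next
    case (insert j S)
    have "h (\<Sum>i\<in>insert j S. f i) = h (f j + (\<Sum>i\<in>S. f i))" using insert by simp
    also have "\<dots> = h (f j) \<oplus>\<^bsub>B\<^esub> h (\<Sum>i\<in>S. f i)"
      using insert.prems by (intro h_add subgrp_sum[OF subgrp_fin_supp]) auto
    also have "\<dots> = h (f j) \<oplus>\<^bsub>B\<^esub> (\<Oplus>\<^bsub>B\<^esub>i\<in>S. h (f i))" using insert by simp
    also have "\<dots> = (\<Oplus>\<^bsub>B\<^esub>i\<in>insert j S. h (f i))"
      using insert by (intro finsum_insert[symmetric]) (auto intro: h_closed)
    finally show ?case .
  qed
qed

end

section \<open>The free nilpotent Lie algebra\<close>

definition reduce :: "nat \<Rightarrow> ('x magma \<Rightarrow> int) \<Rightarrow> 'x magma \<Rightarrow> int"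
  where "reduce p f = (\<lambda>w. f w mod int p)"

lemma reduce_presentation:
  assumes p: "prime p"
  shows "magma_presentation p (free_alg (residue_ring (int p))) (reduce p :: ('x magma \<Rightarrow> int) \<Rightarrow> _)"
proof
  have p0: "int p > 0" using prime_gt_0_nat[OF p] by simp
  show "prime p" by (rule p)
  have supp: "{w. f w mod int p \<noteq> 0} \<subseteq> {w. f w \<noteq> 0}" for f :: "'x magma \<Rightarrow> int" by auto
  show "reduce p ` fin_supp = carrier (free_alg (residue_ring (int p)) :: (int, 'x magma \<Rightarrow> int) module)"
  proof (intro equalityI subsetI)
    fix f :: "'x magma \<Rightarrow> int" assume "f \<in> reduce p ` fin_supp"
    then obtain g where "g \<in> fin_supp" "f = reduce p g" by blast
    thus "f \<in> carrier (free_alg (residue_ring (int p)))"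
      using p0 finite_subset[OF supp[of g]]
      by (auto simp: free_alg_def residue_ring_def reduce_def fin_supp_def)
  next
    fix f :: "'x magma \<Rightarrow> int" assume "f \<in> carrier (free_alg (residue_ring (int p)))"
    hence "f \<in> fin_supp" "f = reduce p f"
      by (auto simp: free_alg_def residue_ring_def reduce_def fin_supp_def fun_eq_iff)
    thus "f \<in> reduce p ` fin_supp" by blast
  qed
next
  fix f g :: "'x magma \<Rightarrow> int"
  show "reduce p (f + g) = reduce p f \<oplus>\<^bsub>free_alg (residue_ring (int p))\<^esub> reduce p g"
    by (simp add: free_alg_def residue_ring_def reduce_def fun_eq_iff mod_add_eq)
  show "reduce p (brk f g) = reduce p f \<otimes>\<^bsub>free_alg (residue_ring (int p))\<^esub> reduce p g"
  proof
    fix w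
    show "reduce p (brk f g) w = (reduce p f \<otimes>\<^bsub>free_alg (residue_ring (int p))\<^esub> reduce p g) w"
      by (cases w) (simp_all add: free_alg_def residue_ring_def reduce_def brk_def mod_mult_eq)
  qed
  show "reduce p (zsmul a f) = a \<odot>\<^bsub>free_alg (residue_ring (int p))\<^esub> reduce p f" for a
    by (simp add: free_alg_def residue_ring_def reduce_def fun_eq_iff zsmul_apply zsmul_int mod_mult_right_eq)
qed (simp_all add: free_alg_def residue_ring_def reduce_def fun_eq_iff zsmul_apply zsmul_int)

lemma dvd_conv:
  assumes "\<And>s t. v = s @ t \<Longrightarrow> d dvd g s * h t"
  shows "d dvd conv g h v"
  unfolding conv_eq_sum by (intro dvd_sum assms) simp

lemma eval_words_Nil: "eval_words f [] = 0"
proof -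
  have "{w :: 'a magma. degree_magma w = 0} = {}" using degree_magma_pos by (auto simp: neq0_conv)
  thus ?thesis by (simp only: eval_words_def list.size sum.empty)
qed

lemma dvd_eval_words_reduce: "int p dvd eval_words (reduce p f) v - eval_words f v"
proof -
  have "eval_words (reduce p f) v - eval_words f v =
      (\<Sum>w | degree_magma w = length v. (f w mod int p - f w) * lie_coeff w v)"
    by (simp add: eval_words_def reduce_def sum_subtractf left_diff_distrib)
  also have "int p dvd \<dots>"
    by (intro dvd_sum dvd_mult2) (simp add: mod_eq_dvd_iff[symmetric])
  finally show ?thesis .
qed

text \<open>The steps of the construction of the free nilpotent Lie algebra: the free algebra \<open>A\<close>, its quotient
  \<open>F\<close> by the ideal of Lie relations, and the quotient \<open>L\<close> of \<open>F\<close> by a term of the lower central series.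
  Each inherits a presentation from the step before.\<close>

locale free_nilpotent_mod =
  fixes p c :: nat and letters :: "'x itself"
  assumes prime: "prime p" and fin: "finite (UNIV :: 'x set)"
begin

abbreviation K :: "int ring"
  where "K \<equiv> residue_ring (int p)"

abbreviation A :: "(int, 'x magma \<Rightarrow> int) module"
  where "A \<equiv> free_alg K"

abbreviation rel :: "('x magma \<Rightarrow> int) set"
  where "rel \<equiv> lie_relation_ideal K"

abbreviation F :: "(int, ('x magma \<Rightarrow> int) set) module"
  where "F \<equiv> free_lie K"

definition to_free_lie :: "('x magma \<Rightarrow> int) \<Rightarrow> ('x magma \<Rightarrow> int) set"
  where "to_free_lie f = rel +>\<^bsub>A\<^esub> reduce p f"

sublocale A: magma_presentation p A "reduce p"
  by (rule reduce_presentation[OF prime])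

lemma lie_relators_subset: "lie_relators A \<subseteq> carrier A"
proof
  fix x assume "x \<in> lie_relators A"
  then consider f where "f \<in> fin_supp" "x = reduce p f \<otimes>\<^bsub>A\<^esub> reduce p f"
    | f g l where "f \<in> fin_supp" "g \<in> fin_supp" "l \<in> fin_supp"
      "x = (reduce p f \<otimes>\<^bsub>A\<^esub> reduce p g) \<otimes>\<^bsub>A\<^esub> reduce p l \<oplus>\<^bsub>A\<^esub> (reduce p g \<otimes>\<^bsub>A\<^esub> reduce p l) \<otimes>\<^bsub>A\<^esub> reduce p f
        \<oplus>\<^bsub>A\<^esub> (reduce p l \<otimes>\<^bsub>A\<^esub> reduce p f) \<otimes>\<^bsub>A\<^esub> reduce p g"
    by (auto simp: lie_relators_def A.surj[symmetric])
  thus "x \<in> carrier A"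
    by cases (simp_all add: A.h_brk[symmetric] A.h_add[symmetric] brk_fin_supp A.fin_supp_add A.h_closed)
qed

lemma alg_ideal_rel: "alg_ideal K A rel"
  unfolding lie_relation_ideal_def by (rule A.alg_ideal_gen[OF lie_relators_subset])

sublocale F: magma_presentation p F to_free_lie
  using A.quotient_presentation[OF alg_ideal_rel] by (simp add: free_lie_def to_free_lie_def[abs_def])

definition rel_preim :: "('x magma \<Rightarrow> int) set"
  where "rel_preim = A.preim rel"

lemma to_free_lie_eq_0: "f \<in> fin_supp \<Longrightarrow> to_free_lie f = \<zero>\<^bsub>F\<^esub> \<longleftrightarrow> f \<in> rel_preim"
  using A.quotient_zero_iff[OF alg_ideal_rel] by (simp add: free_lie_def to_free_lie_def rel_preim_def)

lemma lie_relators_rel: "lie_relators A \<subseteq> rel"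
  by (auto simp: lie_relation_ideal_def gen_alg_ideal_def)

sublocale R: lie_relations rel_preim
proof
  show "finite (UNIV :: 'x set)" by (rule fin)
  show "subgrp rel_preim" using alg_ideal_rel by (simp add: A.alg_ideal_iff rel_preim_def)
  show "f \<in> rel_preim \<Longrightarrow> g \<in> fin_supp \<Longrightarrow> brk f g \<in> rel_preim"
    "f \<in> rel_preim \<Longrightarrow> g \<in> fin_supp \<Longrightarrow> brk g f \<in> rel_preim" for f g
    using alg_ideal_rel by (simp_all add: A.alg_ideal_iff rel_preim_def)
  show "brk f f \<in> rel_preim" if "f \<in> fin_supp" for f
  proof -
    have "reduce p f \<otimes>\<^bsub>A\<^esub> reduce p f \<in> lie_relators A"
      using A.h_closed[OF that] by (auto simp: lie_relators_def)
    thus ?thesis using lie_relators_rel that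
      by (auto simp: rel_preim_def A.preim_def A.h_brk brk_fin_supp)
  qed
  show "brk (brk f g) l + brk (brk g l) f + brk (brk l f) g \<in> rel_preim"
    if "f \<in> fin_supp" "g \<in> fin_supp" "l \<in> fin_supp" for f g l
  proof -
    have "(reduce p f \<otimes>\<^bsub>A\<^esub> reduce p g) \<otimes>\<^bsub>A\<^esub> reduce p l \<oplus>\<^bsub>A\<^esub> (reduce p g \<otimes>\<^bsub>A\<^esub> reduce p l) \<otimes>\<^bsub>A\<^esub> reduce p f
        \<oplus>\<^bsub>A\<^esub> (reduce p l \<otimes>\<^bsub>A\<^esub> reduce p f) \<otimes>\<^bsub>A\<^esub> reduce p g \<in> lie_relators A"
      unfolding lie_relators_def using that[THEN A.h_closed] by blast
    hence "reduce p (brk (brk f g) l + brk (brk g l) f + brk (brk l f) g) \<in> rel"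
      using lie_relators_rel that by (simp add: A.h_brk A.h_add brk_fin_supp A.fin_supp_add subset_iff)
    thus ?thesis using that by (simp add: rel_preim_def A.preim_def brk_fin_supp A.fin_supp_add)
  qed
qed

lemma rel_preim_char: "f \<in> fin_supp \<Longrightarrow> zsmul (int p) f \<in> rel_preim"
  using F.h_char[of f] to_free_lie_eq_0[of "zsmul (int p) f"] by (simp add: subgrp_zsmul[OF subgrp_fin_supp])

lemma dvd_commutator:
  assumes "\<And>s. length s \<le> length v \<Longrightarrow> d dvd g s"
  shows "d dvd commutator g h v" "d dvd commutator h g v"
proof -
  have "d dvd conv g h v" by (rule dvd_conv, rule dvd_mult2, rule assms) simp
  moreover have "d dvd conv h g v" by (rule dvd_conv, rule dvd_mult, rule assms) simp
  ultimately show "d dvd commutator g h v" "d dvd commutator h g v" by (simp_all add: commutator_def)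
qed

text \<open>The polynomials whose expansion into words vanishes modulo \<open>p\<close> form an ideal that contains the
  Lie relators, as the commutator is a Lie bracket.\<close>

lemma dvd_eval_words_rel:
  assumes "f \<in> rel_preim"
  shows "int p dvd eval_words f v"
proof -
  \<comment> \<open>The elements of \<open>A\<close> are themselves functions on the magma, with values in \<open>{0..<p}\<close>.\<close>
  define I where "I = {x \<in> carrier A. \<forall>v. int p dvd eval_words x v}"
  have dvd_iff: "int p dvd eval_words (reduce p f) v \<longleftrightarrow> int p dvd eval_words f v" for f :: "'x magma \<Rightarrow> int" and v
    using dvd_eval_words_reduce[of p f v] by (metis dvd_diff_commute dvd_diff_left_iff zdvd_zdiffD)
  have pre: "A.preim I = {f \<in> fin_supp. \<forall>v. int p dvd eval_words f v}"
    by (auto simp: A.preim_def I_def A.h_closed dvd_iff)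
  have "alg_ideal K A I"
    unfolding A.alg_ideal_iff pre
  proof (intro conjI ballI)
    show "I \<subseteq> carrier A" by (auto simp: I_def)
    show "subgrp {f \<in> fin_supp. \<forall>v. int p dvd eval_words f v}"
      by (auto simp: subgrp_def A.fin_supp_0 A.fin_supp_diff additive.diff[OF additive_eval_words]
          additive.zero[OF additive_eval_words])
    fix f g :: "'x magma \<Rightarrow> int"
    assume f: "f \<in> fin_supp" and g: "g \<in> {f \<in> fin_supp. \<forall>v. int p dvd eval_words f v}"
    have "int p dvd commutator (eval_words f) (eval_words g) v" "int p dvd commutator (eval_words g) (eval_words f) v" for v
      using g by (intro dvd_commutator; simp)+
    with f g show "brk f g \<in> {f \<in> fin_supp. \<forall>v. int p dvd eval_words f v}"
      "brk g f \<in> {f \<in> fin_supp. \<forall>v. int p dvd eval_words f v}"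
      by (auto simp: brk_fin_supp eval_words_brk[OF fin])
  qed
  moreover have "lie_relators A \<subseteq> I"
  proof
    fix x assume x: "x \<in> lie_relators A"
    then consider f where "f \<in> fin_supp" "x = reduce p f \<otimes>\<^bsub>A\<^esub> reduce p f"
      | f g l where "f \<in> fin_supp" "g \<in> fin_supp" "l \<in> fin_supp"
        "x = (reduce p f \<otimes>\<^bsub>A\<^esub> reduce p g) \<otimes>\<^bsub>A\<^esub> reduce p l \<oplus>\<^bsub>A\<^esub> (reduce p g \<otimes>\<^bsub>A\<^esub> reduce p l) \<otimes>\<^bsub>A\<^esub> reduce p f
          \<oplus>\<^bsub>A\<^esub> (reduce p l \<otimes>\<^bsub>A\<^esub> reduce p f) \<otimes>\<^bsub>A\<^esub> reduce p g"
      by (auto simp: lie_relators_def A.surj[symmetric])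
    hence "\<exists>f\<in>fin_supp. x = reduce p f \<and> eval_words f = 0"
    proof cases
      case (1 f)
      hence "x = reduce p (brk f f)" by (simp add: A.h_brk)
      moreover have "eval_words (brk f f) = 0" by (simp only: eval_words_brk[OF fin 1(1) 1(1)] commutator_self)
      ultimately show ?thesis using brk_fin_supp[OF 1(1) 1(1)] by blast
    next
      case (2 f g l)
      let ?j = "brk (brk f g) l + brk (brk g l) f + brk (brk l f) g"
      have "x = reduce p ?j" using 2 by (simp add: A.h_brk A.h_add brk_fin_supp A.fin_supp_add)
      moreover have "eval_words ?j = 0"
        by (simp only: additive.add[OF additive_eval_words] eval_words_brk[OF fin] brk_fin_supp 2(1-3) commutator_jacobi)
      moreover have "?j \<in> fin_supp" using 2(1-3) by (intro A.fin_supp_add brk_fin_supp)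
      ultimately show ?thesis by blast
    qed
    then obtain f where f: "f \<in> fin_supp" "x = reduce p f" "eval_words f = 0" by blast
    have "int p dvd eval_words x v" for v using dvd_iff[of f v] f(3) by (simp add: f(2))
    thus "x \<in> I" using x lie_relators_subset by (auto simp: I_def)
  qed
  ultimately have "rel \<subseteq> I" by (auto simp: lie_relation_ideal_def gen_alg_ideal_def)
  hence "f \<in> A.preim I" using assms by (auto simp: rel_preim_def A.preim_def)
  thus ?thesis by (simp add: pre)
qed

text \<open>The term with index \<open>i\<close> is $\gamma_{i+1}$.\<close>

definition lower_preim :: "nat \<Rightarrow> ('x magma \<Rightarrow> int) set"
  where "lower_preim i = F.preim (lower_central K F i)"

lemma lower_central_subset: "lower_central K F i \<subseteq> carrier F"
  and submodule_lower_central: "submodule (lower_central K F i) K F"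
proof (induction i)
  case 0
  have "F.preim (carrier F) = fin_supp" by (auto simp: F.preim_def F.h_closed)
  thus "lower_central K F 0 \<subseteq> carrier F" "submodule (lower_central K F 0) K F"
    by (simp_all add: F.submodule_iff subgrp_fin_supp)
next
  case (Suc i)
  have "x \<otimes>\<^bsub>F\<^esub> y \<in> carrier F" if "x \<in> carrier F" "y \<in> carrier F" for x y
    using that by (elim F.carrierE) (simp add: F.h_brk[symmetric] F.h_closed brk_fin_supp)
  hence "{x \<otimes>\<^bsub>F\<^esub> y | x y. x \<in> lower_central K F i \<and> y \<in> carrier F} \<subseteq> carrier F"
    using Suc(1) by auto
  from F.lin_span_submodule[OF this]
  show "submodule (lower_central K F (Suc i)) K F" by simp
  thus "lower_central K F (Suc i) \<subseteq> carrier F" by (simp only: F.submodule_iff)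
qed

lemma lower_preim_subgrp: "subgrp (lower_preim i)"
  using submodule_lower_central by (simp add: lower_preim_def F.submodule_iff)

lemma lower_preim_fin_supp: "lower_preim i \<subseteq> fin_supp"
  by (auto simp: lower_preim_def F.preim_def)

lemma lower_preim_brk: "f \<in> lower_preim i \<Longrightarrow> g \<in> fin_supp \<Longrightarrow> brk f g \<in> lower_preim (Suc i)"
proof -
  assume f: "f \<in> lower_preim i" and g: "g \<in> fin_supp"
  have fs: "f \<in> fin_supp" "to_free_lie f \<in> lower_central K F i"
    using f by (auto simp: lower_preim_def F.preim_def)
  have "to_free_lie f \<otimes>\<^bsub>F\<^esub> to_free_lie g \<in> lower_central K F (Suc i)"
    using F.lin_span_incl[of "{x \<otimes>\<^bsub>F\<^esub> y | x y. x \<in> lower_central K F i \<and> y \<in> carrier F}"] fs(2) F.h_closed[OF g]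
    by auto
  thus ?thesis using fs(1) g by (simp add: lower_preim_def F.preim_def F.h_brk brk_fin_supp)
qed

lemma rel_preim_lower: "rel_preim \<subseteq> lower_preim i"
proof
  fix f assume f: "f \<in> rel_preim"
  hence fs: "f \<in> fin_supp" by (simp add: rel_preim_def A.preim_def)
  have "to_free_lie f = to_free_lie 0" using f fs to_free_lie_eq_0 F.h_zero by simp
  thus "f \<in> lower_preim i"
    using fs subgrp_0[OF lower_preim_subgrp] by (simp add: lower_preim_def F.preim_def)
qed

lemma lower_preim_Suc: "lower_preim (Suc i) \<subseteq> lower_preim i"
proof -
  have "lower_central K F (Suc i) \<subseteq> lower_central K F i"
  proof (induction i)
    case 0
    show ?case using lower_central_subset[of "Suc 0"] by simp
  next
    case (Suc i)
    show ?case unfolding lower_central.simps(2)[of _ _ "Suc i"] lower_central.simps(2)[of _ _ i]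
      by (rule F.lin_span_mono) (use Suc in auto)
  qed
  thus ?thesis by (auto simp: lower_preim_def F.preim_def)
qed

lemma lower_preim_antimono: "i \<le> j \<Longrightarrow> lower_preim j \<subseteq> lower_preim i"
  by (rule lift_Suc_antimono_le[of lower_preim, OF lower_preim_Suc])

lemma lower_preim_eqv: "R.eqv f g \<Longrightarrow> g \<in> lower_preim i \<Longrightarrow> f \<in> lower_preim i"
  using subgrp_add[OF lower_preim_subgrp[of i], of "f - g" g] rel_preim_lower[of i] by (auto simp: R.eqv_def)

text \<open>The definition of the lower central series provides only brackets with one further element of
  \<open>F\<close>; that a monomial of degree \<open>d\<close> raises the index by \<open>d\<close> comes from the Jacobi identity.\<close>

lemma lower_preim_brk_single: "f \<in> lower_preim i \<Longrightarrow> brk f (single w) \<in> lower_preim (i + degree_magma w)"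
proof (induction w arbitrary: f i)
  case (Gen x)
  thus ?case using lower_preim_brk[OF _ single_fin_supp] by simp
next
  case (Br w1 w2)
  have f: "f \<in> fin_supp" using Br.prems lower_preim_fin_supp by blast
  have "brk (brk f (single w1)) (single w2) - brk (brk f (single w2)) (single w1) \<in> lower_preim (i + degree_magma (Br w1 w2))"
    using Br.IH(2)[OF Br.IH(1)[OF Br.prems]] Br.IH(1)[OF Br.IH(2)[OF Br.prems]]
    by (intro subgrp_diff[OF lower_preim_subgrp]) (simp_all add: add_ac)
  from lower_preim_eqv[OF R.brk_brk[OF f single_fin_supp single_fin_supp] this]
  show ?case by (simp only: brk_single)
qed

lemma single_lower_preim: "single w \<in> lower_preim (degree_magma w - 1)"
proof (cases w)
  case (Gen x)
  thus ?thesis by (simp add: lower_preim_def F.preim_def single_fin_supp F.h_closed)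
next
  case (Br w1 w2)
  have "single w1 \<in> lower_preim (degree_magma w1 - 1)"
  proof (induction w1)
    case (Gen x)
    thus ?case by (simp add: lower_preim_def F.preim_def single_fin_supp F.h_closed)
  next
    case (Br u v)
    thus ?case using lower_preim_brk_single[OF Br(1), of v] degree_magma_pos[of u] by (simp add: brk_single)
  qed
  thus ?thesis using lower_preim_brk_single[of "single w1" _ w2] degree_magma_pos[of w1]
    by (fastforce simp: Br brk_single)
qed

lemma alg_ideal_lower_central: "alg_ideal K F (lower_central K F i)"
  unfolding F.alg_ideal_iff lower_preim_def[symmetric]
proof (intro conjI ballI)
  fix f g :: "'x magma \<Rightarrow> int" assume f: "f \<in> fin_supp" and g: "g \<in> lower_preim i"
  have gs: "g \<in> fin_supp" using g lower_preim_fin_supp by blast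
  show *: "brk g f \<in> lower_preim i" using lower_preim_brk[OF g f] lower_preim_Suc by blast
  show "brk f g \<in> lower_preim i"
    by (rule lower_preim_eqv[OF R.brk_anti[OF f gs] subgrp_minus[OF lower_preim_subgrp *]])
qed (rule lower_central_subset lower_preim_subgrp)+

text \<open>Modulo \<open>p\<close>, elements of $\gamma_{i+1}$ have no words of length at most \<open>i\<close>: each further bracket adds a factor
  without constant term.\<close>

lemma dvd_eval_words_lower:
  assumes f: "f \<in> lower_preim i" and v: "length v \<le> i"
  shows "int p dvd eval_words f v"
proof -
  define G where "G i = {f \<in> fin_supp :: ('x magma \<Rightarrow> int) set. \<forall>v. length v \<le> i \<longrightarrow> int p dvd eval_words f v}" for i
  have G: "subgrp (G i)" "G i \<subseteq> fin_supp" for i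
    by (auto simp: G_def subgrp_def A.fin_supp_0 A.fin_supp_diff additive.diff[OF additive_eval_words]
        additive.zero[OF additive_eval_words])
  have "lower_central K F i \<subseteq> to_free_lie ` G i" for i
  proof (induction i)
    case 0
    have "G 0 = fin_supp" by (auto simp: G_def eval_words_Nil)
    thus ?case by (simp add: F.surj)
  next
    case (Suc i)
    have "{x \<otimes>\<^bsub>F\<^esub> y | x y. x \<in> lower_central K F i \<and> y \<in> carrier F} \<subseteq> to_free_lie ` G (Suc i)"
    proof clarify
      fix x y assume "x \<in> lower_central K F i" "y \<in> carrier F"
      then obtain f g where f: "f \<in> G i" "x = to_free_lie f" and g: "g \<in> fin_supp" "y = to_free_lie g"
        using Suc by (auto elim!: F.carrierE)
      have fs: "f \<in> fin_supp" using f(1) by (simp add: G_def)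
      have "int p dvd eval_words f s * eval_words g t" if "length (s @ t) \<le> Suc i" for s t
      proof (cases t)
        case Nil
        thus ?thesis by (simp add: eval_words_Nil)
      next
        case (Cons y u)
        thus ?thesis using f(1) that by (auto simp: G_def intro: dvd_mult2)
      qed
      hence "int p dvd conv (eval_words f) (eval_words g) v \<and> int p dvd conv (eval_words g) (eval_words f) v"
        if "length v \<le> Suc i" for v
        using that by (auto intro!: dvd_conv simp: mult.commute[of "eval_words g _"] add.commute)
      hence "brk f g \<in> G (Suc i)"
        using fs g(1) by (simp add: G_def brk_fin_supp eval_words_brk[OF fin] commutator_def)
      thus "x \<otimes>\<^bsub>F\<^esub> y \<in> to_free_lie ` G (Suc i)" using fs f g by (auto simp: F.h_brk[symmetric])
    qed
    thus ?case using F.lin_span_least[OF F.submodule_image[OF G]] by simp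
  qed
  moreover have "to_free_lie f \<in> lower_central K F i" using f by (simp add: lower_preim_def F.preim_def)
  ultimately obtain g where g: "g \<in> G i" "to_free_lie f = to_free_lie g" by blast
  have fg: "f \<in> fin_supp" "g \<in> fin_supp" using f g lower_preim_fin_supp by (auto simp: G_def)
  hence "f - g \<in> rel_preim"
    using g(2) F.h_eq_iff to_free_lie_eq_0 F.fin_supp_diff by metis
  hence "int p dvd eval_words (f - g) v" by (rule dvd_eval_words_rel)
  hence "int p dvd eval_words f v - eval_words g v" by (simp add: additive.diff[OF additive_eval_words])
  moreover have "int p dvd eval_words g v" using g(1) v by (simp add: G_def)
  ultimately show ?thesis by (metis dvd_add diff_add_cancel)
qed

abbreviation L :: "(int, ('x magma \<Rightarrow> int) set set) module"
  where "L \<equiv> free_nilpotent_lie K c"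

definition to_L :: "('x magma \<Rightarrow> int) \<Rightarrow> ('x magma \<Rightarrow> int) set set"
  where "to_L f = lower_central K F c +>\<^bsub>F\<^esub> to_free_lie f"

sublocale L: magma_presentation p L to_L
  using F.quotient_presentation[OF alg_ideal_lower_central]
  by (simp add: free_nilpotent_lie_def to_L_def[abs_def])

text \<open>The vanishing of \<open>to_L f\<close> means that \<open>f\<close> represents an element of $\gamma_{c+1}$, so one direction is
  \<open>dvd_eval_words_lower\<close>.  Conversely, the parts of \<open>f\<close> of degree at most \<open>c\<close> are Lie relations by \<open>graded_part_relation\<close>, and the monomials of larger degree lie in $\gamma_{c+1}$.\<close>

theorem to_L_eq_0_iff:
  assumes c: "c < p" and f: "f \<in> fin_supp"
  shows "to_L f = \<zero>\<^bsub>L\<^esub> \<longleftrightarrow> (\<forall>v. length v \<le> c \<longrightarrow> int p dvd eval_words f v)"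
proof -
  have "to_L f = \<zero>\<^bsub>L\<^esub> \<longleftrightarrow> f \<in> lower_preim c"
    using F.quotient_zero_iff[OF alg_ideal_lower_central f]
    by (simp add: free_nilpotent_lie_def to_L_def lower_preim_def)
  also have "\<dots> \<longleftrightarrow> (\<forall>v. length v \<le> c \<longrightarrow> int p dvd eval_words f v)"
  proof (intro iffI allI impI)
    assume ev: "\<forall>v. length v \<le> c \<longrightarrow> int p dvd eval_words f v"
    define low where "low = (\<Sum>k\<in>{1..c}. R.graded_part k f)"
    have "low \<in> lower_preim c"
      unfolding low_def
    proof (rule subgrp_sum[OF lower_preim_subgrp])
      fix k assume k: "k \<in> {1..c}"
      have "R.graded_part k f \<in> rel_preim"
        by (rule R.graded_part_relation[OF prime rel_preim_char _ _ f]) (use k c ev in auto)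
      thus "R.graded_part k f \<in> lower_preim c" using rel_preim_lower by blast
    qed
    moreover have "f - low \<in> lower_preim c"
    proof -
      have low: "low w = (if degree_magma w \<le> c then f w else 0)" for w
        using degree_magma_pos[of w] by (auto simp: low_def sum_fun_apply R.graded_part_def Suc_le_eq)
      have "{w. (f - low) w \<noteq> 0} \<subseteq> {w. f w \<noteq> 0 \<and> c < degree_magma w}" by (auto simp: low)
      moreover have "finite {w. f w \<noteq> 0 \<and> c < degree_magma w}"
        using f by (auto simp: fin_supp_def)
      ultimately have "f - low = (\<Sum>w | f w \<noteq> 0 \<and> c < degree_magma w. zsmul ((f - low) w) (single w))"
        by (intro sum_singles)
      also have "\<dots> \<in> lower_preim c"
      proof (intro subgrp_sum[OF lower_preim_subgrp] subgrp_zsmul[OF lower_preim_subgrp])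
        fix w assume "w \<in> {w. f w \<noteq> 0 \<and> c < degree_magma w}"
        hence "c \<le> degree_magma w - 1" by auto
        thus "single w \<in> lower_preim c" using lower_preim_antimono single_lower_preim by blast
      qed
      finally show ?thesis .
    qed
    ultimately have "low + (f - low) \<in> lower_preim c" by (rule subgrp_add[OF lower_preim_subgrp])
    thus "f \<in> lower_preim c" by simp
  qed (rule dvd_eval_words_lower)
  finally show ?thesis .
qed

end

section \<open>Elements of the free nilpotent Lie algebra as functions on words\<close>

definition at_length :: "nat \<Rightarrow> ('x list \<Rightarrow> 'a) \<Rightarrow> 'x list \<Rightarrow> 'a::ab_group_add"
  where "at_length j g = (\<lambda>v. if length v = j then g v else 0)"

lemma additive_at_length: "Modules.additive (at_length j)"
  by unfold_locales (auto simp: at_length_def fun_eq_iff)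

definition homogeneous :: "nat \<Rightarrow> ('x magma \<Rightarrow> int) set"
  where "homogeneous k = {f \<in> fin_supp. \<forall>w. f w \<noteq> 0 \<longrightarrow> degree_magma w = k}"

lemma subgrp_homogeneous: "subgrp (homogeneous k)"
proof (rule subgrpI)
  fix f g :: "'x magma \<Rightarrow> int" assume fg: "f \<in> homogeneous k" "g \<in> homogeneous k"
  have "f w \<noteq> 0 \<or> g w \<noteq> 0" if "(f - g) w \<noteq> 0" for w using that by auto
  thus "f - g \<in> homogeneous k"
    using fg subgrp_diff[OF subgrp_fin_supp] unfolding homogeneous_def by blast
qed (simp add: homogeneous_def subgrp_0[OF subgrp_fin_supp])

lemma homogeneous_fin_supp: "homogeneous k \<subseteq> fin_supp"
  by (auto simp: homogeneous_def)

lemma eval_words_homogeneous: "f \<in> homogeneous k \<Longrightarrow> length v \<noteq> k \<Longrightarrow> eval_words f v = 0"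
  unfolding eval_words_def homogeneous_def by (intro sum.neutral) fastforce

text \<open>For \<open>p > c\<close> an element of \<open>L\<close> is determined by the coefficients of the words of length at most
  \<open>c\<close>, read in \<open>\<rat>/\<int>\<close>.\<close>

locale large_prime = free_nilpotent_mod p c letters for p c and letters :: "'x itself" +
  assumes c: "c < p"
begin

lemma p0: "p > 0"
  using c by simp

definition word_values :: "('x magma \<Rightarrow> int) \<Rightarrow> 'x list \<Rightarrow> rat_mod_int"
  where "word_values f = (\<lambda>v. if length v \<le> c then residue p (eval_words f v) else 0)"

lemma additive_word_values: "Modules.additive word_values"
  by unfold_locales
     (auto simp: word_values_def fun_eq_iff additive.add[OF additive_eval_words] additive.add[OF additive_residue])

lemma to_L_eq_iff:
  assumes f: "f \<in> fin_supp" and g: "g \<in> fin_supp"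
  shows "to_L f = to_L g \<longleftrightarrow> word_values f = word_values g"
proof -
  have "to_L f = to_L g \<longleftrightarrow> (\<forall>v. length v \<le> c \<longrightarrow> int p dvd eval_words f v - eval_words g v)"
    using to_L_eq_0_iff[OF c L.fin_supp_diff[OF f g]]
    by (simp add: L.h_eq_iff[OF f g] additive.diff[OF additive_eval_words])
  also have "\<dots> \<longleftrightarrow> word_values f = word_values g"
    by (auto simp: word_values_def fun_eq_iff residue_eq_iff[OF p0])
  finally show ?thesis .
qed

abbreviation lie :: "nat \<Rightarrow> ('x list \<Rightarrow> rat_mod_int) set"
  where "lie k \<equiv> lie_polys (residues_mod p) k"

text \<open>The component \<open>L\<^sub>k\<close> is identified with the Lie polynomials of degree \<open>k\<close>.\<close>

lemma word_values_homogeneous: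
  assumes k: "k \<le> c"
  shows "word_values ` homogeneous k = lie k"
proof (intro equalityI subsetI)
  have res: "residue p (\<Sum>w\<in>S. f w * n w) = (\<Sum>w\<in>S. zsmul (n w) (residue p (f w)))"
    for S and f n :: "'x magma \<Rightarrow> int"
    by (simp add: additive.sum[OF additive_residue] zsmul_residue mult.commute)
  {
    fix g assume "g \<in> word_values ` homogeneous k"
    then obtain f where f: "f \<in> homogeneous k" "g = word_values f" by blast
    show "g \<in> lie k"
    proof (rule lie_polysI[of "\<lambda>w. residue p (f w)"])
      show "g = (\<lambda>v. \<Sum>w | degree_magma w = k. zsmul (lie_coeff w v) (residue p (f w)))"
      proof
        fix v
        show "g v = (\<Sum>w | degree_magma w = k. zsmul (lie_coeff w v) (residue p (f w)))"
        proof (cases "length v = k")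
          case True
          thus ?thesis using k by (simp add: f(2) word_values_def eval_words_def res)
        next
          case False
          have "lie_coeff w v = 0" if "degree_magma w = k" for w
            using lie_coeff_support[of w v] that False by auto
          thus ?thesis using eval_words_homogeneous[OF f(1) False]
            by (simp add: f(2) word_values_def additive.zero[OF additive_residue])
        qed
      qed
    qed (simp add: residues_mod_def)
  next
    fix g assume "g \<in> lie k"
    then obtain t where t: "\<forall>w. t w \<in> residues_mod p"
        "g = (\<lambda>v. \<Sum>w | degree_magma w = k. zsmul (lie_coeff w v) (t w))"
      by (auto simp: lie_polys_def)
    have "\<forall>w. \<exists>n. t w = residue p n" using t(1) by (auto simp: residues_mod_def)
    from choice[OF this] obtain n where n: "\<forall>w. t w = residue p (n w)" by blast
    define f where "f w = (if degree_magma w = k then n w else 0)" for w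
    have "{w. f w \<noteq> 0} \<subseteq> {w. degree_magma w = k}" by (auto simp: f_def)
    hence "f \<in> fin_supp" using finite_magma_degree[OF fin] by (auto simp: fin_supp_def intro: finite_subset)
    hence f: "f \<in> homogeneous k" by (simp add: homogeneous_def f_def)
    have "g = word_values f"
    proof
      fix v
      show "g v = word_values f v"
      proof (cases "length v = k")
        case True
        thus ?thesis using k by (simp add: word_values_def eval_words_def res t(2) n f_def)
      next
        case False
        have "lie_coeff w v = 0" if "degree_magma w = k" for w
          using lie_coeff_support[of w v] that False by auto
        thus ?thesis using eval_words_homogeneous[OF f False]
          by (simp add: t(2) word_values_def additive.zero[OF additive_residue])
      qed
    qed
    thus "g \<in> word_values ` homogeneous k" using f by blast
  }
qed

lemma at_length_homogeneous:
  "f \<in> homogeneous j \<Longrightarrow> at_length i (word_values f) = (if i = j then word_values f else 0)"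
  using eval_words_homogeneous[of f j]
  by (auto simp: at_length_def word_values_def fun_eq_iff additive.zero[OF additive_residue])

lemma graded_part_homogeneous: "f \<in> fin_supp \<Longrightarrow> R.graded_part j f \<in> homogeneous j"
proof -
  assume f: "f \<in> fin_supp"
  have "{w. R.graded_part j f w \<noteq> 0} \<subseteq> {w. f w \<noteq> 0}" by (auto simp: R.graded_part_def)
  thus ?thesis using f by (auto simp: homogeneous_def fin_supp_def R.graded_part_def intro: finite_subset split: if_splits)
qed

lemma word_values_graded_part: "word_values (R.graded_part j f) = at_length j (word_values f)"
proof
  fix v
  have "eval_words (R.graded_part j f) v = (if length v = j then eval_words f v else 0)"
    unfolding eval_words_def by (auto simp: R.graded_part_def intro!: sum.neutral)
  thus "word_values (R.graded_part j f) v = at_length j (word_values f) v"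
    by (auto simp: at_length_def word_values_def additive.zero[OF additive_residue])
qed

lemma word_values_sum_graded: "word_values (\<Sum>j\<in>{1..c}. R.graded_part j f) = word_values f"
proof
  fix v
  have "word_values (\<Sum>j\<in>{1..c}. R.graded_part j f) v = (\<Sum>j\<in>{1..c}. at_length j (word_values f) v)"
    by (simp add: additive.sum[OF additive_word_values] sum_fun_apply word_values_graded_part)
  also have "\<dots> = (if length v \<in> {1..c} then word_values f v else 0)"
    by (simp add: at_length_def sum.delta')
  also have "\<dots> = word_values f v"
    by (cases v) (auto simp: word_values_def eval_words_Nil additive.zero[OF additive_residue])
  finally show "word_values (\<Sum>j\<in>{1..c}. R.graded_part j f) v = word_values f v" .
qed

abbreviation comp :: "nat \<Rightarrow> ('x magma \<Rightarrow> int) set set set"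
  where "comp k \<equiv> homogeneous_component K L (free_nilpotent_lie_gen K c) k"

lemma free_nilpotent_lie_gen_eq: "free_nilpotent_lie_gen K c x = to_L (single (Gen x))"
proof -
  have "1 mod int p = 1" using prime_gt_1_nat[OF prime] by simp
  hence "free_alg_gen K x = reduce p (single (Gen x))"
    by (auto simp: free_alg_gen_def reduce_def single_def residue_ring_def fun_eq_iff)
  thus ?thesis by (simp add: free_nilpotent_lie_gen_def to_L_def to_free_lie_def free_lie_gen_def)
qed

lemma lie_monomial_eq: "lie_monomial L (free_nilpotent_lie_gen K c) w = to_L (single w)"
  by (induction w)
     (simp_all add: free_nilpotent_lie_gen_eq L.h_brk[symmetric] single_fin_supp brk_single)

lemma comp_eq: "comp k = to_L ` homogeneous k"
proof -
  have "lie_monomial L (free_nilpotent_lie_gen K c) ` {w. degree_magma w = k} = to_L ` single ` {w. degree_magma w = k}"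
    by (simp add: image_image lie_monomial_eq)
  moreover have "lin_span K L (to_L ` single ` {w :: 'x magma. degree_magma w = k}) = to_L ` homogeneous k"
  proof (rule L.lin_span_image[OF subgrp_homogeneous homogeneous_fin_supp])
    show "single ` {w :: 'x magma. degree_magma w = k} \<subseteq> homogeneous k"
      by (auto simp: homogeneous_def single_fin_supp) (simp add: single_def split: if_splits)
    fix P :: "('x magma \<Rightarrow> int) set" assume P: "subgrp P" "single ` {w. degree_magma w = k} \<subseteq> P"
    show "homogeneous k \<subseteq> P"
    proof
      fix f :: "'x magma \<Rightarrow> int" assume f: "f \<in> homogeneous k"
      have "f = (\<Sum>w | degree_magma w = k. zsmul (f w) (single w))"
        by (rule sum_singles[OF finite_magma_degree[OF fin]]) (use f in \<open>auto simp: homogeneous_def\<close>)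
      also have "\<dots> \<in> P" by (intro subgrp_sum[OF P(1)] subgrp_zsmul[OF P(1)]) (use P(2) in blast)
      finally show "f \<in> P" .
    qed
  qed
  ultimately show ?thesis by (simp add: homogeneous_component_def)
qed

text \<open>The inverse image in the free nonassociative ring of
  \<open>0 \<oplus> \<dots> \<oplus> 0 \<oplus> V \<oplus> V' \<oplus> L\<^sub>k\<^sub>+\<^sub>2 \<oplus> \<dots> \<oplus> L\<^sub>c\<close>, in terms of word values.\<close>

definition graded_preim :: "nat \<Rightarrow> ('x list \<Rightarrow> rat_mod_int) set \<Rightarrow> ('x list \<Rightarrow> rat_mod_int) set \<Rightarrow> ('x magma \<Rightarrow> int) set"
  where "graded_preim k V V' = {f \<in> fin_supp. (\<forall>j<k. at_length j (word_values f) = 0) \<and>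
    at_length k (word_values f) \<in> V \<and> at_length (Suc k) (word_values f) \<in> V'}"

lemma preim_graded: "L.preim (to_L ` graded_preim k V V') = graded_preim k V V'"
  by (auto simp: L.preim_def graded_preim_def to_L_eq_iff)

lemma subgrp_graded_preim:
  assumes "subgrp V" "subgrp V'"
  shows "subgrp (graded_preim k V V')"
  using assms
  by (auto simp: subgrp_def graded_preim_def L.fin_supp_0 L.fin_supp_diff additive.diff[OF additive_word_values]
      additive.zero[OF additive_word_values] additive.diff[OF additive_at_length] additive.zero[OF additive_at_length])

lemma at_length_0: "at_length 0 (word_values f) = 0"
  by (auto simp: at_length_def word_values_def eval_words_Nil additive.zero[OF additive_residue] fun_eq_iff)

text \<open>A sum of homogeneous elements is decomposed into its terms by the lengths of words, so membership in
  the direct sum is tested degree by degree.\<close>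

lemma component_sum_eq:
  assumes k: "1 \<le> k" "Suc k \<le> c"
    and J: "\<And>j. j \<in> {k..k + 1} \<Longrightarrow> J j \<subseteq> comp j"
  shows "component_sum L c (\<lambda>j. if j < k then {\<zero>\<^bsub>L\<^esub>} else if j \<le> k + 1 then J j else comp j) =
    to_L ` graded_preim k (word_values ` L.preim (J k)) (word_values ` L.preim (J (Suc k)))"
    (is "component_sum L c ?E = to_L ` graded_preim k ?V ?V'")
proof (intro equalityI subsetI)
  fix x assume "x \<in> component_sum L c ?E"
  then obtain y where y: "x = (\<Oplus>\<^bsub>L\<^esub>j\<in>{1..c}. y j)" "\<forall>j\<in>{1..c}. y j \<in> ?E j"
    unfolding component_sum_def by blast
  have "\<exists>f\<in>homogeneous j. y j = to_L f" if j: "j \<in> {1..c}" for j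
  proof -
    have "?E j \<subseteq> comp j"
      using J[of j] subgrp_0[OF subgrp_homogeneous[of j]] by (auto simp: comp_eq L.h_zero[symmetric])
    thus ?thesis using y(2) j unfolding comp_eq by blast
  qed
  then obtain f where f: "\<And>j. j \<in> {1..c} \<Longrightarrow> f j \<in> homogeneous j" "\<And>j. j \<in> {1..c} \<Longrightarrow> y j = to_L (f j)"
    by metis
  have fs: "f j \<in> fin_supp" if "j \<in> {1..c}" for j using f(1)[OF that] homogeneous_fin_supp by blast
  interpret abelian_group L by (rule L.abelian_group)
  have "x = (\<Oplus>\<^bsub>L\<^esub>j\<in>{1..c}. to_L (f j))"
    unfolding y(1) by (rule finsum_cong') (use f(2) L.h_closed[OF fs] in auto)
  also have "\<dots> = to_L (\<Sum>j\<in>{1..c}. f j)" by (rule L.h_sum[symmetric]) (use fs in auto)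
  finally have x: "x = to_L (\<Sum>j\<in>{1..c}. f j)" .
  have at: "at_length i (word_values (\<Sum>j\<in>{1..c}. f j)) = word_values (f i)" if i: "i \<in> {1..c}" for i
  proof -
    have "at_length i (word_values (\<Sum>j\<in>{1..c}. f j)) = (\<Sum>j\<in>{1..c}. at_length i (word_values (f j)))"
      by (simp add: additive.sum[OF additive_word_values] additive.sum[OF additive_at_length])
    also have "\<dots> = (\<Sum>j\<in>{1..c}. if i = j then word_values (f j) else 0)"
      by (rule sum.cong) (use f(1) in \<open>auto simp: at_length_homogeneous\<close>)
    also have "\<dots> = word_values (f i)" using i by (simp add: sum.delta)
    finally show ?thesis .
  qed
  have "(\<Sum>j\<in>{1..c}. f j) \<in> graded_preim k ?V ?V'"
    unfolding graded_preim_def mem_Collect_eq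
  proof (intro conjI allI impI)
    show "(\<Sum>j\<in>{1..c}. f j) \<in> fin_supp" by (intro subgrp_sum[OF subgrp_fin_supp] fs)
    show "at_length i (word_values (\<Sum>j\<in>{1..c}. f j)) = 0" if "i < k" for i
    proof (cases "i = 0")
      case False
      hence i: "i \<in> {1..c}" using that k by auto
      have "y i \<in> ?E i" using y(2) i by blast
      hence "to_L (f i) = to_L 0" using that f(2)[OF i] L.h_zero by simp
      hence "word_values (f i) = word_values 0" using to_L_eq_iff[OF fs[OF i] L.fin_supp_0] by simp
      thus ?thesis using at[OF i] by (simp add: additive.zero[OF additive_word_values])
    qed (simp add: at_length_0)
    have k': "k \<in> {1..c}" "Suc k \<in> {1..c}" using k by auto
    have "f k \<in> L.preim (J k)" "f (Suc k) \<in> L.preim (J (Suc k))"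
      using bspec[OF y(2) k'(1)] bspec[OF y(2) k'(2)] f(2)[OF k'(1)] f(2)[OF k'(2)] fs[OF k'(1)] fs[OF k'(2)]
      by (simp_all add: L.preim_def)
    thus "at_length k (word_values (\<Sum>j\<in>{1..c}. f j)) \<in> ?V"
      "at_length (Suc k) (word_values (\<Sum>j\<in>{1..c}. f j)) \<in> ?V'"
      by (simp_all only: at[OF k'(1)] at[OF k'(2)] imageI)
  qed
  thus "x \<in> to_L ` graded_preim k ?V ?V'" using x by blast
next
  fix x assume "x \<in> to_L ` graded_preim k ?V ?V'"
  then obtain f where f: "f \<in> graded_preim k ?V ?V'" "x = to_L f" by blast
  have fs: "f \<in> fin_supp" using f(1) by (simp add: graded_preim_def)
  define y where "y j = to_L (R.graded_part j f)" for j
  have gs: "R.graded_part j f \<in> fin_supp" for j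
    using graded_part_homogeneous[OF fs] homogeneous_fin_supp by blast
  have "x = to_L (\<Sum>j\<in>{1..c}. R.graded_part j f)"
    unfolding f(2) by (subst to_L_eq_iff) (auto intro!: fs subgrp_sum[OF subgrp_fin_supp] gs simp only: word_values_sum_graded)
  also have "\<dots> = (\<Oplus>\<^bsub>L\<^esub>j\<in>{1..c}. y j)" unfolding y_def by (rule L.h_sum) (use gs in auto)
  finally have x: "x = (\<Oplus>\<^bsub>L\<^esub>j\<in>{1..c}. y j)" .
  have in_J: "y j \<in> H" if "at_length j (word_values f) \<in> word_values ` L.preim H" for j H
  proof -
    from that obtain g where g: "g \<in> L.preim H" "word_values (R.graded_part j f) = word_values g"
      by (auto simp: word_values_graded_part)
    hence "y j = to_L g" unfolding y_def using to_L_eq_iff[OF gs] L.preimD(1) by blast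
    thus ?thesis using g(1) by (simp add: L.preim_def)
  qed
  have "y j \<in> ?E j" if j: "j \<in> {1..c}" for j
  proof -
    consider "j < k" | "j = k" | "j = Suc k" | "Suc k < j" by linarith
    thus ?thesis
    proof cases
      case 1
      hence "word_values (R.graded_part j f) = word_values 0"
        using f(1) by (simp add: word_values_graded_part graded_preim_def additive.zero[OF additive_word_values])
      hence "y j = to_L 0" unfolding y_def using to_L_eq_iff[OF gs L.fin_supp_0] by simp
      thus ?thesis using 1 by (simp add: L.h_zero)
    next
      case 2
      thus ?thesis using in_J[of k "J k"] f(1) by (simp add: graded_preim_def)
    next
      case 3
      thus ?thesis using in_J[of "Suc k" "J (Suc k)"] f(1) by (simp add: graded_preim_def)
    next
      case 4
      thus ?thesis using graded_part_homogeneous[OF fs] by (simp add: comp_eq y_def)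
    qed
  qed
  thus "x \<in> component_sum L c ?E" unfolding component_sum_def using x by blast
qed

end

section \<open>Graded ideals as pairs of subspaces\<close>

lemma bracket_letter_residue:
  "residue p (bracket_letter x g v) = bracket_letter x (\<lambda>v. residue p (g v)) v"
  by (simp add: bracket_letter_def additive.diff[OF additive_residue] additive.minus[OF additive_residue]
      additive.zero[OF additive_residue])

context large_prime
begin

lemma at_length_brk_letter:
  assumes f: "f \<in> fin_supp" and i: "Suc i \<le> c"
  shows "at_length (Suc i) (word_values (brk f (single (Gen x)))) = bracket_letter x (at_length i (word_values f))"
proof
  fix v
  show "at_length (Suc i) (word_values (brk f (single (Gen x)))) v = bracket_letter x (at_length i (word_values f)) v"
  proof (cases "length v = Suc i")
    case True
    have "eval_words (brk f (single (Gen x))) = bracket_letter x (eval_words f)"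
      by (simp only: eval_words_brk[OF fin f single_fin_supp] eval_words_single[OF fin] commutator_letter)
    hence "at_length (Suc i) (word_values (brk f (single (Gen x)))) v = bracket_letter x (\<lambda>v. residue p (eval_words f v)) v"
      using True i by (simp add: at_length_def word_values_def bracket_letter_residue)
    also have "\<dots> = bracket_letter x (at_length i (word_values f)) v"
      using True i by (simp add: bracket_letter_def at_length_def word_values_def)
    finally show ?thesis .
  next
    case False
    have "length v - 1 \<noteq> i" if "v \<noteq> []" using False that by (cases v) auto
    hence "length (butlast v) \<noteq> i" "length (tl v) \<noteq> i" if "v \<noteq> []" using that by simp_all
    thus ?thesis using False by (simp add: at_length_def bracket_letter_def)
  qed
qed

lemma word_values_brk_anti:
  assumes "f \<in> fin_supp" "g \<in> fin_supp"
  shows "word_values (brk f g) = - word_values (brk g f)"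
proof -
  have "eval_words (brk f g) = - eval_words (brk g f)"
    by (simp add: eval_words_brk[OF fin] assms commutator_def)
  thus ?thesis by (auto simp: word_values_def fun_eq_iff additive.minus[OF additive_residue])
qed

text \<open>Elements that start in degree \<open>k\<close> are moved to degree at least \<open>k + 2\<close> by a bracket with a monomial
  of degree at least two.\<close>

lemma at_length_brk_Br:
  assumes g: "g \<in> graded_preim k V V'" and k: "Suc k \<le> c" and j: "j \<le> Suc k"
  shows "at_length j (word_values (brk g (single (Br u w)))) = 0"
proof -
  have gs: "g \<in> fin_supp" using g by (simp add: graded_preim_def)
  have low: "int p dvd eval_words g s" if "length s < k" for s
  proof -
    have "at_length (length s) (word_values g) s = 0" using g that by (simp add: graded_preim_def)
    hence "residue p (eval_words g s) = 0" using that k by (simp add: at_length_def word_values_def)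
    thus ?thesis by (simp add: residue_eq_0_iff[OF p0])
  qed
  have dvd: "int p dvd eval_words g s * lie_coeff (Br u w) t" if "length (s @ t) \<le> Suc k" for s t
  proof (cases "lie_coeff (Br u w) t = 0")
    case False
    hence "length t = degree_magma u + degree_magma w" using lie_coeff_support[of "Br u w" t] by simp
    hence "length s < k" using that degree_magma_pos[of u] degree_magma_pos[of w] by simp
    thus ?thesis using low by simp
  qed simp
  have "int p dvd eval_words (brk g (single (Br u w))) v" if "length v \<le> Suc k" for v
  proof -
    have "int p dvd conv (eval_words g) (lie_coeff (Br u w)) v"
      by (rule dvd_conv, rule dvd) (use that in simp)
    moreover have "int p dvd conv (lie_coeff (Br u w)) (eval_words g) v"
      by (rule dvd_conv, subst mult.commute, rule dvd) (use that in simp)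
    ultimately show ?thesis
      unfolding eval_words_brk[OF fin gs single_fin_supp] eval_words_single[OF fin] commutator_def minus_apply
      by (rule dvd_diff)
  qed
  thus ?thesis
    using j by (auto simp: at_length_def word_values_def residue_eq_0_iff[OF p0] fun_eq_iff)
qed

text \<open>Brackets with monomials of degree two or more are harmless by \<open>at_length_brk_Br\<close>.  A bracket with a
  letter takes degree \<open>k\<close> to degree \<open>k + 1\<close> and degree \<open>k + 1\<close> into the part where nothing is required.\<close>

lemma alg_ideal_graded_iff:
  assumes k: "Suc k \<le> c" and V: "subgrp V" "V \<subseteq> lie k" and V': "subgrp V'"
  shows "alg_ideal K L (to_L ` graded_preim k V V') \<longleftrightarrow> (\<forall>x. bracket_letter x ` V \<subseteq> V')"
proof
  let ?G = "graded_preim k V V'"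
  assume I: "alg_ideal K L (to_L ` ?G)"
  show "\<forall>x. bracket_letter x ` V \<subseteq> V'"
  proof (intro allI image_subsetI)
    fix x u assume u: "u \<in> V"
    then obtain f where f: "f \<in> homogeneous k" "u = word_values f"
      using V(2) word_values_homogeneous[of k] k by auto
    hence "f \<in> ?G"
      using u subgrp_0[OF V'] homogeneous_fin_supp by (auto simp: graded_preim_def at_length_homogeneous)
    hence "brk f (single (Gen x)) \<in> ?G"
      using I single_fin_supp unfolding L.alg_ideal_iff preim_graded by blast
    hence "at_length (Suc k) (word_values (brk f (single (Gen x)))) \<in> V'" by (simp add: graded_preim_def)
    moreover have "f \<in> fin_supp" using f(1) homogeneous_fin_supp by blast
    ultimately show "bracket_letter x u \<in> V'"
      using f k by (simp add: at_length_brk_letter at_length_homogeneous)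
  qed
next
  let ?G = "graded_preim k V V'"
  assume B: "\<forall>x. bracket_letter x ` V \<subseteq> V'"
  have G: "subgrp ?G" by (rule subgrp_graded_preim[OF V(1) V'])
  have right: "brk g f \<in> ?G" if g: "g \<in> ?G" and f: "f \<in> fin_supp" for f g
  proof -
    have gs: "g \<in> fin_supp" using g by (simp add: graded_preim_def)
    have "f \<in> {f. brk g f \<in> ?G}"
    proof (rule fin_supp_induct[OF f subgrp_vimage[OF additive_brk_right G]])
      fix w
      show "single w \<in> {f. brk g f \<in> ?G}"
      proof (cases w)
        case (Br u v)
        have "at_length j (word_values (brk g (single w))) = 0" if "j \<le> Suc k" for j
          unfolding Br by (rule at_length_brk_Br[OF g k that])
        thus ?thesis
          using subgrp_0[OF V(1)] subgrp_0[OF V'] brk_fin_supp[OF gs single_fin_supp] by (simp add: graded_preim_def)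
      next
        case (Gen x)
        have at: "at_length (Suc i) (word_values (brk g (single w))) = bracket_letter x (at_length i (word_values g))"
          if "i \<le> k" for i
          unfolding Gen by (rule at_length_brk_letter[OF gs]) (use that k in simp)
        have z: "bracket_letter x (0 :: 'x list \<Rightarrow> rat_mod_int) = 0" by (rule additive.zero[OF additive_bracket_letter])
        have low: "at_length j (word_values (brk g (single w))) = 0" if "j \<le> k" for j
        proof (cases j)
          case 0
          thus ?thesis by (simp only: at_length_0)
        next
          case (Suc i)
          have "at_length i (word_values g) = 0" using g Suc that by (simp add: graded_preim_def)
          thus ?thesis using at[of i] Suc that z by simp
        qed
        have "at_length (Suc k) (word_values (brk g (single w))) \<in> V'"
          using at[of k] B g by (auto simp: graded_preim_def)
        thus ?thesis
          using low subgrp_0[OF V(1)] brk_fin_supp[OF gs single_fin_supp] by (simp add: graded_preim_def)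
      qed
    qed
    thus ?thesis by simp
  qed
  have left: "brk f g \<in> ?G" if g: "g \<in> ?G" and f: "f \<in> fin_supp" for f g
  proof -
    have gs: "g \<in> fin_supp" using g by (simp add: graded_preim_def)
    have "- brk g f \<in> ?G" by (rule subgrp_minus[OF G right[OF g f]])
    moreover have "word_values (brk f g) = word_values (- brk g f)"
      using word_values_brk_anti[OF f gs] by (simp add: additive.minus[OF additive_word_values])
    ultimately show ?thesis using brk_fin_supp[OF f gs] by (simp add: graded_preim_def)
  qed
  have "to_L ` ?G \<subseteq> carrier L" using L.h_closed by (auto simp: graded_preim_def)
  thus "alg_ideal K L (to_L ` ?G)"
    unfolding L.alg_ideal_iff preim_graded using G left right by blast
qed

definition pairs :: "nat \<Rightarrow> (('x list \<Rightarrow> rat_mod_int) set \<times> ('x list \<Rightarrow> rat_mod_int) set) set"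
  where "pairs k = {(V, V'). subgrp V \<and> V \<subseteq> lie k \<and> subgrp V' \<and> V' \<subseteq> lie (Suc k) \<and>
    (\<forall>x. bracket_letter x ` V \<subseteq> V')}"

text \<open>An ideal in the stated form gives the subspaces as word values of its components.  Conversely the
  components are recovered from the subspaces as images of homogeneous elements.\<close>

lemma step_graded_ideals:
  assumes k: "1 \<le> k" "Suc k \<le> c"
  shows "{I. step_graded_ideal K L comp c k 1 I} = (\<lambda>(V, V'). to_L ` graded_preim k V V') ` pairs k"
proof (intro equalityI subsetI)
  fix I assume "I \<in> {I. step_graded_ideal K L comp c k 1 I}"
  hence "step_graded_ideal K L comp c k 1 I" by (rule CollectD)
  hence step: "alg_ideal K L I \<and> (\<exists>J. (\<forall>j\<in>{k..k+1}. submodule (J j) K L \<and> J j \<subseteq> comp j) \<and>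
      I = component_sum L c (\<lambda>j. if j < k then {\<zero>\<^bsub>L\<^esub>} else if j \<le> k + 1 then J j else comp j))"
    by (simp only: step_graded_ideal_def)
  have I: "alg_ideal K L I" by (rule conjunct1[OF step])
  from conjunct2[OF step] obtain J where J: "\<forall>j\<in>{k..k+1}. submodule (J j) K L \<and> J j \<subseteq> comp j"
      "I = component_sum L c (\<lambda>j. if j < k then {\<zero>\<^bsub>L\<^esub>} else if j \<le> k + 1 then J j else comp j)"
    by (elim exE conjE)
  let ?V = "word_values ` L.preim (J k)" and ?V' = "word_values ` L.preim (J (Suc k))"
  have IG: "I = to_L ` graded_preim k ?V ?V'"
    unfolding J(2) by (rule component_sum_eq[OF k, of J]) (use J(1) in blast)
  have sub: "subgrp (word_values ` L.preim (J j)) \<and> word_values ` L.preim (J j) \<subseteq> lie j" if j: "j \<in> {k, Suc k}" for j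
  proof
    have Jj: "submodule (J j) K L" "J j \<subseteq> comp j" using J(1) j by auto
    show "subgrp (word_values ` L.preim (J j))"
      using Jj(1) by (intro subgrp_image[OF additive_word_values]) (simp add: L.submodule_iff)
    show "word_values ` L.preim (J j) \<subseteq> lie j"
    proof (rule image_subsetI)
      fix f assume f: "f \<in> L.preim (J j)"
      then obtain g where g: "g \<in> homogeneous j" "to_L f = to_L g" using Jj(2) by (auto simp: L.preim_def comp_eq)
      hence "word_values f = word_values g"
        using to_L_eq_iff[of f g] L.preimD(1)[OF f] homogeneous_fin_supp by blast
      hence "word_values f \<in> word_values ` homogeneous j" using g(1) by blast
      moreover have "j \<le> c" using j k by auto
      ultimately show "word_values f \<in> lie j" by (simp only: word_values_homogeneous)
    qed
  qed
  have "(?V, ?V') \<in> pairs k"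
  proof -
    have V: "subgrp ?V" "?V \<subseteq> lie k" and V': "subgrp ?V'" "?V' \<subseteq> lie (Suc k)"
      using sub[of k] sub[of "Suc k"] by blast+
    have "\<forall>x. bracket_letter x ` ?V \<subseteq> ?V'"
      using I unfolding IG by (rule alg_ideal_graded_iff[OF k(2) V V'(1), THEN iffD1])
    with V V' show ?thesis unfolding pairs_def by blast
  qed
  thus "I \<in> (\<lambda>(V, V'). to_L ` graded_preim k V V') ` pairs k" using IG by blast
next
  fix I assume "I \<in> (\<lambda>(V, V'). to_L ` graded_preim k V V') ` pairs k"
  then obtain x where x: "x \<in> pairs k" "I = (case x of (V, V') \<Rightarrow> to_L ` graded_preim k V V')" by (rule imageE)
  obtain V V' where "x = (V, V')" by (cases x)
  with x have P: "(V, V') \<in> pairs k" and I: "I = to_L ` graded_preim k V V'" by simp_all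
  define H where "H j = {f \<in> homogeneous j. word_values f \<in> (if j = k then V else V')}" for j
  have H: "subgrp (H j)" for j
  proof -
    have "H j = homogeneous j \<inter> {f. word_values f \<in> (if j = k then V else V')}" by (auto simp: H_def)
    thus ?thesis using P
      by (auto simp: pairs_def intro!: subgrp_Int subgrp_homogeneous subgrp_vimage[OF additive_word_values])
  qed
  have Hfs: "H j \<subseteq> fin_supp" for j using homogeneous_fin_supp by (auto simp: H_def)
  have J: "submodule (to_L ` H j) K L" "to_L ` H j \<subseteq> comp j" for j
    using L.submodule_image[OF H Hfs] by (auto simp: comp_eq H_def)
  have vals: "word_values ` L.preim (to_L ` H j) = (if j = k then V else V')" if j: "j = k \<or> j = Suc k" for j
  proof -
    have "word_values ` L.preim (to_L ` H j) = word_values ` H j"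
    proof (intro equalityI subsetI)
      fix g assume "g \<in> word_values ` L.preim (to_L ` H j)"
      then obtain f f' where f: "f \<in> fin_supp" "g = word_values f" "f' \<in> H j" "to_L f = to_L f'"
        by (auto simp: L.preim_def)
      have "word_values f = word_values f'"
        using to_L_eq_iff[OF f(1) subsetD[OF Hfs f(3)]] f(4) by simp
      thus "g \<in> word_values ` H j" using f(2,3) by simp
    next
      fix g assume "g \<in> word_values ` H j"
      thus "g \<in> word_values ` L.preim (to_L ` H j)" using Hfs by (auto simp: L.preim_def)
    qed
    also have "\<dots> = lie j \<inter> (if j = k then V else V')"
    proof -
      have "j \<le> c" using j k by auto
      from word_values_homogeneous[OF this, symmetric] show ?thesis by (simp only: H_def) blast
    qed
    also have "\<dots> = (if j = k then V else V')" using P j by (auto simp: pairs_def)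
    finally show ?thesis .
  qed
  have eq: "I = component_sum L c (\<lambda>j. if j < k then {\<zero>\<^bsub>L\<^esub>} else if j \<le> k + 1 then to_L ` H j else comp j)"
    unfolding I using component_sum_eq[OF k, of "\<lambda>j. to_L ` H j"] J(2) vals[of k] vals[of "Suc k"] by simp
  have ideal: "alg_ideal K L I"
    unfolding I using P by (subst alg_ideal_graded_iff[OF k(2)]) (auto simp: pairs_def)
  show "I \<in> {I. step_graded_ideal K L comp c k 1 I}"
    unfolding step_graded_ideal_def mem_Collect_eq
    by (intro conjI exI[of _ "\<lambda>j. to_L ` H j"] ballI ideal J eq)
qed

lemma graded_preim_homogeneous:
  assumes k: "1 \<le> k" "Suc k \<le> c" and P: "(V, V') \<in> pairs k"
  shows "word_values ` (graded_preim k V V' \<inter> homogeneous k) = V"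
    and "word_values ` (graded_preim k V V' \<inter> homogeneous (Suc k)) = V'"
proof -
  have V: "subgrp V" "V \<subseteq> word_values ` homogeneous k" and V': "subgrp V'" "V' \<subseteq> word_values ` homogeneous (Suc k)"
    using P k by (auto simp: pairs_def word_values_homogeneous)
  have "f \<in> graded_preim k V V' \<longleftrightarrow> word_values f \<in> V" if "f \<in> homogeneous k" for f
    using that subgrp_0[OF V'(1)] homogeneous_fin_supp by (auto simp: graded_preim_def at_length_homogeneous)
  thus "word_values ` (graded_preim k V V' \<inter> homogeneous k) = V" using V(2) by blast
  have "f \<in> graded_preim k V V' \<longleftrightarrow> word_values f \<in> V'" if "f \<in> homogeneous (Suc k)" for f
    using that subgrp_0[OF V(1)] homogeneous_fin_supp by (auto simp: graded_preim_def at_length_homogeneous)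
  thus "word_values ` (graded_preim k V V' \<inter> homogeneous (Suc k)) = V'" using V'(2) by blast
qed

lemma inj_on_graded_ideal:
  assumes k: "1 \<le> k" "Suc k \<le> c"
  shows "inj_on (\<lambda>(V, V'). to_L ` graded_preim k V V') (pairs k)"
proof (rule inj_onI)
  fix x y assume x: "x \<in> pairs k" and y: "y \<in> pairs k"
    and eq: "(case x of (V, V') \<Rightarrow> to_L ` graded_preim k V V') = (case y of (V, V') \<Rightarrow> to_L ` graded_preim k V V')"
  obtain V V' W W' where xy: "x = (V, V')" "y = (W, W')" by (cases x, cases y)
  have "L.preim (to_L ` graded_preim k V V') = L.preim (to_L ` graded_preim k W W')"
    using eq unfolding xy prod.case by (rule arg_cong)
  hence "graded_preim k V V' = graded_preim k W W'" by (simp only: preim_graded)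
  thus "x = y" using graded_preim_homogeneous[OF k x[unfolded xy]] graded_preim_homogeneous[OF k y[unfolded xy]]
    by (simp add: xy)
qed

text \<open>Word values and classes in \<open>L\<close> identify the same elements.\<close>

lemma card_to_L_image:
  assumes H: "H \<subseteq> fin_supp"
  shows "card (to_L ` H) = card (word_values ` H)"
proof -
  \<comment> \<open>The bijection from classes to word values, through a choice of representatives.\<close>
  define \<Psi> where "\<Psi> x = word_values (SOME f. f \<in> fin_supp \<and> to_L f = x)" for x
  have \<Psi>: "\<Psi> (to_L f) = word_values f" if f: "f \<in> fin_supp" for f
  proof -
    have "(SOME g. g \<in> fin_supp \<and> to_L g = to_L f) \<in> fin_supp \<and> to_L (SOME g. g \<in> fin_supp \<and> to_L g = to_L f) = to_L f"
      by (rule someI[of _ f]) (use f in simp)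
    thus ?thesis unfolding \<Psi>_def using to_L_eq_iff[OF _ f] by blast
  qed
  have "inj_on \<Psi> (to_L ` H)"
    using H by (auto simp: inj_on_def \<Psi> to_L_eq_iff subset_iff)
  from card_image[OF this] show ?thesis using H by (simp add: image_image \<Psi> subset_iff cong: image_cong)
qed

text \<open>This is the theorem of Lagrange in the additive group of the larger subspace.\<close>

lemma add_index_mult_card:
  assumes P: "subgrp P" "P \<subseteq> fin_supp" and Q: "subgrp Q" "Q \<subseteq> P" and fin: "finite (word_values ` P)"
  shows "add_index L (to_L ` P) (to_L ` Q) * card (word_values ` Q) = card (word_values ` P)"
proof -
  interpret abelian_group L by (rule L.abelian_group)
  have "0 \<in> P" using subgrp_0[OF P(1)] .
  hence "card (to_L ` P) > 0" unfolding card_to_L_image[OF P(2)] using fin by (auto simp: card_gt_0_iff)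
  hence finP: "finite (to_L ` P)" by (rule card_ge_0_finite)
  have sP: "subgroup (to_L ` P) (add_monoid L)"
    using L.submodule_image[OF P] by (rule submodule.axioms(1))
  have sQ: "subgroup (to_L ` Q) (add_monoid L)"
    using L.submodule_image[OF Q(1)] P(2) Q(2) by (blast dest: submodule.axioms(1))
  let ?G = "add_monoid (L\<lparr>carrier := to_L ` P\<rparr>)"
  have G: "?G = (add_monoid L)\<lparr>carrier := to_L ` P\<rparr>" by simp
  have group: "group ?G" unfolding G by (rule group.subgroup_imp_group[OF a_group sP])
  have sub: "subgroup (to_L ` Q) ?G" unfolding G
    by (rule group.subgroup_incl[OF a_group sQ sP]) (use Q(2) in blast)
  have "card (rcosets\<^bsub>?G\<^esub> (to_L ` Q)) * card (to_L ` Q) = Coset.order ?G"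
    by (rule group.lagrange_finite[OF group _ sub]) (use finP in simp)
  moreover have "Coset.order ?G = card (to_L ` P)" by (simp add: Coset.order_def)
  moreover have "card (to_L ` Q) = card (word_values ` Q)" using P(2) Q(2) by (intro card_to_L_image) blast
  ultimately show ?thesis by (simp add: add_index_def A_RCOSETS_def card_to_L_image[OF P(2)])
qed

lemma finite_lie: "finite (lie k)"
  by (rule elementary_finite[OF elementary_lie_polys[OF fin elementary_residues_mod[OF p0]]])

lemma add_index_graded:
  assumes k: "1 \<le> k" "Suc k \<le> c" and P: "(V, V') \<in> pairs k"
  shows "add_index L (comp k) (to_L ` graded_preim k V V' \<inter> comp k) * card V = card (lie k)"
    and "add_index L (comp (Suc k)) (to_L ` graded_preim k V V' \<inter> comp (Suc k)) * card V' = card (lie (Suc k))"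
proof -
  let ?G = "graded_preim k V V'"
  have G: "subgrp ?G" using P by (intro subgrp_graded_preim) (auto simp: pairs_def)
  have inter: "to_L ` ?G \<inter> comp j = to_L ` (?G \<inter> homogeneous j)" for j
  proof (intro equalityI subsetI)
    fix x assume "x \<in> to_L ` ?G \<inter> comp j"
    then obtain f where f: "f \<in> homogeneous j" "x = to_L f" "to_L f \<in> to_L ` ?G" by (auto simp: comp_eq)
    hence "f \<in> L.preim (to_L ` ?G)" using homogeneous_fin_supp by (auto simp: L.preim_def)
    thus "x \<in> to_L ` (?G \<inter> homogeneous j)" using f by (auto simp: preim_graded)
  qed (auto simp: comp_eq)
  have index: "add_index L (comp j) (to_L ` ?G \<inter> comp j) * card (word_values ` (?G \<inter> homogeneous j)) = card (lie j)"
    if j: "j \<le> c" for j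
  proof -
    have "add_index L (to_L ` homogeneous j) (to_L ` (?G \<inter> homogeneous j)) * card (word_values ` (?G \<inter> homogeneous j))
        = card (word_values ` homogeneous j)"
      by (rule add_index_mult_card[OF subgrp_homogeneous homogeneous_fin_supp subgrp_Int[OF G subgrp_homogeneous]])
         (auto simp: word_values_homogeneous[OF j] finite_lie)
    thus ?thesis unfolding inter unfolding comp_eq word_values_homogeneous[OF j] .
  qed
  show "add_index L (comp k) (to_L ` ?G \<inter> comp k) * card V = card (lie k)"
    using index[of k] k graded_preim_homogeneous(1)[OF k P] by simp
  show "add_index L (comp (Suc k)) (to_L ` ?G \<inter> comp (Suc k)) * card V' = card (lie (Suc k))"
    using index[of "Suc k"] k graded_preim_homogeneous(2)[OF k P] by simp
qed

end

section \<open>The zeta function\<close>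

lemma of_nat_power_powr: "(of_nat (p ^ m) :: complex) powr z = (of_nat p powr z) ^ m" if "p > 0"
proof (induction m)
  case (Suc m)
  have "(of_nat (p ^ Suc m) :: complex) powr z = (of_nat p * of_nat (p ^ m)) powr z" by simp
  also have "\<dots> = of_nat p powr z * of_nat (p ^ m) powr z"
    by (rule powr_times_real) simp_all
  finally show ?case using Suc by simp
qed simp

context large_prime
begin

lemma finite_pairs: "finite (pairs k)"
proof (rule finite_subset)
  show "pairs k \<subseteq> Pow (lie k) \<times> Pow (lie (Suc k))" by (auto simp: pairs_def)
qed (simp add: finite_lie)

text \<open>The sum over the ideals becomes a sum over pairs of subspaces, which are grouped by their
  dimensions \<open>a\<close> and \<open>b\<close>; both indices are powers of \<open>p\<close> with the codimensions as exponents.\<close>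

theorem step_ideal_zeta_eq:
  assumes xy: "(UNIV :: 'x set) = {x, y}"
    and d: "\<And>k. 1 \<le> k \<Longrightarrow> k \<le> c \<Longrightarrow> card (lie k) = p ^ d k"
  shows "step_ideal_zeta K L comp c 1 s =
    (\<Sum>k=1..c - 1. \<Sum>(a, b)\<in>{..d k} \<times> {..d (Suc k)}.
      of_nat (card (subreps (bracket_letter x) (bracket_letter y) (lie k) (lie (Suc k)) (p ^ a) (p ^ b))) *
      (of_nat p powr (- s)) ^ (d k - a + (d (Suc k) - b)))"
  unfolding step_ideal_zeta_def
proof (rule sum.cong[OF refl])
  fix k assume "k \<in> {1..c - 1}"
  hence k: "1 \<le> k" "Suc k \<le> c" by auto
  have p1: "p > 1" using prime by (rule prime_gt_1_nat)
  have el: "elementary p (lie j)" for j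
    by (rule elementary_lie_polys[OF fin elementary_residues_mod[OF p0]])
  let ?z = "of_nat p powr (- s) :: complex"
  let ?r = "\<lambda>(V, V'). (prank p V, prank p V')"
  let ?I = "\<lambda>(V, V'). to_L ` graded_preim k V V'"
  have rank: "card H = p ^ prank p H" "prank p H \<le> d j"
    if "subgrp H" "H \<subseteq> lie j" and j: "1 \<le> j" "j \<le> c" for H j
  proof -
    show c: "card H = p ^ prank p H"
      by (rule card_elementary[OF prime elementary_subset[OF el that(1,2)]])
    have "card H \<le> card (lie j)" using that(2) finite_lie by (rule card_mono[rotated])
    thus "prank p H \<le> d j" using c d[OF j] p1 by simp
  qed
  have index: "of_nat i powr (- s) = ?z ^ (d j - prank p H)"
    if "i * card H = card (lie j)" "subgrp H" "H \<subseteq> lie j" and j: "1 \<le> j" "j \<le> c" for i j H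
  proof -
    have "i * p ^ prank p H = p ^ (d j - prank p H) * p ^ prank p H"
      using that(1) rank[OF that(2,3) j] d[OF j] by (simp flip: power_add)
    hence "i = p ^ (d j - prank p H)" using p1 by simp
    thus ?thesis using of_nat_power_powr[OF p0] by simp
  qed
  have factor: "(\<Prod>j=k..k+1. of_nat (add_index L (comp j) (?I x \<inter> comp j)) powr (- s)) =
      (\<lambda>(a, b). ?z ^ (d k - a + (d (Suc k) - b))) (?r x)" if "x \<in> pairs k" for x
  proof -
    obtain V V' where x: "x = (V, V')" by (cases x)
    have P: "(V, V') \<in> pairs k" using that x by simp
    have V: "subgrp V" "V \<subseteq> lie k" "subgrp V'" "V' \<subseteq> lie (Suc k)" using P by (auto simp: pairs_def)
    have "{k..k+1} = {k, Suc k}" by auto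
    hence "(\<Prod>j=k..k+1. of_nat (add_index L (comp j) (?I x \<inter> comp j)) powr (- s)) =
        of_nat (add_index L (comp k) (?I x \<inter> comp k)) powr (- s) *
        of_nat (add_index L (comp (Suc k)) (?I x \<inter> comp (Suc k))) powr (- s)" by simp
    also have "\<dots> = ?z ^ (d k - prank p V) * ?z ^ (d (Suc k) - prank p V')"
      using index[OF add_index_graded(1)[OF k P] V(1,2)] index[OF add_index_graded(2)[OF k P] V(3,4)] k
      by (simp add: x)
    finally show ?thesis by (simp add: x power_add)
  qed
  have "(\<Sum>I | step_graded_ideal K L comp c k 1 I. \<Prod>j=k..k+1. of_nat (add_index L (comp j) (I \<inter> comp j)) powr (- s)) =
      (\<Sum>x\<in>pairs k. \<Prod>j=k..k+1. of_nat (add_index L (comp j) (?I x \<inter> comp j)) powr (- s))"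
    unfolding step_graded_ideals[OF k] by (rule sum.reindex_cong[OF inj_on_graded_ideal[OF k] refl refl])
  also have "\<dots> = (\<Sum>x\<in>pairs k. (\<lambda>(a, b). ?z ^ (d k - a + (d (Suc k) - b))) (?r x))"
    by (rule sum.cong[OF refl factor])
  also have "\<dots> = (\<Sum>q\<in>{..d k} \<times> {..d (Suc k)}. \<Sum>x\<in>{x \<in> pairs k. ?r x = q}.
      (\<lambda>(a, b). ?z ^ (d k - a + (d (Suc k) - b))) (?r x))"
  proof (rule sum.group[symmetric, OF finite_pairs])
    show "?r ` pairs k \<subseteq> {..d k} \<times> {..d (Suc k)}"
    proof (rule image_subsetI)
      fix q assume "q \<in> pairs k"
      moreover obtain V V' where q: "q = (V, V')" by (cases q)
      ultimately have V: "subgrp V" "V \<subseteq> lie k" "subgrp V'" "V' \<subseteq> lie (Suc k)"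
        by (auto simp: pairs_def)
      show "?r q \<in> {..d k} \<times> {..d (Suc k)}"
        using rank(2)[OF V(1,2)] rank(2)[OF V(3,4)] k by (simp add: q)
    qed
  qed simp
  also have "\<dots> = (\<Sum>(a, b)\<in>{..d k} \<times> {..d (Suc k)}.
      of_nat (card (subreps (bracket_letter x) (bracket_letter y) (lie k) (lie (Suc k)) (p ^ a) (p ^ b))) *
      ?z ^ (d k - a + (d (Suc k) - b)))"
  proof (rule sum.cong[OF refl], clarify)
    fix a b
    have all: "(\<forall>z. P z) \<longleftrightarrow> P x \<and> P y" for P :: "'x \<Rightarrow> bool"
      using xy by (metis UNIV_I insertE singletonD)
    have "(V, V') \<in> pairs k \<and> ?r (V, V') = (a, b) \<longleftrightarrow>
        (V, V') \<in> subreps (bracket_letter x) (bracket_letter y) (lie k) (lie (Suc k)) (p ^ a) (p ^ b)" for V V'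
    proof -
      have "card V = p ^ a \<longleftrightarrow> prank p V = a" if "subgrp V" "V \<subseteq> lie k"
        using rank(1)[OF that] k p1 by simp
      moreover have "card V' = p ^ b \<longleftrightarrow> prank p V' = b" if "subgrp V'" "V' \<subseteq> lie (Suc k)"
        using rank(1)[OF that] k p1 by simp
      ultimately show ?thesis
        by (auto simp: pairs_def subreps_def subgrps_between_def all subgrp_0)
    qed
    hence "{q \<in> pairs k. ?r q = (a, b)} =
        subreps (bracket_letter x) (bracket_letter y) (lie k) (lie (Suc k)) (p ^ a) (p ^ b)"
      by auto
    moreover have "(\<Sum>q\<in>{q \<in> pairs k. ?r q = (a, b)}. (\<lambda>(a, b). ?z ^ (d k - a + (d (Suc k) - b))) (?r q)) =
        (\<Sum>q\<in>{q \<in> pairs k. ?r q = (a, b)}. ?z ^ (d k - a + (d (Suc k) - b)))"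
      by (rule sum.cong) auto
    ultimately show "(\<Sum>q\<in>{q \<in> pairs k. ?r q = (a, b)}. (\<lambda>(a, b). ?z ^ (d k - a + (d (Suc k) - b))) (?r q)) =
        of_nat (card (subreps (bracket_letter x) (bracket_letter y) (lie k) (lie (Suc k)) (p ^ a) (p ^ b))) *
        ?z ^ (d k - a + (d (Suc k) - b))"
      by simp
  qed
  finally show "(\<Sum>I | step_graded_ideal K L comp c k 1 I. \<Prod>j=k..k+1. of_nat (add_index L (comp j) (I \<inter> comp j)) powr (- s)) =
      (\<Sum>(a, b)\<in>{..d k} \<times> {..d (Suc k)}.
      of_nat (card (subreps (bracket_letter x) (bracket_letter y) (lie k) (lie (Suc k)) (p ^ a) (p ^ b))) *
      ?z ^ (d k - a + (d (Suc k) - b)))" .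
qed

end

lemma eval_XY_add: "eval_XY (V + W) x y = eval_XY V x y + eval_XY W x y"
proof -
  have rat: "map_poly of_rat (q + r) = (map_poly of_rat q + map_poly of_rat r :: complex poly)" for q r
    by (rule poly_eqI) (simp add: coeff_map_poly of_rat_add)
  let ?\<phi> = "\<lambda>q. poly (map_poly of_rat q) x"
  have "map_poly ?\<phi> (V + W) = map_poly ?\<phi> V + map_poly ?\<phi> W"
    by (rule poly_eqI) (simp add: coeff_map_poly rat)
  thus ?thesis by (simp add: eval_XY_def)
qed

lemma eval_XY_0: "eval_XY 0 x y = 0"
  by (simp add: eval_XY_def)

lemma eval_XY_sum: "eval_XY (\<Sum>i\<in>S. W i) x y = (\<Sum>i\<in>S. eval_XY (W i) x y)"
  by (induction S rule: infinite_finite_induct) (auto simp: eval_XY_0 eval_XY_add)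

lemma eval_XY_monom:
  "eval_XY (monom (map_poly of_int P) n) (of_nat p) y = of_int (poly P (int p)) * y ^ n"
proof -
  have "map_poly of_rat (map_poly of_int P) = (map_poly of_int P :: complex poly)"
    by (rule poly_eqI) (simp add: coeff_map_poly)
  moreover have "poly (map_poly of_int P) (of_nat p) = (of_int (poly P (int p)) :: complex)"
    by (induction P) (simp_all add: map_poly_pCons)
  ultimately show ?thesis by (simp add: eval_XY_def map_poly_monom poly_monom)
qed

lemma UNIV_two_generators: "(UNIV :: two_generators set) = {X1, X2}"
  using two_generators.exhaust by blast

theorem theorem1p8:
  fixes c :: nat
  assumes "c \<ge> 1"
  shows "\<exists>W :: rat poly poly.
    finite {p :: nat. prime p \<and>
      \<not> (\<forall>s :: complex. zeta_f2 c p 1 s = eval_XY W (of_nat p) (of_nat p powr (- s)))}"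
proof -
  let ?lie = "\<lambda>p k. lie_polys (residues_mod p) k :: (two_generators list \<Rightarrow> rat_mod_int) set"
  let ?count = "\<lambda>p k a b. card (subreps (bracket_letter X1) (bracket_letter X2) (?lie p k) (?lie p (Suc k)) (p ^ a) (p ^ b))"
  have fin: "finite (UNIV :: two_generators set)" by (simp add: UNIV_two_generators)
  have "\<forall>k. \<exists>d N. \<forall>p. prime p \<longrightarrow> N < p \<longrightarrow> card (?lie p k) = p ^ d"
  proof
    fix k
    obtain d N where "\<forall>p (T :: rat_mod_int set). prime p \<longrightarrow> N < p \<longrightarrow> elementary p T \<longrightarrow> card T = p \<longrightarrow>
        card (lie_polys T k :: (two_generators list \<Rightarrow> rat_mod_int) set) = p ^ d"
      using card_lie_polys[OF fin, where k = k] by blast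
    hence "\<forall>p. prime p \<longrightarrow> N < p \<longrightarrow> card (?lie p k) = p ^ d"
      by (simp add: prime_gt_0_nat elementary_residues_mod card_residues_mod)
    thus "\<exists>d N. \<forall>p. prime p \<longrightarrow> N < p \<longrightarrow> card (?lie p k) = p ^ d" by blast
  qed
  from choice[OF this] obtain d where "\<forall>k. \<exists>N. \<forall>p. prime p \<longrightarrow> N < p \<longrightarrow> card (?lie p k) = p ^ d k"
    by blast
  from choice[OF this] obtain N where N: "\<forall>k p. prime p \<longrightarrow> N k < p \<longrightarrow> card (?lie p k) = p ^ d k"
    by blast
  have "\<forall>k. \<exists>M. 1 \<le> k \<longrightarrow> (\<forall>a b. poly_on {p. prime p \<and> M < p} (\<lambda>p. int (?count p k a b)))"
    using poly_on_subreps_lie_polys[OF UNIV_two_generators two_generators.distinct(1)] by blast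
  from choice[OF this] obtain M where
    M: "\<forall>k. 1 \<le> k \<longrightarrow> (\<forall>a b. poly_on {p. prime p \<and> M k < p} (\<lambda>p. int (?count p k a b)))"
    by blast
  have "\<exists>P. 1 \<le> k \<longrightarrow> (\<forall>p. prime p \<longrightarrow> M k < p \<longrightarrow> int (?count p k a b) = poly P (int p))" for k a b
    using M unfolding poly_on_def by (metis (mono_tags, lifting) mem_Collect_eq)
  then obtain P where P: "\<And>k a b p. 1 \<le> k \<Longrightarrow> prime p \<Longrightarrow> M k < p \<Longrightarrow> int (?count p k a b) = poly (P k a b) (int p)"
    by metis
  \<comment> \<open>Only finitely many levels \<open>k\<close> occur, so one bound serves for all of them.\<close>
  define B where "B = Max (insert c (N ` {1..c} \<union> M ` {1..c}))"
  have B: "c \<le> B" "\<And>k. k \<in> {1..c} \<Longrightarrow> N k \<le> B" "\<And>k. k \<in> {1..c} \<Longrightarrow> M k \<le> B"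
    unfolding B_def by (rule Max_ge; simp)+
  define W :: "rat poly poly" where "W = (\<Sum>k=1..c - 1. \<Sum>(a, b)\<in>{..d k} \<times> {..d (Suc k)}.
    monom (map_poly of_int (P k a b)) (d k - a + (d (Suc k) - b)))"
  have zeta: "zeta_f2 c p 1 s = eval_XY W (of_nat p) (of_nat p powr (- s))" if p: "prime p" "B < p" for p s
  proof -
    interpret large_prime p c "TYPE(two_generators)"
      by unfold_locales (use p B(1) fin in auto)
    have "zeta_f2 c p 1 s = step_ideal_zeta K L comp c 1 s" by (simp add: zeta_f2_def Let_def)
    also have "\<dots> = (\<Sum>k=1..c - 1. \<Sum>(a, b)\<in>{..d k} \<times> {..d (Suc k)}.
        of_nat (?count p k a b) * (of_nat p powr (- s)) ^ (d k - a + (d (Suc k) - b)))"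
    proof (rule step_ideal_zeta_eq[OF UNIV_two_generators])
      fix k assume "1 \<le> k" "k \<le> c"
      thus "card (lie k) = p ^ d k" using N p B(2)[of k] by simp
    qed
    also have "\<dots> = eval_XY W (of_nat p) (of_nat p powr (- s))"
      unfolding W_def eval_XY_sum
    proof (intro sum.cong refl, clarify)
      fix k a b assume "k \<in> {1..c - 1}"
      hence k: "k \<in> {1..c}" by auto
      hence "int (?count p k a b) = poly (P k a b) (int p)"
        using p B(3)[OF k] by (intro P) auto
      hence "(of_nat (?count p k a b) :: complex) = of_int (poly (P k a b) (int p))"
        by (metis of_int_of_nat_eq)
      thus "of_nat (?count p k a b) * (of_nat p powr (- s)) ^ (d k - a + (d (Suc k) - b)) =
          eval_XY (monom (map_poly of_int (P k a b)) (d k - a + (d (Suc k) - b))) (of_nat p) (of_nat p powr (- s))"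
        by (simp only: eval_XY_monom)
    qed
    finally show ?thesis .
  qed
  have "{p. prime p \<and> \<not> (\<forall>s. zeta_f2 c p 1 s = eval_XY W (of_nat p) (of_nat p powr (- s)))} \<subseteq> {..B}"
    using zeta by (auto simp: not_le[symmetric])
  hence "finite {p. prime p \<and> \<not> (\<forall>s. zeta_f2 c p 1 s = eval_XY W (of_nat p) (of_nat p powr (- s)))}"
    by (rule finite_subset) simp
  thus ?thesis by blast
qed

end
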